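(* Let $k>2$, let $\varphi_k:(\mathbb{C}^{2k-2},0)\to(\mathbb{C}^{2k-1},0)$ be the complex minimal cross cap mapping of multiplicity $k$, and let $h:(\mathbb{C}^{2k-1},0)\to(\mathbb{C},0)$ be the linear map \[ h=\sum_{i=1}^{k-2}\alpha_iU_i+\sum_{i=1}^{k-1}\beta_iV_i+\gamma_1W_1+\gamma_2W_2,\qquad \alpha_i,\beta_i,\gamma_i\in\mathbb{C}. \] Suppose that $\alpha_{k-2}$ and $\beta_{k-1}$ are non-zero and that $g:(\mathbb{C}^{2k-2},0)\to(\mathbb{C}^{2k-1},0)$ is an immersion parametrizing $h^{-1}(0)$. Then the pullback $g^*(\varphi_k)$ has $\mathcal{A}_e$-codimension $1$: \[ \mathcal{A}_e\text{-}\mathrm{cod}(g^*(\varphi_k))=1 . \]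
   Context: Everything is complex analytic; maps, functions and vector fields are germs at $0$. The minimal cross cap mapping of multiplicity $k\ge2$ is $\varphi_k:(\mathbb{C}^{2k-2},0)\to(\mathbb{C}^{2k-1},0)$, \[ \varphi_k(u_1,\ldots,u_{k-2},v_1,\ldots,v_{k-1},y)=\Big(u_1,\ldots,u_{k-2},v_1,\ldots,v_{k-1},\,y^k+\sum_{i=1}^{k-2}u_iy^i,\ \sum_{i=1}^{k-1}v_iy^i\Big). \] The coordinates on the target are, in order, $U_1,\dots,U_{k-2},V_1,\dots,V_{k-1},W_1,W_2$. Pullback: for a map germ $F:(\mathbb{C}^n,0)\to(\mathbb{C}^p,0)$ and an immersion germ $g:(\mathbb{C}^r,0)\to(\mathbb{C}^p,0)$ transverse to $F$, i.e. $dF(T_0\mathbb{C}^n)+T_0(g(\mathbb{C}^r))=T_0\mathbb{C}^p$, the pullback $g^*(F)$ is the map germ from $\{(x,y)\in(\mathbb{C}^n,0)\times(\mathbb{C}^r,0): F(x)=g(y)\}\cong(\mathbb{C}^{r-(p-n)},0)$ to $(\mathbb{C}^r,0)$ given by projection onto the second factor. $\mathcal{A}_e$-codimension: for $f:(\mathbb{C}^n,0)\to(\mathbb{C}^p,0)$, let $\theta(f)$ be the module of vector fields along $f$ (germs $s:(\mathbb{C}^n,0)\to T\mathbb{C}^p$ lying over $f$), $\theta_n,\theta_p$ the modules of vector field germs on $(\mathbb{C}^n,0)$, $(\mathbb{C}^p,0)$, and $tf(\eta)=df\circ\eta$ for $\eta\in\theta_n$, $wf(\xi)=\xi\circ f$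 for $\xi\in\theta_p$. Then \[ \mathcal{A}_e\text{-}\mathrm{cod}(f)=\dim_{\mathbb{C}}\frac{\theta(f)}{tf(\theta_n)+wf(\theta_p)}. \] *)

theory Defs
  imports "HOL-Analysis.Analysis" "HOL-Library.Extended_Nat"
begin

text \<open>
  Germs at \<open>0\<close> are represented by total functions, and every notion below only depends on the
  values near \<open>0\<close>.  The space \<open>\<complex>\<^sup>n\<close> is \<^typ>\<open>complex ^ 'n\<close> with
  \<open>CARD('n) = n\<close>; its coordinates are numbered \<open>1, \<dots>, n\<close> by means of the library
  enumeration of the finite index type.
\<close>

definition coord :: "nat \<Rightarrow> complex ^ 'n \<Rightarrow> complex" where
  "coord i x = x $ from_nat_into UNIV (i - 1)"

definition vec_of_coords :: "(nat \<Rightarrow> complex) \<Rightarrow> complex ^ 'n" where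
  "vec_of_coords c = (\<chi> j. c (to_nat_on UNIV j + 1))"

lemma coord_vec_of_coords:
  assumes "1 \<le> i" "i \<le> CARD('n)"
  shows "coord i (vec_of_coords c :: complex ^ 'n) = c i"
proof -
  have "i - 1 \<in> to_nat_on (UNIV :: 'n set) ` UNIV"
    using assms bij_betw_imp_surj_on[OF to_nat_on_finite, of "UNIV :: 'n set"] by auto
  then show ?thesis
    using assms by (simp add: coord_def vec_of_coords_def)
qed

lemma vec_of_coords_coord: "vec_of_coords (\<lambda>i. coord i x) = (x :: complex ^ 'n)"
  by (simp add: coord_def vec_of_coords_def vec_eq_iff countable_finite)

text \<open>
  The derivative at each point near \<open>0\<close> is given by a complex matrix, i.e. the function is
  complex differentiable, hence complex analytic, on a neighbourhood of \<open>0\<close>.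
\<close>

definition holo_germ :: "(complex ^ 'n \<Rightarrow> complex ^ 'p) \<Rightarrow> bool" where
  "holo_germ s \<longleftrightarrow>
     (\<forall>\<^sub>F x in nhds 0. \<exists>A :: complex ^ 'n ^ 'p. (s has_derivative (\<lambda>v. A *v v)) (at x))"

definition map_germ :: "(complex ^ 'n \<Rightarrow> complex ^ 'p) \<Rightarrow> bool" where
  "map_germ f \<longleftrightarrow> holo_germ f \<and> f 0 = 0"

definition immersive :: "('a::real_normed_vector \<Rightarrow> 'b::real_normed_vector) \<Rightarrow> bool" where
  "immersive g \<longleftrightarrow> inj (frechet_derivative g (at 0))"

definition transverse ::
  "(complex ^ 'n \<Rightarrow> complex ^ 'p) \<Rightarrow> (complex ^ 'r \<Rightarrow> complex ^ 'p) \<Rightarrow> bool" where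
  "transverse F g \<longleftrightarrow>
     (\<forall>w. \<exists>v y. w = frechet_derivative F (at 0) v + frechet_derivative g (at 0) y)"

text \<open>
  \<open>\<psi>\<close> is an immersion whose image is, as a germ at \<open>0\<close>, the set germ \<open>(X, 0)\<close>.  The last
  clause says that \<open>\<psi>\<close> maps every neighbourhood of \<open>0\<close> onto a neighbourhood of \<open>0\<close> in \<open>X\<close>;
  together with local injectivity of immersions this makes \<open>\<psi>\<close> an isomorphism onto \<open>(X, 0)\<close>.
\<close>

definition parametrizes ::
  "('a::real_normed_vector \<Rightarrow> 'b::real_normed_vector) \<Rightarrow> 'b set \<Rightarrow> bool" where
  "parametrizes \<psi> X \<longleftrightarrow>
     \<psi> 0 = 0 \<and> immersive \<psi> \<and> (\<forall>\<^sub>F z in nhds 0. \<psi> z \<in> X) \<and>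
     (\<forall>U. open U \<longrightarrow> 0 \<in> U \<longrightarrow> (\<forall>\<^sub>F w in nhds 0. w \<in> X \<longrightarrow> w \<in> \<psi> ` U))"

text \<open>
  The pullback is determined up to the choice of the isomorphism \<open>\<psi>\<close> between \<open>(\<complex>\<^sup>m, 0)\<close> and
  the fibre product, so it is a relation: \<open>f\<close> is one of the germs representing \<open>g\<^sup>*(F)\<close>.
\<close>

definition is_pullback ::
  "(complex ^ 'r \<Rightarrow> complex ^ 'p) \<Rightarrow> (complex ^ 'n \<Rightarrow> complex ^ 'p)
     \<Rightarrow> (complex ^ 'm \<Rightarrow> complex ^ 'r) \<Rightarrow> bool" where
  "is_pullback g F f \<longleftrightarrow>
     map_germ F \<and> map_germ g \<and> immersive g \<and> transverse F g \<and>
     (\<exists>\<psi> :: complex ^ 'm \<Rightarrow> (complex ^ 'n) \<times> (complex ^ 'r).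
        holo_germ (fst \<circ> \<psi>) \<and> holo_germ (snd \<circ> \<psi>) \<and>
        parametrizes \<psi> {(x, y). F x = g y} \<and> f = snd \<circ> \<psi>)"

text \<open>
  In terms of the coordinates, the source has \<open>u\<^sub>i = coord i\<close> for \<open>i \<le> k - 2\<close>,
  \<open>v\<^sub>i = coord (k - 2 + i)\<close> for \<open>i \<le> k - 1\<close> and \<open>y = coord (2k - 2)\<close>.
\<close>

definition cross_cap :: "nat \<Rightarrow> complex ^ 'n \<Rightarrow> complex ^ 'p" where
  "cross_cap k x =
     (let u = (\<lambda>i. coord i x); v = (\<lambda>i. coord (k - 2 + i) x); y = coord (2 * k - 2) x
      in vec_of_coords (\<lambda>j.
           if j \<le> k - 2 then u j
           else if j \<le> 2 * k - 3 then v (j - (k - 2))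
           else if j = 2 * k - 2 then y ^ k + (\<Sum>i = 1..k - 2. u i * y ^ i)
           else (\<Sum>i = 1..k - 1. v i * y ^ i)))"

text \<open>
  A vector field along \<open>f\<close> is identified with its principal part, since the tangent spaces of
  \<open>\<complex>\<^sup>p\<close> are all \<open>\<complex>\<^sup>p\<close>; the same holds for \<open>\<theta>\<^sub>n\<close> and \<open>\<theta>\<^sub>p\<close>.
\<close>

definition theta :: "(complex ^ 'n \<Rightarrow> complex ^ 'p) \<Rightarrow> (complex ^ 'n \<Rightarrow> complex ^ 'p) set" where
  "theta f = {s. holo_germ s}"

definition tf ::
  "(complex ^ 'n \<Rightarrow> complex ^ 'p) \<Rightarrow> (complex ^ 'n \<Rightarrow> complex ^ 'n) \<Rightarrow> complex ^ 'n \<Rightarrow> complex ^ 'p"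
  where "tf f \<eta> = (\<lambda>x. frechet_derivative f (at x) (\<eta> x))"

definition wf ::
  "(complex ^ 'n \<Rightarrow> complex ^ 'p) \<Rightarrow> (complex ^ 'p \<Rightarrow> complex ^ 'p) \<Rightarrow> complex ^ 'n \<Rightarrow> complex ^ 'p"
  where "wf f \<xi> = \<xi> \<circ> f"

text \<open>
  The representatives of the elements of \<open>tf(\<theta>\<^sub>n) + wf(\<theta>\<^sub>p)\<close>.  This set contains every
  function vanishing near \<open>0\<close>, so the quotient of \<^term>\<open>theta f\<close> by it is the quotient of
  the corresponding spaces of germs.
\<close>

definition Ae_tangent ::
  "(complex ^ 'n \<Rightarrow> complex ^ 'p) \<Rightarrow> (complex ^ 'n \<Rightarrow> complex ^ 'p) set" where
  "Ae_tangent f =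
     {s \<in> theta f. \<exists>\<eta> \<xi>. holo_germ \<eta> \<and> holo_germ \<xi> \<and>
        (\<forall>\<^sub>F x in nhds 0. s x = tf f \<eta> x + wf f \<xi> x)}"

text \<open>The classes of the elements of \<open>B\<close> form a finite basis of the complex vector space \<open>V / W\<close>.\<close>

definition quotient_basis ::
  "('a \<Rightarrow> complex ^ 'p) set \<Rightarrow> ('a \<Rightarrow> complex ^ 'p) set \<Rightarrow> ('a \<Rightarrow> complex ^ 'p) set \<Rightarrow> bool" where
  "quotient_basis V W B \<longleftrightarrow>
     finite B \<and> B \<subseteq> V \<and>
     (\<forall>c. (\<lambda>x. \<Sum>b\<in>B. c b *s b x) \<in> W \<longrightarrow> (\<forall>b\<in>B. c b = 0)) \<and>
     (\<forall>s\<in>V. \<exists>c. (\<lambda>x. s x - (\<Sum>b\<in>B. c b *s b x)) \<in> W)"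

definition quotient_dim ::
  "('a \<Rightarrow> complex ^ 'p) set \<Rightarrow> ('a \<Rightarrow> complex ^ 'p) set \<Rightarrow> enat" where
  "quotient_dim V W =
     (if \<exists>B. quotient_basis V W B then enat (card (SOME B. quotient_basis V W B)) else \<infinity>)"

definition Ae_cod :: "(complex ^ 'n \<Rightarrow> complex ^ 'p) \<Rightarrow> enat" where
  "Ae_cod f = quotient_dim (theta f) (Ae_tangent f)"

end

theory Submission
  imports Defs "HOL-Complex_Analysis.Complex_Analysis" "HOL-Library.Landau_Symbols"
begin

text \<open>
  By Weierstrass division every function germ on the source of \<open>\<phi> = \<phi>\<^sub>k\<close> is a polynomial of degree below
  \<open>k\<close> in \<open>y\<close> with coefficients pulled back from the target.  Comparing coefficients shows that
  \<open>\<theta>(\<phi>) = t\<phi>(\<theta>) + w\<phi>(\<theta>)\<close>, and that the values \<open>dh(\<xi>)\<close> of \<open>h\<close> on liftable vector fields \<open>\<xi>\<close> form an ideal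
  which contains every coordinate function modulo the square of the maximal ideal; this is where
  \<open>\<alpha>\<^bsub>k-2\<^esub> \<noteq> 0\<close> and \<open>\<beta>\<^bsub>k-1\<^esub> \<noteq> 0\<close> enter.  By Nakayama's lemma the ideal is the maximal ideal.  Hence in any
  \<open>\<sigma> = t\<phi>(\<eta>) + w\<phi>(\<xi>)\<close> the function \<open>dh(\<xi>)\<close> may be taken constant, and this constant is the only obstruction to
  restricting \<open>\<eta>\<close> to the source and \<open>\<xi>\<close> to the target of the pullback.  It is a genuine obstruction because
  liftable vector fields vanish at \<open>0\<close>.  Finally, every pullback is \<open>\<A>\<close>-equivalent to the one obtained by
  solving \<open>h = 0\<close> for the coordinate \<open>V\<^bsub>k-1\<^esub>\<close>, and the codimension is invariant under \<open>\<A>\<close>-equivalence.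
\<close>

subsection \<open>Holomorphic germs in several variables\<close>

text \<open>The two non-vanishing hypotheses are pivots. Modulo squares the relations given by
  liftable fields are triangular: one family yields W_2, V_1, ..., V_(k-1) in turn, always with
  leading coefficient -\<beta>_(k-1); the other yields W_1, U_1, ..., U_(k-2), where the i-th step
  has leading coefficient -(k - i) \<alpha>_(k-2), up to sign. The same \<beta>_(k-1) makes the
  normal form explicit: the derivative of \<open>h \<circ> \<phi>\<close> in the direction v_(k-1)
  is \<beta>_(k-1) + \<gamma>_2 y^(k-1), a unit that is free of v_(k-1). Hence both h = 0 in the
  target and its preimage in the source are graphs over the remaining coordinates, and no implicit
  function is needed to write them down. The analytic input is a single fact, differentiation under
  an integral over [0,1]. It gives holomorphic partial derivatives, Hadamard's lemma and Weierstrass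
  division, because Cauchy's formula on a circle around 0 can be written as such an
  integral.\<close>

definition cdiff :: "(complex ^ 'n \<Rightarrow> complex) \<Rightarrow> complex ^ 'n \<Rightarrow> bool" where
  "cdiff a x \<longleftrightarrow> (\<exists>D. (a has_derivative D) (at x) \<and> (\<forall>c v. D (c *s v) = c * D v))"

definition hgerm :: "(complex ^ 'n \<Rightarrow> complex) \<Rightarrow> bool" where
  "hgerm a \<longleftrightarrow> (\<forall>\<^sub>F x in nhds 0. cdiff a x)"

text \<open>Complex differentiability means a real Frechet derivative that commutes with complex
  scalars, so the real theory applies. Taking vector-valued maps componentwise leaves the closure
  properties to be proved for scalar functions only.\<close>

definition vdiff :: "(complex ^ 'n \<Rightarrow> complex ^ 'p) \<Rightarrow> complex ^ 'n \<Rightarrow> bool" where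
  "vdiff s x \<longleftrightarrow> (\<forall>i. cdiff (\<lambda>x. s x $ i) x)"

lemma has_derivative_vec_iff:
  "(s has_derivative D) (at x) \<longleftrightarrow> (\<forall>i. ((\<lambda>x. s x $ i :: complex) has_derivative (\<lambda>v. D v $ i)) (at x))"
proof
  assume "(s has_derivative D) (at x)"
  then show "\<forall>i. ((\<lambda>x. s x $ i) has_derivative (\<lambda>v. D v $ i)) (at x)"
    by (auto intro: bounded_linear.has_derivative[OF bounded_linear_vec_nth])
next
  assume *: "\<forall>i. ((\<lambda>x. s x $ i) has_derivative (\<lambda>v. D v $ i)) (at x)"
  show "(s has_derivative D) (at x)"
    unfolding has_derivative_componentwise_within[where f = s]
  proof
    fix b :: "complex ^ 'b" assume "b \<in> Basis"
    then obtain i u where b: "b = axis i u" "u \<in> Basis" by (auto simp: Basis_vec_def)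
    have "((\<lambda>x. s x $ i \<bullet> u) has_derivative (\<lambda>v. D v $ i \<bullet> u)) (at x)"
      using * by (intro bounded_linear.has_derivative[OF bounded_linear_inner_left]) auto
    then show "((\<lambda>x. s x \<bullet> b) has_derivative (\<lambda>v. D v \<bullet> b)) (at x)"
      by (simp add: b inner_axis)
  qed
qed

lemma cdiffI: "(a has_derivative D) (at x) \<Longrightarrow> (\<And>c v. D (c *s v) = c * D v) \<Longrightarrow> cdiff a x"
  unfolding cdiff_def by blast

lemma cdiff_has_derivative:
  assumes "cdiff a x"
  shows "(a has_derivative frechet_derivative a (at x)) (at x)"
    and "frechet_derivative a (at x) (c *s v) = c * frechet_derivative a (at x) v"
  using assms frechet_derivative_at unfolding cdiff_def by metis+

lemma vdiffI:
  assumes "(s has_derivative D) (at x)" "\<And>c v. D (c *s v) = c *s D v"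
  shows "vdiff s x"
  unfolding vdiff_def
proof
  fix i
  show "cdiff (\<lambda>x. s x $ i) x"
    using assms has_derivative_vec_iff[of s D x]
    by (intro cdiffI[of _ "\<lambda>v. D v $ i"]) auto
qed

lemma vdiff_has_derivative:
  assumes "vdiff s x"
  shows "(s has_derivative frechet_derivative s (at x)) (at x)"
    and "frechet_derivative s (at x) (c *s v) = c *s frechet_derivative s (at x) v"
    and "frechet_derivative s (at x) v $ i = frechet_derivative (\<lambda>x. s x $ i) (at x) v"
proof -
  define D where "D v = (\<chi> i. frechet_derivative (\<lambda>x. s x $ i) (at x) v)" for v
  have cd: "cdiff (\<lambda>x. s x $ i) x" for i using assms by (simp add: vdiff_def)
  have "(s has_derivative D) (at x)"
    unfolding has_derivative_vec_iff D_def using cdiff_has_derivative(1)[OF cd] by simp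
  then have D: "frechet_derivative s (at x) = D" using frechet_derivative_at by metis
  show "(s has_derivative frechet_derivative s (at x)) (at x)"
    unfolding D by fact
  show "frechet_derivative s (at x) (c *s v) = c *s frechet_derivative s (at x) v"
    using cdiff_has_derivative(2)[OF cd] by (simp add: D D_def vec_eq_iff)
  show "frechet_derivative s (at x) v $ i = frechet_derivative (\<lambda>x. s x $ i) (at x) v"
    by (simp add: D D_def)
qed

lemma vdiff_iff:
  "vdiff s x \<longleftrightarrow> (\<exists>D. (s has_derivative D) (at x) \<and> (\<forall>c v. D (c *s v) = c *s D v))"
  using vdiff_has_derivative vdiffI by metis

text \<open>The link with \<open>holo_germ\<close>, which asks for a matrix: a real-linear
  derivative that commutes with complex scalars is complex linear, hence multiplication by its
  matrix.\<close>

lemma vdiff_iff_matrix: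
  fixes s :: "complex ^ 'n \<Rightarrow> complex ^ 'p"
  shows "vdiff s x \<longleftrightarrow> (\<exists>A :: complex ^ 'n ^ 'p. (s has_derivative (\<lambda>v. A *v v)) (at x))"
proof
  assume "vdiff s x"
  then obtain D where D: "(s has_derivative D) (at x)" "\<And>c v. D (c *s v) = c *s D v"
    by (auto simp: vdiff_iff)
  then interpret bounded_linear D by (simp add: has_derivative_bounded_linear)
  have "Vector_Spaces.linear (*s) (*s) D"
    by (standard) (auto simp: D add vector_ssub_ldistrib vec.scale_right_distrib vec.scale_left_distrib)
  then have "(\<lambda>v. matrix D *v v) = D" by (simp add: matrix_works)
  then show "\<exists>A :: complex ^ 'n ^ 'p. (s has_derivative (\<lambda>v. A *v v)) (at x)"
    using D(1) by metis
next
  assume "\<exists>A :: complex ^ 'n ^ 'p. (s has_derivative (\<lambda>v. A *v v)) (at x)"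
  then show "vdiff s x" by (auto intro!: vdiffI simp: vec.scale)
qed

lemma holo_germ_iff_vdiff: "holo_germ s \<longleftrightarrow> (\<forall>\<^sub>F x in nhds 0. vdiff s x)"
  by (simp add: holo_germ_def vdiff_iff_matrix)

lemma holo_germ_iff_hgerm: "holo_germ s \<longleftrightarrow> (\<forall>i. hgerm (\<lambda>x. s x $ i))"
  unfolding holo_germ_iff_vdiff vdiff_def hgerm_def
  using eventually_ball_finite_distrib[of UNIV "\<lambda>x i. cdiff (\<lambda>x. s x $ i) x" "nhds 0"] by simp

lemma cdiff_const [simp]: "cdiff (\<lambda>_. c) x"
  by (rule cdiffI) (auto intro: derivative_intros)

lemma cdiff_nth [simp]: "cdiff (\<lambda>x. x $ i) x"
  by (rule cdiffI) (auto intro: bounded_linear_imp_has_derivative bounded_linear_vec_nth)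

lemma cdiff_add: "cdiff a x \<Longrightarrow> cdiff b x \<Longrightarrow> cdiff (\<lambda>x. a x + b x) x"
  unfolding cdiff_def
proof clarify
  fix D E
  assume "(a has_derivative D) (at x)" "(b has_derivative E) (at x)"
    and "\<forall>c v. D (c *s v) = c * D v" "\<forall>c v. E (c *s v) = c * E v"
  then show "\<exists>F. ((\<lambda>x. a x + b x) has_derivative F) (at x) \<and> (\<forall>c v. F (c *s v) = c * F v)"
    by (intro exI[of _ "\<lambda>h. D h + E h"] conjI has_derivative_add) (auto simp: algebra_simps)
qed

lemma cdiff_minus: "cdiff a x \<Longrightarrow> cdiff (\<lambda>x. - a x) x"
  unfolding cdiff_def
proof clarify
  fix D assume "(a has_derivative D) (at x)" "\<forall>c v. D (c *s v) = c * D v"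
  then show "\<exists>F. ((\<lambda>x. - a x) has_derivative F) (at x) \<and> (\<forall>c v. F (c *s v) = c * F v)"
    by (intro exI[of _ "\<lambda>h. - D h"] conjI has_derivative_minus) auto
qed

lemma cdiff_diff: "cdiff a x \<Longrightarrow> cdiff b x \<Longrightarrow> cdiff (\<lambda>x. a x - b x) x"
  using cdiff_add[OF _ cdiff_minus] by force

lemma cdiff_mult: "cdiff a x \<Longrightarrow> cdiff b x \<Longrightarrow> cdiff (\<lambda>x. a x * b x) x"
  unfolding cdiff_def
proof clarify
  fix D E
  assume "(a has_derivative D) (at x)" "(b has_derivative E) (at x)"
    and "\<forall>c v. D (c *s v) = c * D v" "\<forall>c v. E (c *s v) = c * E v"
  then show "\<exists>F. ((\<lambda>x. a x * b x) has_derivative F) (at x) \<and> (\<forall>c v. F (c *s v) = c * F v)"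
    by (intro exI[of _ "\<lambda>h. a x * E h + D h * b x"] conjI has_derivative_mult) (auto simp: algebra_simps)
qed

lemma cdiff_compose_field:
  assumes "(q has_field_derivative q') (at (a x))" "cdiff a x"
  shows "cdiff (\<lambda>x. q (a x)) x"
proof -
  obtain D where D: "(a has_derivative D) (at x)" "\<And>c v. D (c *s v) = c * D v"
    using assms by (auto simp: cdiff_def)
  have "((\<lambda>x. q (a x)) has_derivative (\<lambda>v. q' * D v)) (at x)"
    using assms(1) has_derivative_compose[OF D(1), of q] by (simp add: has_field_derivative_def)
  then show ?thesis by (rule cdiffI) (simp add: D)
qed

lemma cdiff_inverse: "cdiff a x \<Longrightarrow> a x \<noteq> 0 \<Longrightarrow> cdiff (\<lambda>x. inverse (a x)) x"
  by (rule cdiff_compose_field) (auto intro!: derivative_eq_intros)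

lemma cdiff_divide: "cdiff a x \<Longrightarrow> cdiff b x \<Longrightarrow> b x \<noteq> 0 \<Longrightarrow> cdiff (\<lambda>x. a x / b x) x"
  unfolding divide_inverse by (intro cdiff_mult cdiff_inverse)

lemma cdiff_power: "cdiff a x \<Longrightarrow> cdiff (\<lambda>x. a x ^ m) x"
  by (induction m) (auto intro: cdiff_mult)

lemma cdiff_sum: "(\<And>i. i \<in> I \<Longrightarrow> cdiff (a i) x) \<Longrightarrow> cdiff (\<lambda>x. \<Sum>i\<in>I. a i x) x"
  by (induction I rule: infinite_finite_induct) (auto intro: cdiff_add)

lemma cdiff_compose: "cdiff a (s x) \<Longrightarrow> vdiff s x \<Longrightarrow> cdiff (\<lambda>x. a (s x)) x"
  unfolding cdiff_def vdiff_iff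
proof clarify
  fix D E
  assume "(a has_derivative D) (at (s x))" "(s has_derivative E) (at x)"
    and "\<forall>c v. D (c *s v) = c * D v" "\<forall>c v. E (c *s v) = c *s E v"
  then show "\<exists>F. ((\<lambda>x. a (s x)) has_derivative F) (at x) \<and> (\<forall>c v. F (c *s v) = c * F v)"
    by (intro exI[of _ "\<lambda>h. D (E h)"]) (auto intro: has_derivative_compose)
qed

lemma cdiff_cong_ev:
  assumes "\<forall>\<^sub>F y in nhds x. a y = b y"
  shows "cdiff a x \<longleftrightarrow> cdiff b x"
proof -
  have "cdiff b x" if e: "\<forall>\<^sub>F y in nhds x. a y = b y" and "cdiff a x" for a b :: "complex ^ 'a \<Rightarrow> complex"
  proof -
    obtain D where D: "(a has_derivative D) (at x)" "\<And>c v. D (c *s v) = c * D v"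
      using \<open>cdiff a x\<close> unfolding cdiff_def by blast
    have "a x = b x" using e eventually_nhds_x_imp_x by fast
    then have "(b has_derivative D) (at x)"
      using has_derivative_transform_eventually[OF D(1), of b] e
      by (auto simp: eventually_nhds_conv_at)
    then show ?thesis using D cdiffI by blast
  qed
  from this[of a b] this[of b a] assms show ?thesis by (auto simp: eq_commute)
qed

lemma hgerm_cong_ev:
  assumes "\<forall>\<^sub>F y in nhds 0. a y = b y"
  shows "hgerm a \<longleftrightarrow> hgerm b"
proof -
  have "\<forall>\<^sub>F x in nhds 0. \<forall>\<^sub>F y in nhds x. a y = b y"
    using assms by (simp add: eventually_eventually)
  then have "\<forall>\<^sub>F x in nhds 0. cdiff a x \<longleftrightarrow> cdiff b x"
    by eventually_elim (rule cdiff_cong_ev)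
  then show ?thesis unfolding hgerm_def by (rule eventually_cong) auto
qed

lemma hgerm_const [simp, intro]: "hgerm (\<lambda>_. c)"
  by (simp add: hgerm_def)

lemma hgerm_nth [simp, intro]: "hgerm (\<lambda>x. x $ i)"
  by (simp add: hgerm_def)

lemma hgerm_coord [simp, intro]: "hgerm (coord i)"
  unfolding coord_def by simp

lemma hgerm_add [intro]: "hgerm a \<Longrightarrow> hgerm b \<Longrightarrow> hgerm (\<lambda>x. a x + b x)"
  unfolding hgerm_def by (erule (1) eventually_elim2) (rule cdiff_add)

lemma hgerm_minus [intro]: "hgerm a \<Longrightarrow> hgerm (\<lambda>x. - a x)"
  unfolding hgerm_def by (elim eventually_mono) (rule cdiff_minus)

lemma hgerm_diff [intro]: "hgerm a \<Longrightarrow> hgerm b \<Longrightarrow> hgerm (\<lambda>x. a x - b x)"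
  unfolding hgerm_def by (erule (1) eventually_elim2) (rule cdiff_diff)

lemma hgerm_mult [intro]: "hgerm a \<Longrightarrow> hgerm b \<Longrightarrow> hgerm (\<lambda>x. a x * b x)"
  unfolding hgerm_def by (erule (1) eventually_elim2) (rule cdiff_mult)

lemma hgerm_power [intro]: "hgerm a \<Longrightarrow> hgerm (\<lambda>x. a x ^ m)"
  unfolding hgerm_def by (elim eventually_mono) (rule cdiff_power)

lemma hgerm_sum [intro]: "(\<And>i. i \<in> I \<Longrightarrow> hgerm (a i)) \<Longrightarrow> hgerm (\<lambda>x. \<Sum>i\<in>I. a i x)"
  by (induction I rule: infinite_finite_induct) auto

lemma cdiff_isCont: "cdiff a x \<Longrightarrow> isCont a x"
  unfolding cdiff_def by (blast dest: has_derivative_continuous)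

lemma vdiff_isCont: "vdiff s x \<Longrightarrow> isCont s x"
  unfolding vdiff_iff by (blast dest: has_derivative_continuous)

lemma hgerm_isCont: "hgerm a \<Longrightarrow> isCont a 0"
  unfolding hgerm_def by (drule eventually_nhds_x_imp_x) (rule cdiff_isCont)

lemma holo_germ_isCont: "holo_germ s \<Longrightarrow> isCont s 0"
  unfolding holo_germ_iff_vdiff by (drule eventually_nhds_x_imp_x) (rule vdiff_isCont)

lemma eventually_isCont_nhds:
  "isCont s x \<Longrightarrow> \<forall>\<^sub>F y in nhds (s x). P y \<Longrightarrow> \<forall>\<^sub>F x in nhds x. P (s x)"
  by (metis continuous_at_imp_continuous_at_within eventually_compose_filterlim isCont_def
      tendsto_at_iff_tendsto_nhds)

lemma holo_germ_eventually:
  "holo_germ s \<Longrightarrow> s 0 = 0 \<Longrightarrow> \<forall>\<^sub>F y in nhds 0. P y \<Longrightarrow> \<forall>\<^sub>F x in nhds 0. P (s x)"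
  using eventually_isCont_nhds[OF holo_germ_isCont, of s P] by simp

lemma hgerm_divide [intro]:
  assumes "hgerm a" "hgerm b" "b 0 \<noteq> 0"
  shows "hgerm (\<lambda>x. a x / b x)"
proof -
  have "\<forall>\<^sub>F x in nhds 0. b x \<noteq> 0"
    using eventually_isCont_nhds[OF hgerm_isCont[OF assms(2)], of "\<lambda>z. z \<noteq> 0"]
      assms(3) t1_space_nhds by blast
  then show ?thesis using assms(1,2) unfolding hgerm_def
    by eventually_elim (rule cdiff_divide)
qed

lemma hgerm_compose:
  assumes "hgerm a" "holo_germ s" "s 0 = 0"
  shows "hgerm (\<lambda>x. a (s x))"
proof -
  have "\<forall>\<^sub>F x in nhds 0. cdiff a (s x)"
    using holo_germ_eventually[OF assms(2,3)] assms(1) by (simp add: hgerm_def)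
  with assms(2) show ?thesis unfolding hgerm_def holo_germ_iff_vdiff
    by eventually_elim (rule cdiff_compose)
qed

lemma holo_germ_compose:
  assumes "holo_germ r" "holo_germ s" "s 0 = 0"
  shows "holo_germ (\<lambda>x. r (s x))"
  using assms hgerm_compose[OF _ assms(2,3)] unfolding holo_germ_iff_hgerm[of r]
    holo_germ_iff_hgerm[of "\<lambda>x. r (s x)"] by blast

lemma holo_germ_cong_ev:
  "\<forall>\<^sub>F y in nhds 0. r y = s y \<Longrightarrow> holo_germ r \<longleftrightarrow> holo_germ s"
  unfolding holo_germ_iff_hgerm
  by (intro iff_allI hgerm_cong_ev) (auto elim: eventually_mono)

lemma holo_germ_id [simp, intro]: "holo_germ (\<lambda>x. x)"
  by (simp add: holo_germ_iff_hgerm)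

lemma holo_germ_const [simp, intro]: "holo_germ (\<lambda>x. c)"
  by (simp add: holo_germ_iff_hgerm)

lemma holo_germ_add [intro]: "holo_germ r \<Longrightarrow> holo_germ s \<Longrightarrow> holo_germ (\<lambda>x. r x + s x)"
  by (auto simp: holo_germ_iff_hgerm)

lemma holo_germ_diff [intro]: "holo_germ r \<Longrightarrow> holo_germ s \<Longrightarrow> holo_germ (\<lambda>x. r x - s x)"
  by (auto simp: holo_germ_iff_hgerm)

lemma holo_germ_scale [intro]: "hgerm a \<Longrightarrow> holo_germ s \<Longrightarrow> holo_germ (\<lambda>x. a x *s s x)"
  by (auto simp: holo_germ_iff_hgerm)

lemma hgerm_coord_comp [intro]: "holo_germ s \<Longrightarrow> hgerm (\<lambda>x. coord i (s x))"
  by (simp add: holo_germ_iff_hgerm coord_def)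

subsection \<open>Cauchy's formula and its consequences\<close>

definition pd :: "'n \<Rightarrow> (complex ^ 'n \<Rightarrow> complex) \<Rightarrow> complex ^ 'n \<Rightarrow> complex" where
  "pd j a x = frechet_derivative a (at x) (axis j 1)"

lemma frechet_derivative_eq_pd:
  assumes "cdiff a x"
  shows "frechet_derivative a (at x) v = (\<Sum>j\<in>UNIV. v $ j * pd j a x)"
proof -
  note D = cdiff_has_derivative[OF assms]
  interpret bounded_linear "frechet_derivative a (at x)"
    using D(1) by (rule has_derivative_bounded_linear)
  have "frechet_derivative a (at x) v = frechet_derivative a (at x) (\<Sum>j\<in>UNIV. v $ j *s axis j 1)"
    by (simp add: basis_expansion)
  also have "\<dots> = (\<Sum>j\<in>UNIV. v $ j * pd j a x)"
    by (simp add: sum D(2) pd_def)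
  finally show ?thesis .
qed

text \<open>Restriction to a complex line gives access to one-variable Cauchy theory.\<close>

lemma cdiff_line:
  assumes "cdiff a (x + z *s w)"
  shows "((\<lambda>z. a (x + z *s w)) has_field_derivative frechet_derivative a (at (x + z *s w)) w) (at z)"
proof -
  note D = cdiff_has_derivative[OF assms]
  have "((\<lambda>z. x + z *s w) has_derivative (\<lambda>h. h *s w)) (at z)"
    unfolding has_derivative_vec_iff by (auto intro!: derivative_eq_intros)
  from has_derivative_compose[OF this D(1)] show ?thesis
    by (simp add: has_field_derivative_def D(2) mult.commute[of _ "frechet_derivative a (at (x + z *s w)) w"])
qed

lemma norm_scale_axis: "norm (z *s axis j 1 :: complex ^ 'n) = norm z"
proof -
  have "z *s axis j 1 = (axis j z :: complex ^ 'n)" by (simp add: vec_eq_iff axis_def)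
  moreover have "axis j z \<bullet> axis j z = z \<bullet> z" by (simp add: inner_axis_axis)
  ultimately show ?thesis by (simp add: norm_eq_sqrt_inner)
qed

text \<open>For a circle around 0 the velocity is 2 pi i times the position. A contour integral
  thereby becomes an ordinary integral over [0,1], the shape in which dependence on parameters is
  studied below.\<close>

lemma integral_circlepath:
  assumes "(f has_contour_integral I) (circlepath 0 r)"
  shows "integral {0..1} (\<lambda>t. f (circlepath 0 r t) * circlepath 0 r t) = I / (2 * pi * \<i>)"
proof -
  have "((\<lambda>t. f (circlepath 0 r t) * vector_derivative (circlepath 0 r) (at t within {0..1})) has_integral I) {0..1}"
    using assms by (simp add: has_contour_integral_def)
  then have "((\<lambda>t. (2 * pi * \<i>) * (f (circlepath 0 r t) * circlepath 0 r t)) has_integral I) {0..1}"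
    by (rule has_integral_eq[rotated]) (simp only: atLeastAtMost_iff vector_derivative_circlepath01, simp add: circlepath)
  then have "((\<lambda>t. inverse (2 * pi * \<i>) * ((2 * pi * \<i>) * (f (circlepath 0 r t) * circlepath 0 r t)))
     has_integral inverse (2 * pi * \<i>) * I) {0..1}"
    by (rule has_integral_mult_right)
  then show ?thesis by (simp add: field_simps integral_unique)
qed

lemma norm_circlepath: "r \<ge> 0 \<Longrightarrow> norm (circlepath 0 r t) = r"
  by (simp add: circlepath norm_mult)

lemma continuous_on_circlepath [continuous_intros]:
  "continuous_on A f \<Longrightarrow> continuous_on A (\<lambda>x. circlepath z r (f x))"
  unfolding circlepath by (intro continuous_intros)

text \<open>Cauchy's formula for the first derivative on the complex line through \<open>x\<close>
  in direction \<open>j\<close>. The kernel is 1/u and not 1/u^2 because du contributes a factor u.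
  Regularity of partial derivatives is thus reduced to that of \<open>a\<close>.\<close>

lemma pd_Cauchy:
  assumes "\<And>y. y \<in> ball 0 R \<Longrightarrow> cdiff a y" and r: "0 < r" "norm x + r < R"
  shows "pd j a x = integral {0..1} (\<lambda>t. a (x + circlepath 0 r t *s axis j 1) / circlepath 0 r t)"
proof -
  let ?f = "\<lambda>z. a (x + z *s axis j 1)"
  have der: "(?f has_field_derivative pd j a (x + z *s axis j 1)) (at z)" if "z \<in> cball 0 r" for z
  proof -
    have "norm (x + z *s axis j 1) < R"
      using norm_triangle_ineq[of x "z *s axis j 1"] that r by (simp add: norm_scale_axis)
    then show ?thesis unfolding pd_def using assms by (intro cdiff_line) simp
  qed
  have cont: "continuous_on (cball 0 r) ?f"
    by (rule DERIV_continuous_on) (blast intro: has_field_derivative_at_within der)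
  have hol: "?f holomorphic_on ball 0 r"
    using der by (intro holomorphic_onI) (meson ball_subset_cball field_differentiable_at_within field_differentiable_def subsetD)
  have "((\<lambda>u. ?f u / (u - 0) ^ Suc 1) has_contour_integral (2 * pi * \<i>) / fact 1 * (deriv ^^ 1) ?f 0) (circlepath 0 r)"
    using r by (intro Cauchy_has_contour_integral_higher_derivative_circlepath cont hol) auto
  moreover have "deriv ?f 0 = pd j a x"
    using der[of 0] r by (intro DERIV_imp_deriv) auto
  ultimately have "((\<lambda>u. ?f u / u ^ 2) has_contour_integral (2 * pi * \<i>) * pd j a x) (circlepath 0 r)"
    by (simp add: power2_eq_square)
  from integral_circlepath[OF this]
  have "pd j a x = integral {0..1} (\<lambda>t. ?f (circlepath 0 r t) / circlepath 0 r t ^ 2 * circlepath 0 r t)"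
    by simp
  also have "\<dots> = integral {0..1} (\<lambda>t. ?f (circlepath 0 r t) / circlepath 0 r t)"
    by (rule integral_cong) (simp add: power2_eq_square)
  finally show ?thesis .
qed

text \<open>The Leibniz rule needs derivatives that are jointly continuous in point and parameter;
  Cauchy's formula extracts this from joint continuity of \<open>F\<close>. Shrinking the radius by
  \<open>r\<close> leaves room for the circles.\<close>

lemma continuous_on_pd_param:
  fixes F :: "complex ^ 'n \<Rightarrow> real \<Rightarrow> complex"
  assumes cont: "continuous_on (ball 0 R \<times> {0..1}) (\<lambda>(x, t). F x t)"
    and hol: "\<And>x t. x \<in> ball 0 R \<Longrightarrow> t \<in> {0..1} \<Longrightarrow> cdiff (\<lambda>x. F x t) x"
    and r: "r > 0"
  shows "continuous_on (ball 0 (R - r) \<times> {0..1}) (\<lambda>(x, t). pd j (\<lambda>x. F x t) x)"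
proof -
  let ?G = "\<lambda>(x, t) u. F (x + circlepath 0 r u *s axis j 1) t / circlepath 0 r u"
  have nz: "circlepath 0 r u \<noteq> 0" for u using r by (simp add: circlepath)
  have in_ball: "x + circlepath 0 r u *s axis j 1 \<in> ball 0 R" if "x \<in> ball 0 (R - r)" for x u
    using that norm_triangle_ineq[of x "circlepath 0 r u *s axis j 1"] r
    by (simp add: norm_scale_axis norm_circlepath)
  have cs: "continuous_on A (\<lambda>q. f q *s axis j 1 :: complex ^ 'n)" if "continuous_on A f"
    for A :: "(((complex ^ 'n) \<times> real) \<times> real) set" and f
    using that unfolding continuous_on_componentwise[where f = "\<lambda>q. f q *s axis j 1"]
    by (auto simp: Basis_vec_def inner_axis intro!: continuous_intros)
  have "continuous_on ((ball 0 (R - r) \<times> {0..1}) \<times> cbox 0 1) (\<lambda>(q, u). ?G q u)"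
    unfolding case_prod_beta
    by (intro continuous_on_divide continuous_on_compose2[OF cont, unfolded case_prod_beta,
          where f = "\<lambda>q. (fst (fst q) + circlepath 0 r (snd q) *s axis j 1, snd (fst q))", simplified]
        continuous_intros cs) (auto simp: nz in_ball[simplified])
  then have "continuous_on (ball 0 (R - r) \<times> {0..1}) (\<lambda>q. integral (cbox 0 1) (?G q))"
    by (rule integral_continuous_on_param)
  then show ?thesis
  proof (rule continuous_on_eq)
    fix q :: "(complex ^ 'n) \<times> real" assume q: "q \<in> ball 0 (R - r) \<times> {0..1}"
    then have "\<And>y. y \<in> ball 0 R \<Longrightarrow> cdiff (\<lambda>x. F x (snd q)) y" "norm (fst q) + r < R"
      using hol by (auto simp: mem_Times_iff)
    from pd_Cauchy[OF this(1) r this(2), of j]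
    show "integral (cbox 0 1) (?G q) = (case q of (x, t) \<Rightarrow> pd j (\<lambda>x. F x t) x)"
      by (simp add: case_prod_beta)
  qed
qed

text \<open>The Leibniz rule is applied to real Frechet derivatives. The result is an integral of
  maps that commute with complex scalars, so it commutes with them too.\<close>

lemma cdiff_integral:
  fixes F :: "complex ^ 'n \<Rightarrow> real \<Rightarrow> complex"
  assumes cont: "continuous_on (ball 0 R \<times> {0..1}) (\<lambda>(x, t). F x t)"
    and hol: "\<And>x t. x \<in> ball 0 R \<Longrightarrow> t \<in> {0..1} \<Longrightarrow> cdiff (\<lambda>x. F x t) x"
    and x: "x \<in> ball 0 R"
  shows "cdiff (\<lambda>x. integral {0..1} (F x)) x"
proof -
  \<comment> \<open>Half the distance to the boundary, so that \<open>x\<close> still lies in the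
    ball of radius \<open>R - r\<close>.\<close>
  define r where "r = (R - norm x) / 2"
  define U where "U = (ball 0 (R - r) :: (complex ^ 'n) set)"
  have r: "r > 0" and xU: "x \<in> U" and UR: "U \<subseteq> ball 0 R" using x by (auto simp: r_def U_def field_simps)
  define D where "D y t v = (\<Sum>j\<in>UNIV. v $ j * pd j (\<lambda>x. F x t) y)" for y t and v :: "complex ^ 'n"
  have bl: "bounded_linear (D y t)" for y t
    unfolding D_def by (intro bounded_linear_sum bounded_linear_mult_const bounded_linear_vec_nth)
  define f' where "f' y t = Blinfun (D y t)" for y t
  have f': "blinfun_apply (f' y t) = D y t" for y t
    unfolding f'_def by (rule bounded_linear_Blinfun_apply[OF bl])
  have contf': "continuous_on (U \<times> cbox 0 1) (\<lambda>(y, t). f' y t)"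
    unfolding case_prod_beta
  proof (rule continuous_on_blinfun_componentwise)
    fix i :: "complex ^ 'n"
    show "continuous_on (U \<times> cbox 0 1) (\<lambda>q. blinfun_apply (f' (fst q) (snd q)) i)"
      unfolding f' D_def
      using continuous_on_pd_param[OF cont hol r] by (auto intro!: continuous_intros simp: U_def case_prod_beta)
  qed
  have contx: "continuous_on (cbox 0 1) (F y)" if "y \<in> ball 0 R" for y
    using that by (intro continuous_on_compose2[OF cont, of _ "\<lambda>t. (y, t)", simplified] continuous_intros) auto
  have "((\<lambda>y. integral (cbox 0 1) (F y)) has_derivative integral (cbox 0 1) (f' x)) (at x within U)"
  proof (rule leibniz_rule[OF _ _ contf' xU])
    fix y and t :: real assume "y \<in> U" "t \<in> cbox 0 1"
    then have "cdiff (\<lambda>x. F x t) y" using hol UR by auto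
    from cdiff_has_derivative(1)[OF this] frechet_derivative_eq_pd[OF this]
    have "((\<lambda>y. F y t) has_derivative f' y t) (at y)"
      by (metis (no_types, lifting) D_def f' ext)
    then show "((\<lambda>y. F y t) has_derivative f' y t) (at y within U)" by (rule has_derivative_at_withinI)
  next
    fix y assume "y \<in> U"
    then show "F y integrable_on cbox 0 1" using contx UR by (intro integrable_continuous) auto
  qed (simp add: U_def)
  then have der: "((\<lambda>y. integral {0..1} (F y)) has_derivative integral (cbox 0 1) (f' x)) (at x)"
    using xU at_within_open[of x U] by (simp add: U_def)
  show ?thesis
  proof (rule cdiffI[OF der])
    fix c v
    have "continuous_on (cbox 0 1) (f' x)"
      using xU by (intro continuous_on_compose2[OF contf', of _ "\<lambda>t. (x, t)", simplified] continuous_intros) auto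
    then have int: "f' x integrable_on cbox 0 1" by (rule integrable_continuous)
    have "blinfun_apply (f' x t) (c *s v) = c * blinfun_apply (f' x t) v" for t
      by (simp add: f' D_def sum_distrib_left mult.assoc)
    then show "blinfun_apply (integral (cbox 0 1) (f' x)) (c *s v) =
      c * blinfun_apply (integral (cbox 0 1) (f' x)) v"
      unfolding blinfun_apply_integral[OF int] by simp
  qed
qed

lemma hgerm_ball:
  assumes "hgerm a" obtains R where "R > 0" "\<And>x. x \<in> ball 0 R \<Longrightarrow> cdiff a x"
proof -
  obtain R where "R > 0" "\<forall>x. dist x 0 < R \<longrightarrow> cdiff a x"
    using assms unfolding hgerm_def eventually_nhds_metric by blast
  then show ?thesis using that[of R] by simp
qed

lemma hgermI_ball:
  assumes "R > 0" "\<And>x. x \<in> ball 0 R \<Longrightarrow> cdiff a x" shows "hgerm a"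
  using assms unfolding hgerm_def eventually_nhds_metric by (auto simp: dist_commute)

lemma continuous_on_cdiff: "(\<And>x. x \<in> S \<Longrightarrow> cdiff a x) \<Longrightarrow> continuous_on S a"
  by (auto intro!: continuous_at_imp_continuous_on cdiff_isCont)

text \<open>Near 0 the partial derivative is a Cauchy integral over circles of a fixed radius, and
  the integrand is complex differentiable in the point.\<close>

lemma hgerm_pd [intro]:
  fixes a :: "complex ^ 'n \<Rightarrow> complex"
  assumes "hgerm a" shows "hgerm (pd j a)"
proof -
  obtain R where R: "R > 0" "\<And>x. x \<in> ball 0 R \<Longrightarrow> cdiff a x" using hgerm_ball[OF assms] by blast
  define r where "r = R / 2"
  have r: "r > 0" "R - r > 0" using R by (auto simp: r_def)
  let ?F = "\<lambda>x t. a (x + circlepath 0 r t *s axis j 1) / circlepath 0 r t"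
  have nz: "circlepath 0 r u \<noteq> 0" for u using r by (simp add: circlepath)
  have in_ball: "x + circlepath 0 r u *s axis j 1 \<in> ball 0 R" if "x \<in> ball 0 (R - r)" for x u
    using that norm_triangle_ineq[of x "circlepath 0 r u *s axis j 1"] r
    by (simp add: norm_scale_axis norm_circlepath)
  have cs: "continuous_on A (\<lambda>q. f q *s axis j 1 :: complex ^ 'n)" if "continuous_on A f"
    for A :: "((complex ^ 'n) \<times> real) set" and f
    using that unfolding continuous_on_componentwise[where f = "\<lambda>q. f q *s axis j 1"]
    by (auto simp: Basis_vec_def inner_axis intro!: continuous_intros)
  have "cdiff (\<lambda>x. integral {0..1} (?F x)) x" if "x \<in> ball 0 (R - r)" for x
  proof (rule cdiff_integral[OF _ _ that])
    have cont_a: "continuous_on (ball 0 R) a" by (rule continuous_on_cdiff) (rule R(2))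
    let ?c = "\<lambda>q :: (complex ^ 'n) \<times> real. fst q + circlepath 0 r (snd q) *s axis j 1"
    have "continuous_on (ball 0 (R - r) \<times> {0..1}) ?c"
      by (intro continuous_intros cs)
    then have "continuous_on (ball 0 (R - r) \<times> {0..1}) (\<lambda>q. a (?c q))"
      using in_ball by (intro continuous_on_compose2[OF cont_a, of _ ?c]) auto
    then show "continuous_on (ball 0 (R - r) \<times> {0..1}) (\<lambda>(x, t). ?F x t)"
      unfolding case_prod_beta
      by (intro continuous_on_divide continuous_on_circlepath continuous_on_snd continuous_on_id) (auto simp: nz)
  next
    fix x :: "complex ^ 'n" and t :: real assume "x \<in> ball 0 (R - r)"
    then have *: "cdiff a (x + circlepath 0 r t *s axis j 1)" using R in_ball by blast
    have "vdiff (\<lambda>x. x + circlepath 0 r t *s axis j 1) x"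
      unfolding vdiff_def by (auto intro!: cdiff_add)
    then show "cdiff (\<lambda>x. ?F x t) x"
      by (intro cdiff_divide cdiff_compose[of a "\<lambda>x. x + circlepath 0 r t *s axis j 1"] *) (auto simp: nz)
  qed
  then have hgerm_integral: "hgerm (\<lambda>x. integral {0..1} (?F x))" using r by (intro hgermI_ball[of "R - r"]) auto
  have eq: "integral {0..1} (?F x) = pd j a x" if "x \<in> ball 0 (R - r)" for x
    using pd_Cauchy[where R = R and a = a and r = r and j = j and x = x, OF R(2) r(1)] that by simp
  have "\<forall>\<^sub>F x in nhds 0. integral {0..1} (?F x) = pd j a x"
    using eventually_nhds_in_open[of "ball 0 (R - r)" 0] r by (auto elim!: eventually_mono intro!: eq)
  with hgerm_integral show ?thesis using hgerm_cong_ev[of "\<lambda>x. integral {0..1} (?F x)" "pd j a"] by simp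
qed

text \<open>Each component is a sum of products of components of \<eta> with partial derivatives of
  \<open>s\<close> composed with \<open>g\<close>, all holomorphic. It covers \<open>tf\<close> as
  well as fields transported along a map.\<close>

lemma holo_germ_frechet_along:
  assumes "holo_germ s" "holo_germ g" "g 0 = 0" "holo_germ \<eta>"
  shows "holo_germ (\<lambda>x. frechet_derivative s (at (g x)) (\<eta> x))"
proof -
  have ev: "\<forall>\<^sub>F x in nhds 0. vdiff s (g x)"
    using assms(1) by (intro holo_germ_eventually[OF assms(2,3)]) (simp add: holo_germ_iff_vdiff)
  have "hgerm (\<lambda>x. frechet_derivative s (at (g x)) (\<eta> x) $ i)" for i
  proof -
    have "hgerm (\<lambda>x. \<Sum>j\<in>UNIV. \<eta> x $ j * pd j (\<lambda>x. s x $ i) (g x))"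
      using assms by (intro hgerm_sum hgerm_mult hgerm_compose[OF hgerm_pd]) (auto simp: holo_germ_iff_hgerm)
    moreover have "\<forall>\<^sub>F x in nhds 0. (\<Sum>j\<in>UNIV. \<eta> x $ j * pd j (\<lambda>x. s x $ i) (g x))
        = frechet_derivative s (at (g x)) (\<eta> x) $ i"
      using ev by eventually_elim (simp add: vdiff_has_derivative frechet_derivative_eq_pd vdiff_def)
    ultimately show ?thesis using hgerm_cong_ev by fast
  qed
  then show ?thesis by (simp add: holo_germ_iff_hgerm)
qed

section \<open>Derivatives of germs and the inverse function theorem\<close>

lemma frechet_derivative_cong_ev:
  assumes "\<forall>\<^sub>F y in nhds x. r y = s y"
  shows "frechet_derivative r (at x) = frechet_derivative s (at x)"
proof -
  have *: "(s has_derivative D) (at x)"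
    if "\<forall>\<^sub>F y in nhds x. r y = s y" "(r has_derivative D) (at x)" for r s :: "'a \<Rightarrow> 'b" and D
    using has_derivative_transform_eventually[OF that(2), of s] that(1) eventually_nhds_x_imp_x[OF that(1)]
    by (auto simp: eventually_nhds_conv_at)
  have "(r has_derivative D) (at x) \<longleftrightarrow> (s has_derivative D) (at x)" for D
    using *[of r s D] *[of s r D] assms by (auto simp: eq_commute)
  then show ?thesis by (simp add: frechet_derivative_def)
qed

lemma eventually_frechet_derivative_cong:
  assumes "\<forall>\<^sub>F y in nhds a. r y = s y"
  shows "\<forall>\<^sub>F x in nhds a. frechet_derivative r (at x) = frechet_derivative s (at x)"
proof -
  have "\<forall>\<^sub>F x in nhds a. \<forall>\<^sub>F y in nhds x. r y = s y" using assms by (simp add: eventually_eventually)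
  then show ?thesis by eventually_elim (rule frechet_derivative_cong_ev)
qed

lemma frechet_derivative_vdiff_compose:
  assumes "vdiff s x" "vdiff r (s x)"
  shows "frechet_derivative (\<lambda>x. r (s x)) (at x) v = frechet_derivative r (at (s x)) (frechet_derivative s (at x) v)"
  using has_derivative_compose[OF vdiff_has_derivative(1)[OF assms(1)] vdiff_has_derivative(1)[OF assms(2)]]
    frechet_derivative_at by metis

lemma eventually_frechet_derivative_compose:
  assumes "holo_germ s" "s 0 = 0" "holo_germ r"
  shows "\<forall>\<^sub>F x in nhds 0. \<forall>v. frechet_derivative (\<lambda>x. r (s x)) (at x) v
    = frechet_derivative r (at (s x)) (frechet_derivative s (at x) v)"
proof -
  have "\<forall>\<^sub>F x in nhds 0. vdiff r (s x)"
    using holo_germ_eventually[OF assms(1,2), of "vdiff r"] assms(3) by (simp add: holo_germ_iff_vdiff)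
  then show ?thesis using assms(1) unfolding holo_germ_iff_vdiff
  proof eventually_elim
    case (elim x)
    then show ?case using frechet_derivative_vdiff_compose[of s x r] by blast
  qed
qed

text \<open>The real inverse function theorem applies because holomorphic partial derivatives make
  the derivative continuous. The derivative of the inverse map is the inverse of a complex linear
  bijection, hence complex linear, so the inverse map is holomorphic.\<close>

lemma inverse_germ:
  fixes L :: "complex ^ 'n \<Rightarrow> complex ^ 'n"
  assumes L: "holo_germ L" "L 0 = 0" and inj: "inj (frechet_derivative L (at 0))"
  obtains L' where "holo_germ L'" "L' 0 = 0" "\<forall>\<^sub>F x in nhds 0. L' (L x) = x" "\<forall>\<^sub>F x in nhds 0. L (L' x) = x"
proof -
  have "\<forall>\<^sub>F x in nhds 0. vdiff L x \<and> (\<forall>i j. cdiff (pd j (\<lambda>x. L x $ i)) x)"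
  proof -
    have "hgerm (pd j (\<lambda>x. L x $ i))" for i j using L by (auto simp: holo_germ_iff_hgerm)
    then have "\<forall>\<^sub>F x in nhds 0. \<forall>i\<in>UNIV. \<forall>j\<in>UNIV. cdiff (pd j (\<lambda>x. L x $ i)) x"
      by (intro eventually_ball_finite ballI) (auto simp: hgerm_def)
    then show ?thesis using L by (auto simp: holo_germ_iff_vdiff intro: eventually_conj)
  qed
  then obtain R where R: "R > 0" "\<And>x. x \<in> ball 0 R \<Longrightarrow> vdiff L x"
    "\<And>x i j. x \<in> ball 0 R \<Longrightarrow> cdiff (pd j (\<lambda>x. L x $ i)) x"
    unfolding eventually_nhds_metric by (auto simp: dist_commute)
  define U where "U = (ball 0 R :: (complex ^ 'n) set)"
  define f' where "f' x = Blinfun (frechet_derivative L (at x))" for x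
  have f': "blinfun_apply (f' x) = frechet_derivative L (at x)" if "x \<in> U" for x
    unfolding f'_def using vdiff_has_derivative(1)[OF R(2)] that
    by (intro bounded_linear_Blinfun_apply) (auto simp: U_def intro: has_derivative_bounded_linear)
  have contf': "continuous_on U f'"
  proof (rule continuous_on_blinfun_componentwise)
    fix v :: "complex ^ 'n"
    have "continuous_on U (\<lambda>x. \<chi> i. \<Sum>j\<in>UNIV. v $ j * pd j (\<lambda>x. L x $ i) x)"
      using R(3) by (intro continuous_on_vec_lambda continuous_intros continuous_on_cdiff) (auto simp: U_def)
    then show "continuous_on U (\<lambda>x. blinfun_apply (f' x) v)"
    proof (rule continuous_on_eq)
      fix x assume "x \<in> U"
      then show "(\<chi> i. \<Sum>j\<in>UNIV. v $ j * pd j (\<lambda>x. L x $ i) x) = blinfun_apply (f' x) v"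
        using vdiff_has_derivative(3)[OF R(2)] R(2)
        by (simp add: f' vec_eq_iff U_def vdiff_def frechet_derivative_eq_pd)
    qed
  qed
  have 0: "0 \<in> U" using R(1) by (simp add: U_def)
  have "linear (blinfun_apply (f' 0))" by (simp add: blinfun.bounded_linear_right bounded_linear.linear)
  moreover have "inj (blinfun_apply (f' 0))" using inj by (simp add: f'[OF 0])
  ultimately obtain g0 where g0: "linear g0" "g0 \<circ> blinfun_apply (f' 0) = id"
    using linear_injective_left_inverse by metis
  define invf where "invf = Blinfun g0"
  have "blinfun_apply invf = g0" unfolding invf_def
    using g0(1) by (simp add: bounded_linear_Blinfun_apply linear_conv_bounded_linear)
  then have invf: "invf o\<^sub>L f' 0 = id_blinfun"
    using g0(2) by (intro blinfun_eqI) (simp add: fun_eq_iff)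
  obtain U' V g g' where V: "open U'" "U' \<subseteq> U" "0 \<in> U'" "open V" "L 0 \<in> V" "homeomorphism U' V L g"
    "\<And>y. y \<in> V \<Longrightarrow> (g has_derivative (g' y)) (at y)"
    "\<And>y. y \<in> V \<Longrightarrow> g' y = inv (blinfun_apply (f' (g y)))"
    "\<And>y. y \<in> V \<Longrightarrow> bij (blinfun_apply (f' (g y)))"
  proof (rule inverse_function_theorem[OF _ _ contf' 0 invf])
    show "open U" by (simp add: U_def)
    show "\<And>x. x \<in> U \<Longrightarrow> (L has_derivative blinfun_apply (f' x)) (at x)"
      using vdiff_has_derivative(1)[OF R(2)] by (simp add: f') (simp add: U_def)
  qed blast
  have "vdiff g y" if "y \<in> V" for y
  proof (rule vdiffI)
    show "(g has_derivative (g' y)) (at y)" using V that by blast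
    fix c v
    have gy: "g y \<in> U" using V(2,6) that by (auto simp: homeomorphism_def)
    have *: "blinfun_apply (f' (g y)) (c *s v) = c *s blinfun_apply (f' (g y)) v" for c v
      using vdiff_has_derivative(2)[OF R(2)] gy by (simp add: f') (simp add: U_def)
    have "blinfun_apply (f' (g y)) (c *s g' y v) = c *s v"
      using V(8,9)[OF that] * by (simp add: bij_is_surj surj_f_inv_f)
    then show "g' y (c *s v) = c *s g' y v"
      using V(8,9)[OF that] by (metis bij_inv_eq_iff)
  qed
  then have "holo_germ g" unfolding holo_germ_iff_vdiff eventually_nhds
    using V(4,5) L(2) by auto
  moreover have "g 0 = 0" using homeomorphism_apply1[OF V(6,3)] L(2) by simp
  moreover have "\<forall>\<^sub>F x in nhds 0. g (L x) = x"
    using homeomorphism_apply1[OF V(6)] V(1,3) by (auto simp: eventually_nhds)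
  moreover have "\<forall>\<^sub>F x in nhds 0. L (g x) = x"
    using homeomorphism_apply2[OF V(6)] V(4,5) L(2) by (auto simp: eventually_nhds)
  ultimately show ?thesis using that by blast
qed

subsection \<open>Hadamard's lemma and Nakayama's lemma\<close>

text \<open>Integrate the derivative of \<open>a\<close> along the segment from 0 to x;
  \<open>r j\<close> is the mean of the j-th partial derivative over this segment.\<close>

lemma Hadamard_germ:
  fixes a :: "complex ^ 'n \<Rightarrow> complex"
  assumes a: "hgerm a" "a 0 = 0"
  obtains r where "\<And>j. hgerm (r j)" "\<forall>\<^sub>F x in nhds 0. a x = (\<Sum>j\<in>UNIV. r j x * x $ j)"
proof -
  have "\<forall>\<^sub>F x in nhds 0. cdiff a x \<and> (\<forall>j\<in>UNIV. cdiff (pd j a) x)"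
    using hgerm_pd[OF a(1)] a(1) unfolding hgerm_def
    by (intro eventually_conj eventually_ball_finite) auto
  then obtain R where R: "R > 0" "\<forall>x. dist x 0 < R \<longrightarrow> cdiff a x \<and> (\<forall>j\<in>UNIV. cdiff (pd j a) x)"
    unfolding eventually_nhds_metric by blast
  define r where "r j x = integral {0..1} (\<lambda>t. pd j a (of_real t *s x))" for j x
  have scale: "(of_real t *s x :: complex ^ 'n) = t *\<^sub>R x" for t x
    by (simp add: vec_eq_iff) (simp add: scaleR_conv_of_real)
  have in_ball: "of_real t *s x \<in> ball 0 R" if "x \<in> ball 0 R" "t \<in> {0..1}" for t and x :: "complex ^ 'n"
  proof -
    have "\<bar>t\<bar> * norm x \<le> 1 * norm x" using that by (intro mult_right_mono) auto
    then show ?thesis using that by (simp add: scale)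
  qed
  have "hgerm (r j)" for j
  proof (rule hgermI_ball[OF R(1)])
    fix x :: "complex ^ 'n" assume x: "x \<in> ball 0 R"
    have cont_pd: "continuous_on (ball 0 R) (pd j a)" using R by (intro continuous_on_cdiff) auto
    show "cdiff (r j) x"
      unfolding r_def[abs_def]
    proof (rule cdiff_integral[OF _ _ x])
      show "continuous_on (ball 0 R \<times> {0..1}) (\<lambda>(x, t). pd j a (of_real t *s x))"
        unfolding case_prod_beta scale
        using in_ball unfolding scale
        by (intro continuous_on_compose2[OF cont_pd, of _ "\<lambda>q. snd q *\<^sub>R fst q"] continuous_intros) auto
      fix x :: "complex ^ 'n" and t :: real assume "x \<in> ball 0 R" "t \<in> {0..1}"
      from in_ball[OF this] have "cdiff (pd j a) (of_real t *s x)" using R by auto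
      moreover have "vdiff (\<lambda>x. of_real t *s x :: complex ^ 'n) x"
        unfolding vdiff_def by (auto intro: cdiff_mult)
      ultimately show "cdiff (\<lambda>x. pd j a (of_real t *s x)) x"
        by (rule cdiff_compose)
    qed
  qed
  moreover have "a x = (\<Sum>j\<in>UNIV. r j x * x $ j)" if x: "x \<in> ball 0 R" for x
  proof -
    let ?g = "\<lambda>t. \<Sum>j\<in>UNIV. pd j a (of_real t *s x) * x $ j"
    have "((\<lambda>t. a (of_real t *s x)) has_vector_derivative ?g t) (at t within {0..1})" if "t \<in> {0..1}" for t
    proof -
      from in_ball[OF x that] have cd: "cdiff a (of_real t *s x)" using R by auto
      have "((\<lambda>z. a (z *s x)) has_field_derivative ?g t) (at (of_real t))"
        using cdiff_line[of a 0 "of_real t" x] cd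
        by (simp add: frechet_derivative_eq_pd[OF cd] mult.commute)
      then show ?thesis by (rule has_vector_derivative_real_field)
    qed
    then have "(?g has_integral (a (of_real 1 *s x) - a (of_real 0 *s x))) {0..1}"
      by (intro fundamental_theorem_of_calculus) auto
    then have "a x = integral {0..1} ?g" using a(2) by (simp add: integral_unique)
    also have "\<dots> = (\<Sum>j\<in>UNIV. integral {0..1} (\<lambda>t. pd j a (of_real t *s x) * x $ j))"
    proof (rule integral_sum)
      fix j
      have "continuous_on {0..1} (\<lambda>t. pd j a (of_real t *s x))"
        using R in_ball[OF x]
        by (intro continuous_on_compose2[OF continuous_on_cdiff[of "ball 0 R" "pd j a"], of _ "\<lambda>t. of_real t *s x"])
           (auto simp: scale intro!: continuous_intros)
      then show "(\<lambda>t. pd j a (of_real t *s x) * x $ j) integrable_on {0..1}"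
        by (intro integrable_continuous_interval continuous_intros)
    qed simp
    also have "\<dots> = (\<Sum>j\<in>UNIV. r j x * x $ j)"
      by (simp add: r_def)
    finally show ?thesis .
  qed
  then have "\<forall>\<^sub>F x in nhds 0. a x = (\<Sum>j\<in>UNIV. r j x * x $ j)"
    using eventually_nhds_in_open[of "ball 0 R" 0] R(1) by (auto elim!: eventually_mono)
  ultimately show ?thesis using that by blast
qed

text \<open>An ideal in the ring of germs at 0, encoded by all representatives of its elements; this
  is the reason for the last clause.\<close>

definition germ_ideal :: "(complex ^ 'n \<Rightarrow> complex) set \<Rightarrow> bool" where
  "germ_ideal I \<longleftrightarrow> I \<subseteq> Collect hgerm \<and> (\<lambda>_. 0) \<in> I \<and>
     (\<forall>a\<in>I. \<forall>b\<in>I. (\<lambda>x. a x + b x) \<in> I) \<and>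
     (\<forall>c a. hgerm c \<longrightarrow> a \<in> I \<longrightarrow> (\<lambda>x. c x * a x) \<in> I) \<and>
     (\<forall>a\<in>I. \<forall>b. (\<forall>\<^sub>F x in nhds 0. a x = b x) \<longrightarrow> b \<in> I)"

lemma germ_ideal_hgerm: "germ_ideal I \<Longrightarrow> a \<in> I \<Longrightarrow> hgerm a"
  and germ_ideal_zero: "germ_ideal I \<Longrightarrow> (\<lambda>_. 0) \<in> I"
  and germ_ideal_add: "germ_ideal I \<Longrightarrow> a \<in> I \<Longrightarrow> b \<in> I \<Longrightarrow> (\<lambda>x. a x + b x) \<in> I"
  and germ_ideal_mult: "germ_ideal I \<Longrightarrow> hgerm c \<Longrightarrow> a \<in> I \<Longrightarrow> (\<lambda>x. c x * a x) \<in> I"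
  and germ_ideal_cong: "germ_ideal I \<Longrightarrow> a \<in> I \<Longrightarrow> \<forall>\<^sub>F x in nhds 0. a x = b x \<Longrightarrow> b \<in> I"
  by (auto simp: germ_ideal_def)

lemma germ_ideal_diff:
  assumes "germ_ideal I" "a \<in> I" "b \<in> I" shows "(\<lambda>x. a x - b x) \<in> I"
  using germ_ideal_add[OF assms(1,2) germ_ideal_mult[OF assms(1) _ assms(3), of "\<lambda>_. -1"]] by simp

lemma germ_ideal_sum:
  assumes "germ_ideal I" "\<And>i. i \<in> A \<Longrightarrow> f i \<in> I" shows "(\<lambda>x. \<Sum>i\<in>A. f i x) \<in> I"
  using assms(2)
  by (induction A rule: infinite_finite_induct) (auto intro: germ_ideal_zero germ_ideal_add assms(1))

text \<open>Nakayama's lemma by Gaussian elimination. Modulo \<open>I\<close> every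
  \<open>w l\<close> is a combination of the \<open>w j\<close> with coefficients vanishing at 0.
  The pivot 1 - \<open>n s\<close> is then a unit, so \<open>w s\<close> can be solved for and
  substituted into the other relations, whose coefficients still vanish at 0.\<close>

lemma germ_ideal_elimination:
  assumes I: "germ_ideal I" and "finite S"
    and "\<And>l. l \<in> S \<Longrightarrow> \<exists>n. (\<forall>j. hgerm (n j) \<and> n j 0 = 0) \<and> (\<lambda>x. w l x - (\<Sum>j\<in>S. n j x * w j x)) \<in> I"
    and w: "\<And>l. hgerm (w l)"
  shows "\<forall>l\<in>S. w l \<in> I"
  using assms(2,3)
proof (induction S)
  case empty
  then show ?case by simp
next
  case (insert s S)
  obtain n where n: "\<And>j. hgerm (n j)" "\<And>j. n j 0 = 0"
    and ns: "(\<lambda>x. w s x - (\<Sum>j\<in>insert s S. n j x * w j x)) \<in> I"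
    using insert.prems[of s] by auto
  define e where "e x = 1 - n s x" for x
  have e: "hgerm e" "e 0 \<noteq> 0" using n by (auto simp: e_def[abs_def])
  have e_ev: "\<forall>\<^sub>F x in nhds 0. e x \<noteq> 0"
    using eventually_isCont_nhds[OF hgerm_isCont[OF e(1)], of "\<lambda>z. z \<noteq> 0"] e(2) t1_space_nhds by blast
  define G where "G x = w s x - (\<Sum>j\<in>insert s S. n j x * w j x)" for x
  have G: "G \<in> I" using ns by (simp add: G_def[abs_def])
  have "G x = e x * w s x - (\<Sum>j\<in>S. n j x * w j x)" for x
    using insert.hyps by (simp add: G_def e_def algebra_simps)
  then have ws: "w s x * e x = G x + (\<Sum>j\<in>S. n j x * w j x)" for x by (simp add: algebra_simps)
  have IH: "\<forall>l\<in>S. w l \<in> I"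
  proof (rule insert.IH)
    fix l assume "l \<in> S"
    then obtain m where m: "\<And>j. hgerm (m j)" "\<And>j. m j 0 = 0"
      and ml: "(\<lambda>x. w l x - (\<Sum>j\<in>insert s S. m j x * w j x)) \<in> I"
      using insert.prems[of l] by auto
    \<comment> \<open>The coefficients of the relation for \<open>w l\<close> after the substitution
      for \<open>w s\<close>.\<close>
    define n' where "n' j x = m j x + m s x / e x * n j x" for j x
    have n': "\<forall>j. hgerm (n' j) \<and> n' j 0 = 0"
      unfolding n'_def using m n e by (intro allI conjI hgerm_add hgerm_mult hgerm_divide) auto
    have "(\<lambda>x. (w l x - (\<Sum>j\<in>insert s S. m j x * w j x)) + m s x / e x * G x) \<in> I"
      using m e by (intro germ_ideal_add[OF I ml] germ_ideal_mult[OF I _ G]) auto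
    moreover have "\<forall>\<^sub>F x in nhds 0. (w l x - (\<Sum>j\<in>insert s S. m j x * w j x)) + m s x / e x * G x
        = w l x - (\<Sum>j\<in>S. n' j x * w j x)"
      using e_ev
    proof eventually_elim
      case (elim x)
      have "m s x * w s x = m s x / e x * (w s x * e x)" using elim by simp
      also have "\<dots> = m s x / e x * G x + (\<Sum>j\<in>S. m s x / e x * n j x * w j x)"
        unfolding ws by (simp add: sum_distrib_left distrib_left mult.assoc)
      finally show ?case
        using insert.hyps by (simp add: n'_def distrib_right sum.distrib)
    qed
    ultimately have "(\<lambda>x. w l x - (\<Sum>j\<in>S. n' j x * w j x)) \<in> I"
      by (rule germ_ideal_cong[OF I])
    with n' show "\<exists>n. (\<forall>j. hgerm (n j) \<and> n j 0 = 0) \<and> (\<lambda>x. w l x - (\<Sum>j\<in>S. n j x * w j x)) \<in> I"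
      by blast
  qed
  have "(\<lambda>x. 1 / e x * (G x + (\<Sum>j\<in>S. n j x * w j x))) \<in> I"
    using IH n e by (intro germ_ideal_mult[OF I] germ_ideal_add[OF I G] germ_ideal_sum[OF I]) auto
  moreover have "\<forall>\<^sub>F x in nhds 0. 1 / e x * (G x + (\<Sum>j\<in>S. n j x * w j x)) = w s x"
    using e_ev by eventually_elim (simp add: ws[symmetric])
  ultimately have "w s \<in> I" by (rule germ_ideal_cong[OF I])
  with IH show ?case by simp
qed

text \<open>The ideal I + m^2, with m the maximal ideal: elements of m^2 are written as combinations
  of the coordinates with coefficients in m.\<close>

definition mod_square :: "(complex ^ 'n \<Rightarrow> complex) set \<Rightarrow> (complex ^ 'n \<Rightarrow> complex) set" where
  "mod_square I = {a. \<exists>n. (\<forall>j. hgerm (n j) \<and> n j 0 = 0) \<and> (\<lambda>x. a x - (\<Sum>j\<in>UNIV. n j x * x $ j)) \<in> I}"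

lemma mod_square_supset:
  assumes "germ_ideal I" "a \<in> I" shows "a \<in> mod_square I"
  unfolding mod_square_def using assms by (auto intro!: exI[of _ "\<lambda>_ _. 0"])

lemma germ_ideal_mod_square:
  fixes I :: "(complex ^ 'n \<Rightarrow> complex) set"
  assumes I: "germ_ideal I" shows "germ_ideal (mod_square I)"
  unfolding germ_ideal_def
proof (intro conjI ballI allI impI subsetI)
  fix a :: "complex ^ 'n \<Rightarrow> complex" assume "a \<in> mod_square I"
  then obtain n where n: "\<And>j. hgerm (n j)" "(\<lambda>x. a x - (\<Sum>j\<in>UNIV. n j x * x $ j)) \<in> I"
    unfolding mod_square_def by blast
  have "hgerm (\<lambda>x. (a x - (\<Sum>j\<in>UNIV. n j x * x $ j)) + (\<Sum>j\<in>UNIV. n j x * x $ j))"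
    using germ_ideal_hgerm[OF I n(2)] n(1) by (intro hgerm_add hgerm_sum hgerm_mult) auto
  then show "a \<in> Collect hgerm" by simp
next
  show "(\<lambda>_. 0) \<in> mod_square I" by (rule mod_square_supset[OF I germ_ideal_zero[OF I]])
next
  fix a b :: "complex ^ 'n \<Rightarrow> complex" assume "a \<in> mod_square I" "b \<in> mod_square I"
  then obtain n m where n: "\<And>j. hgerm (n j)" "\<And>j. n j 0 = 0" "(\<lambda>x. a x - (\<Sum>j\<in>UNIV. n j x * x $ j)) \<in> I"
    and m: "\<And>j. hgerm (m j)" "\<And>j. m j 0 = 0" "(\<lambda>x. b x - (\<Sum>j\<in>UNIV. m j x * x $ j)) \<in> I"
    unfolding mod_square_def by blast
  show "(\<lambda>x. a x + b x) \<in> mod_square I"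
    unfolding mod_square_def
    using n(1,2) m(1,2) germ_ideal_add[OF I n(3) m(3)]
    by (intro CollectI exI[of _ "\<lambda>j x. n j x + m j x"]) (auto simp: distrib_right sum.distrib algebra_simps)
next
  fix c a :: "complex ^ 'n \<Rightarrow> complex" assume c: "hgerm c" and "a \<in> mod_square I"
  then obtain n where n: "\<And>j. hgerm (n j)" "\<And>j. n j 0 = 0" "(\<lambda>x. a x - (\<Sum>j\<in>UNIV. n j x * x $ j)) \<in> I"
    unfolding mod_square_def by blast
  show "(\<lambda>x. c x * a x) \<in> mod_square I"
    unfolding mod_square_def
    using n(1,2) c germ_ideal_mult[OF I c n(3)]
    by (intro CollectI exI[of _ "\<lambda>j x. c x * n j x"]) (auto simp: right_diff_distrib sum_distrib_left mult.assoc)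
next
  fix a b :: "complex ^ 'n \<Rightarrow> complex" assume "a \<in> mod_square I" and ev: "\<forall>\<^sub>F x in nhds 0. a x = b x"
  then obtain n where n: "\<And>j. hgerm (n j)" "\<And>j. n j 0 = 0" "(\<lambda>x. a x - (\<Sum>j\<in>UNIV. n j x * x $ j)) \<in> I"
    unfolding mod_square_def by blast
  have "(\<lambda>x. b x - (\<Sum>j\<in>UNIV. n j x * x $ j)) \<in> I"
    by (rule germ_ideal_cong[OF I n(3)]) (use ev in \<open>auto elim: eventually_mono\<close>)
  with n(1,2) show "b \<in> mod_square I" unfolding mod_square_def by blast
qed

lemma mult_in_mod_square:
  assumes I: "germ_ideal I" and a: "hgerm a" "a 0 = 0" and b: "hgerm b" "b 0 = 0"
  shows "(\<lambda>x. a x * b x) \<in> mod_square I"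
proof -
  obtain r where r: "\<And>j. hgerm (r j)" "\<forall>\<^sub>F x in nhds 0. b x = (\<Sum>j\<in>UNIV. r j x * x $ j)"
    using Hadamard_germ[OF b] by blast
  have "(\<lambda>x. a x * b x - (\<Sum>j\<in>UNIV. (a x * r j x) * x $ j)) \<in> I"
    by (rule germ_ideal_cong[OF I germ_ideal_zero[OF I]])
      (use r(2) in \<open>auto elim!: eventually_mono simp: sum_distrib_left mult.assoc\<close>)
  then show ?thesis unfolding mod_square_def
    using a r(1) by (intro CollectI exI[of _ "\<lambda>j x. a x * r j x"]) auto
qed

text \<open>By Hadamard's lemma the coordinates generate the maximal ideal m. So m \<subseteq> I +
  m^2 is a system of relations to which the elimination applies, and it forces m \<subseteq>
  I.\<close>

lemma germ_ideal_Nakayama: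
  fixes a :: "complex ^ 'n \<Rightarrow> complex"
  assumes I: "germ_ideal I" and m: "\<And>j. (\<lambda>x. x $ j) \<in> mod_square I"
    and a: "hgerm a" "a 0 = 0"
  shows "a \<in> I"
proof -
  have "\<forall>j\<in>UNIV. (\<lambda>x. x $ j) \<in> I"
    using m unfolding mod_square_def
    by (intro germ_ideal_elimination[OF I, where w = "\<lambda>j (x :: complex ^ 'n). x $ j"]) auto
  moreover obtain r where r: "\<And>j. hgerm (r j)" "\<forall>\<^sub>F x in nhds 0. a x = (\<Sum>j\<in>UNIV. r j x * x $ j)"
    using Hadamard_germ[OF a] by blast
  ultimately have "(\<lambda>x. \<Sum>j\<in>UNIV. r j x * x $ j) \<in> I"
    by (intro germ_ideal_sum[OF I] germ_ideal_mult[OF I]) auto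
  then show ?thesis
    by (rule germ_ideal_cong[OF I]) (use r(2) in \<open>auto elim: eventually_mono\<close>)
qed

subsection \<open>Cross caps and Weierstrass division\<close>

lemma ex_coord_eq_nth:
  fixes j :: "'n::finite"
  obtains i where "1 \<le> i" "i \<le> CARD('n)" "\<And>x :: complex ^ 'n. coord i x = x $ j"
proof
  have "to_nat_on (UNIV :: 'n set) j < CARD('n)"
    using bij_betw_apply[OF to_nat_on_finite[of "UNIV :: 'n set"]] by fastforce
  then show "to_nat_on (UNIV :: 'n set) j + 1 \<le> CARD('n)" by simp
  show "coord (to_nat_on (UNIV :: 'n set) j + 1) x = x $ j" for x :: "complex ^ 'n"
    by (simp add: coord_def countable_finite)
qed simp

lemma coord_eqI:
  fixes x y :: "complex ^ 'n"
  assumes "\<And>i. 1 \<le> i \<Longrightarrow> i \<le> CARD('n) \<Longrightarrow> coord i x = coord i y"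
  shows "x = y"
proof (subst vec_eq_iff, rule allI)
  fix j :: 'n
  obtain i where "1 \<le> i" "i \<le> CARD('n)" "\<And>x :: complex ^ 'n. coord i x = x $ j"
    using ex_coord_eq_nth[of j] by blast
  then show "x $ j = y $ j" using assms by metis
qed

lemma coord_add [simp]: "coord i (x + y) = coord i x + coord i y"
  and coord_diff [simp]: "coord i (x - y) = coord i x - coord i y"
  and coord_minus [simp]: "coord i (- x) = - coord i x"
  and coord_scale [simp]: "coord i (c *s x) = c * coord i x"
  and coord_zero [simp]: "coord i 0 = 0"
  by (simp_all add: coord_def)

lemma bounded_linear_coord: "bounded_linear (coord i)"
  unfolding coord_def by (rule bounded_linear_vec_nth)

lemma has_derivative_coord [derivative_intros]:
  "(f has_derivative f') F \<Longrightarrow> ((\<lambda>x. coord i (f x)) has_derivative (\<lambda>h. coord i (f' h))) F"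
  by (rule bounded_linear.has_derivative[OF bounded_linear_coord])

lemma continuous_on_coord [continuous_intros]:
  "continuous_on S f \<Longrightarrow> continuous_on S (\<lambda>x. coord i (f x))"
  unfolding coord_def by (intro continuous_intros)

lemma cdiff_coord [simp]: "cdiff (coord i) x"
  unfolding coord_def by simp

lemma cdiff_if: "(C \<Longrightarrow> cdiff a x) \<Longrightarrow> (\<not> C \<Longrightarrow> cdiff b x) \<Longrightarrow> cdiff (\<lambda>x. if C then a x else b x) x"
  and hgerm_if [intro]: "(C \<Longrightarrow> hgerm a) \<Longrightarrow> (\<not> C \<Longrightarrow> hgerm b) \<Longrightarrow> hgerm (\<lambda>x. if C then a x else b x)"
  by (cases C; simp)+

lemma coord_frechet_derivative:
  "vdiff s x \<Longrightarrow> coord i (frechet_derivative s (at x) v) = frechet_derivative (\<lambda>x. coord i (s x)) (at x) v"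
  unfolding coord_def by (rule vdiff_has_derivative(3))

lemma vdiff_vec_of_coords:
  assumes "\<And>i. 1 \<le> i \<Longrightarrow> i \<le> CARD('n) \<Longrightarrow> cdiff (\<lambda>x. c x i) x"
  shows "vdiff (\<lambda>x. vec_of_coords (c x) :: complex ^ 'n) x"
  unfolding vdiff_def
proof
  fix j :: 'n
  obtain i where i: "1 \<le> i" "i \<le> CARD('n)" "\<And>x :: complex ^ 'n. coord i x = x $ j"
    using ex_coord_eq_nth[of j] by blast
  have "(vec_of_coords (c x) :: complex ^ 'n) $ j = c x i" for x
    using i(1,2) by (simp add: i(3)[symmetric] coord_vec_of_coords)
  then show "cdiff (\<lambda>x. (vec_of_coords (c x) :: complex ^ 'n) $ j) x"
    using assms[OF i(1,2)] by simp
qed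

lemma holo_germ_vec_of_coords:
  assumes "\<And>i. 1 \<le> i \<Longrightarrow> i \<le> CARD('n) \<Longrightarrow> hgerm (\<lambda>x. c x i)"
  shows "holo_germ (\<lambda>x. vec_of_coords (c x) :: complex ^ 'n)"
  unfolding holo_germ_iff_hgerm
proof
  fix j :: 'n
  obtain i where i: "1 \<le> i" "i \<le> CARD('n)" "\<And>x :: complex ^ 'n. coord i x = x $ j"
    using ex_coord_eq_nth[of j] by blast
  have "(vec_of_coords (c x) :: complex ^ 'n) $ j = c x i" for x
    using i(1,2) by (simp add: i(3)[symmetric] coord_vec_of_coords)
  then show "hgerm (\<lambda>x. (vec_of_coords (c x) :: complex ^ 'n) $ j)"
    using assms[OF i(1,2)] by simp
qed

lemma continuous_on_vec_of_coords:
  assumes "\<And>i. continuous_on S (\<lambda>x. c x i)"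
  shows "continuous_on S (\<lambda>x. vec_of_coords (c x) :: complex ^ 'n)"
  unfolding vec_of_coords_def by (intro continuous_on_vec_lambda assms)

lemma vdiff_add: "vdiff r x \<Longrightarrow> vdiff s x \<Longrightarrow> vdiff (\<lambda>x. r x + s x) x"
  by (simp add: vdiff_def cdiff_add)

section \<open>The minimal cross cap in coordinates\<close>

locale minimal_cross_cap =
  fixes k :: nat and source :: "'n::finite itself" and target :: "'p::finite itself"
  assumes k: "k > 2" and card_source: "CARD('n) = 2 * k - 2" and card_target: "CARD('p) = 2 * k - 1"
begin

abbreviation \<phi> :: "complex ^ 'n \<Rightarrow> complex ^ 'p" where
  "\<phi> \<equiv> cross_cap k"

abbreviation y :: "complex ^ 'n \<Rightarrow> complex" where
  "y \<equiv> coord (2 * k - 2)"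

lemma coord_\<phi>_parameter [simp]:
  assumes "1 \<le> i" "i \<le> 2 * k - 3" shows "coord i (\<phi> x) = coord i x"
proof -
  have "coord i (\<phi> x) = (if i \<le> k - 2 then coord i x else coord (k - 2 + (i - (k - 2))) x)"
    using assms card_target unfolding cross_cap_def Let_def by (subst coord_vec_of_coords) auto
  then show ?thesis by (cases "i \<le> k - 2") simp_all
qed

lemma coord_\<phi>_W1 [simp]:
  "coord (2 * k - 2) (\<phi> x) = y x ^ k + (\<Sum>i = 1..k - 2. coord i x * y x ^ i)"
  using card_target k unfolding cross_cap_def Let_def by (subst coord_vec_of_coords) auto

lemma coord_\<phi>_W2 [simp]:
  "coord (2 * k - 1) (\<phi> x) = (\<Sum>i = 1..k - 1. coord (k - 2 + i) x * y x ^ i)"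
  using card_target k unfolding cross_cap_def Let_def by (subst coord_vec_of_coords) auto

lemmas coord_\<phi>_W2_Suc [simp] = coord_\<phi>_W2[unfolded One_nat_def]

lemma target_cases:
  assumes "1 \<le> i" "i \<le> CARD('p)"
  obtains "i \<le> 2 * k - 3" | "i = 2 * k - 2" | "i = 2 * k - 1"
  using assms card_target k by linarith

lemma holo_\<phi> [simp, intro]: "holo_germ \<phi>" and vdiff_\<phi> [simp, intro]: "vdiff \<phi> x"
proof -
  have *: "vdiff \<phi> x" for x
    unfolding cross_cap_def Let_def
    by (rule vdiff_vec_of_coords) (auto intro!: cdiff_if cdiff_add cdiff_power cdiff_sum cdiff_mult)
  then show "vdiff \<phi> x" .
  show "holo_germ \<phi>" using * by (simp add: holo_germ_iff_vdiff)
qed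

lemma \<phi>_0 [simp]: "\<phi> 0 = 0"
proof (rule coord_eqI)
  fix i assume i: "1 \<le> i" "i \<le> CARD('p)"
  from this show "coord i (\<phi> 0) = coord i 0"
    by (rule target_cases) (use i(1) k in simp_all)
qed

text \<open>\<open>Py\<close> and \<open>Qy\<close> are the derivatives in y of the components W_1
  and W_2 of \<phi>.\<close>

definition Py :: "complex ^ 'n \<Rightarrow> complex" where
  "Py x = of_nat k * y x ^ (k - 1) + (\<Sum>i = 1..k - 2. of_nat i * coord i x * y x ^ (i - 1))"

definition Qy :: "complex ^ 'n \<Rightarrow> complex" where
  "Qy x = (\<Sum>i = 1..k - 1. of_nat i * coord (k - 2 + i) x * y x ^ (i - 1))"

lemma coord_d\<phi>_parameter [simp]:
  assumes "1 \<le> i" "i \<le> 2 * k - 3"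
  shows "coord i (frechet_derivative \<phi> (at x) v) = coord i v"
proof -
  have "(coord i has_derivative coord i) (at x)"
    by (rule bounded_linear_imp_has_derivative[OF bounded_linear_coord])
  then show ?thesis
    using assms by (simp add: coord_frechet_derivative flip: frechet_derivative_at)
qed

lemma has_derivative_coord_power:
  "((\<lambda>x. coord i x ^ m) has_derivative (\<lambda>h. of_nat m * coord i x ^ (m - 1) * coord i h)) (at (x :: complex ^ 'a))"
  by (auto intro!: derivative_eq_intros simp: algebra_simps)

lemma coord_d\<phi>_W1 [simp]:
  "coord (2 * k - 2) (frechet_derivative \<phi> (at x) v) = Py x * y v + (\<Sum>i = 1..k - 2. coord i v * y x ^ i)"
proof -
  have "((\<lambda>x. y x ^ k + (\<Sum>i = 1..k - 2. coord i x * y x ^ i)) has_derivative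
     (\<lambda>v. of_nat k * y x ^ (k - 1) * y v + (\<Sum>i = 1..k - 2. coord i x * (of_nat i * y x ^ (i - 1) * y v)
       + coord i v * y x ^ i))) (at x)"
    by (intro has_derivative_add has_derivative_sum has_derivative_mult has_derivative_coord_power
        has_derivative_coord has_derivative_ident)
  from frechet_derivative_at[OF this, symmetric] show ?thesis
    unfolding coord_frechet_derivative[OF vdiff_\<phi>] coord_\<phi>_W1
    by (simp add: Py_def sum.distrib sum_distrib_left algebra_simps)
qed

lemma coord_d\<phi>_W2 [simp]:
  "coord (2 * k - 1) (frechet_derivative \<phi> (at x) v)
    = Qy x * y v + (\<Sum>i = 1..k - 1. coord (k - 2 + i) v * y x ^ i)"
proof -
  have "((\<lambda>x. \<Sum>i = 1..k - 1. coord (k - 2 + i) x * y x ^ i) has_derivative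
     (\<lambda>v. (\<Sum>i = 1..k - 1. coord (k - 2 + i) x * (of_nat i * y x ^ (i - 1) * y v)
       + coord (k - 2 + i) v * y x ^ i))) (at x)"
    by (intro has_derivative_add has_derivative_sum has_derivative_mult has_derivative_coord_power
        has_derivative_coord has_derivative_ident)
  from frechet_derivative_at[OF this, symmetric] show ?thesis
    unfolding coord_frechet_derivative[OF vdiff_\<phi>] coord_\<phi>_W2
    by (simp add: Qy_def sum.distrib sum_distrib_left algebra_simps)
qed

lemma sum_lessThan_k: "(\<Sum>l<k. f l) = f 0 + (\<Sum>l = 1..k - 2. f l) + (f (k - 1) :: complex)"
proof -
  have "{..<k} = insert 0 (insert (k - 1) {1..k - 2})" using k by auto
  moreover have "0 \<notin> insert (k - 1) {1..k - 2}" "k - 1 \<notin> {1..k - 2}" using k by auto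
  ultimately show ?thesis by (simp del: atLeastAtMost_iff One_nat_def)
qed

text \<open>The coefficients of the relation y^k = W_1 - (sum of U_l y^l), which holds along \<phi>.
  Degree k - 1 is absent, which later makes it a special case.\<close>

definition cP :: "nat \<Rightarrow> complex ^ 'p \<Rightarrow> complex" where
  "cP l w = (if l = 0 then coord (2 * k - 2) w else if l \<le> k - 2 then - coord l w else 0)"

lemma hgerm_cP [simp, intro]: "hgerm (cP l)"
  unfolding cP_def[abs_def] by (cases "l = 0"; cases "l \<le> k - 2") auto

lemma cdiff_cP [simp]: "cdiff (cP l) w"
  unfolding cP_def[abs_def] by (cases "l = 0"; cases "l \<le> k - 2") (auto intro: cdiff_minus)

lemma cP_0 [simp]: "cP l 0 = 0"
  by (simp add: cP_def)

lemma y_power_k: "y x ^ k = (\<Sum>l<k. cP l (\<phi> x) * y x ^ l)"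
proof -
  have "(\<Sum>l = 1..k - 2. cP l (\<phi> x) * y x ^ l) = - (\<Sum>l = 1..k - 2. coord l x * y x ^ l)"
    unfolding sum_negf[symmetric] by (intro sum.cong) (auto simp: cP_def)
  then show ?thesis using k by (simp add: sum_lessThan_k) (simp add: cP_def)
qed

section \<open>Weierstrass division along the cross cap\<close>

definition jy :: 'n where "jy = from_nat_into UNIV (2 * k - 3)"

text \<open>The source point whose parameters are read off from \<open>w\<close> and whose last
  coordinate is \<open>z\<close>. It is defined for every \<open>w\<close>, on or off the image of
  \<phi>, so the coefficients of the division can be functions on the whole target.\<close>

definition subst_y :: "complex ^ 'p \<Rightarrow> complex \<Rightarrow> complex ^ 'n" where
  "subst_y w z = vec_of_coords (\<lambda>i. if i \<le> 2 * k - 3 then coord i w else 0) + z *s axis jy 1"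

lemma coord_axis_jy: "1 \<le> i \<Longrightarrow> i \<le> 2 * k - 2 \<Longrightarrow> coord i (axis jy 1 :: complex ^ 'n) = (if i = 2 * k - 2 then 1 else 0)"
proof -
  assume i: "1 \<le> i" "i \<le> 2 * k - 2"
  have "inj_on (from_nat_into (UNIV :: 'n set)) {..<CARD('n)}"
    using bij_betw_from_nat_into_finite[of "UNIV :: 'n set"] by (simp add: bij_betw_def)
  then have "from_nat_into (UNIV :: 'n set) (i - 1) = from_nat_into UNIV (2 * k - 3) \<longleftrightarrow> i - 1 = 2 * k - 3"
    using i k card_source by (intro inj_on_eq_iff) auto
  then show ?thesis using i k by (auto simp: coord_def axis_def jy_def)
qed

lemma subst_y_\<phi>: "subst_y (\<phi> x) (y x) = x"
proof (rule coord_eqI)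
  fix i assume "1 \<le> i" "i \<le> CARD('n)"
  then show "coord i (subst_y (\<phi> x) (y x)) = coord i x"
    using card_source k
    by (cases "i = 2 * k - 2") (auto simp: subst_y_def coord_vec_of_coords coord_axis_jy)
qed

text \<open>For \<open>p(\<zeta>) = \<zeta>\<^sup>k - (\<Sum>l<k. cP l (\<phi> x) * \<zeta>\<^sup>l)\<close>, which vanishes at \<open>y x\<close>, the quotient \<open>p(\<zeta>) / (\<zeta> - y x)\<close> is a
  polynomial in \<open>y x\<close> of degree below \<open>k\<close>; inserting it into Cauchy's formula gives the division.\<close>

lemma weierstrass_division:
  assumes A: "hgerm (A :: complex ^ 'n \<Rightarrow> complex)"
  obtains r where "\<And>j. hgerm (r j :: complex ^ 'p \<Rightarrow> complex)"
    "\<forall>\<^sub>F x in nhds 0. A x = (\<Sum>j<k. r j (\<phi> x) * y x ^ j)"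
proof -
  obtain R where R: "R > 0" "\<And>x. x \<in> ball 0 R \<Longrightarrow> cdiff A x" using hgerm_ball[OF A] by blast
  define r where "r = R / 2"
  have r: "r > 0" using R by (simp add: r_def)
  have hs: "holo_germ (\<lambda>w. subst_y w 0)"
    unfolding subst_y_def by (intro holo_germ_add holo_germ_vec_of_coords) auto
  have s0: "subst_y 0 0 = 0"
    by (intro coord_eqI) (auto simp: subst_y_def coord_vec_of_coords)
  have ev1: "\<forall>\<^sub>F w in nhds 0. norm (subst_y w 0) < r"
    using holo_germ_eventually[OF hs s0, of "\<lambda>x. norm x < r"] eventually_nhds_in_open[of "ball 0 r" "0 :: complex ^ 'n"] r
    by simp
  \<comment> \<open>A bound for the lower-order terms of p on the circle of radius \<open>r\<close>.
    It vanishes at w = 0, so for small \<open>w\<close> the term of degree k dominates and p has no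
    zero on the circle.\<close>
  define g where "g = (\<lambda>w. \<Sum>l<k. norm (cP l w) * r ^ l)"
  have "isCont g 0" unfolding g_def by (intro continuous_intros hgerm_isCont) auto
  moreover have "\<forall>\<^sub>F z in nhds (g 0). z < r ^ k"
    using eventually_nhds_in_open[of "{..<r ^ k}" "g 0"] r by (simp add: g_def)
  ultimately have "\<forall>\<^sub>F w in nhds 0. g w < r ^ k"
    by (rule eventually_isCont_nhds)
  with ev1 have "\<forall>\<^sub>F w in nhds 0. norm (subst_y w 0) < r \<and> g w < r ^ k" by (rule eventually_conj)
  then obtain d where d: "d > 0" "\<And>w. w \<in> ball 0 d \<Longrightarrow> norm (subst_y w 0) < r" "\<And>w. w \<in> ball 0 d \<Longrightarrow> g w < r ^ k"
    unfolding eventually_nhds_metric by (auto simp: dist_commute)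
  have subst_eq: "subst_y w z = subst_y w 0 + z *s axis jy 1" for w z by (simp add: subst_y_def)
  have in_ball: "subst_y w z \<in> ball 0 R" if "w \<in> ball 0 d" "norm z \<le> r" for w z
    using norm_triangle_ineq[of "subst_y w 0" "z *s axis jy 1"] d(2)[OF that(1)] that(2)
    unfolding subst_eq[of w z] by (simp add: norm_scale_axis r_def)
  define a where "a i w = (if i = k then 1 else - cP i w)" for i w
  have p_eq: "(\<Sum>i\<le>k. a i w * z ^ i) = z ^ k - (\<Sum>l<k. cP l w * z ^ l)" for w z
    by (simp add: a_def lessThan_Suc_atMost[symmetric] sum_negf)
  define p where "p w z = (\<Sum>i\<le>k. a i w * z ^ i)" for w z
  \<comment> \<open>The coefficient of (y x)^j in the difference quotient of p between
    \<open>z\<close> and y x. It involves only \<open>w\<close> and \<open>z\<close>, which lets y x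
    be pulled out of the integral.\<close>
  define q where "q j w z = (\<Sum>i = Suc j..k. a i w * z ^ (i - j - 1))" for j w z
  have p_nz: "p w z \<noteq> 0" if "w \<in> ball 0 d" "norm z = r" for w z
  proof
    assume "p w z = 0"
    then have "norm (z ^ k) = norm (\<Sum>l<k. cP l w * z ^ l)" by (simp add: p_def p_eq)
    also have "\<dots> \<le> g w" unfolding g_def
      by (rule order_trans[OF norm_sum]) (simp add: norm_mult norm_power that)
    finally show False using d(3)[OF that(1)] that by (simp add: norm_power)
  qed
  have cdiff_a: "cdiff (a i) w" for i w unfolding a_def[abs_def] by (cases "i = k") (auto intro: cdiff_minus)
  have cont_a: "continuous_on S (a i)" for S i by (intro continuous_on_cdiff cdiff_a)
  define F where "F j w t = A (subst_y w (circlepath 0 r t)) * q j w (circlepath 0 r t) / p w (circlepath 0 r t)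
    * circlepath 0 r t" for j w t
  have nc: "norm (circlepath 0 r t) = r" for t using r by (simp add: norm_circlepath)
  have contA: "continuous_on (ball 0 R) A" by (intro continuous_on_cdiff R(2))
  have contF: "continuous_on (ball 0 d \<times> {0..1}) (\<lambda>(w, t). F j w t)" for j
  proof -
    have ca: "continuous_on (ball 0 d \<times> {0..1}) (\<lambda>q. a i (fst q))" for i
      by (rule continuous_on_compose2[OF cont_a[of UNIV]]) (auto intro: continuous_intros)
    have "continuous_on (ball 0 d \<times> {0..1 :: real}) (\<lambda>q. subst_y (fst q) (circlepath 0 r (snd q)))"
    proof -
      let ?S = "ball 0 d \<times> {0..1 :: real} :: ((complex ^ 'p) \<times> real) set"
      have "continuous_on ?S (\<lambda>q. if i \<le> 2 * k - 3 then coord i (fst q) else 0)" for i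
        by (cases "i \<le> 2 * k - 3") (auto intro!: continuous_on_coord continuous_on_fst continuous_on_id)
      moreover have "continuous_on ?S (\<lambda>q. circlepath 0 r (snd q) *s axis jy 1)"
        unfolding vector_scalar_mult_def
        by (intro continuous_on_vec_lambda continuous_on_mult continuous_on_circlepath continuous_on_snd
            continuous_on_id continuous_on_const)
      ultimately show ?thesis unfolding subst_y_def
        by (intro continuous_on_add continuous_on_vec_of_coords)
    qed
    then have "continuous_on (ball 0 d \<times> {0..1 :: real}) (\<lambda>q. A (subst_y (fst q) (circlepath 0 r (snd q))))"
      using in_ball nc by (intro continuous_on_compose2[OF contA, of _ "\<lambda>q. subst_y (fst q) (circlepath 0 r (snd q))"]) auto
    then show ?thesis
      unfolding case_prod_beta F_def using p_nz nc
      by (intro continuous_on_mult continuous_on_divide)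
        (auto simp: p_def q_def intro!: continuous_intros ca)
  qed
  have contFt: "continuous_on {0..1} (F j w)" if "w \<in> ball 0 d" for j w
    using that by (intro continuous_on_compose2[OF contF, of _ "\<lambda>t. (w, t)", simplified] continuous_intros) auto
  define \<rho> where "\<rho> j w = integral {0..1} (F j w)" for j w
  have hg: "hgerm (\<rho> j)" for j
  proof (rule hgermI_ball[OF d(1)])
    fix w :: "complex ^ 'p" assume w: "w \<in> ball 0 d"
    show "cdiff (\<rho> j) w"
      unfolding \<rho>_def[abs_def]
    proof (rule cdiff_integral[OF contF _ w])
      fix w :: "complex ^ 'p" and t :: real assume w: "w \<in> ball 0 d"
      have vs: "vdiff (\<lambda>w. subst_y w (circlepath 0 r t)) w"
        unfolding subst_y_def by (intro vdiff_add vdiff_vec_of_coords cdiff_if) (auto simp: vdiff_def)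
      have "cdiff A (subst_y w (circlepath 0 r t))" using in_ball[OF w] nc R(2) by simp
      from cdiff_compose[OF this vs] show "cdiff (\<lambda>w. F j w t) w"
        unfolding F_def using p_nz[OF w nc]
        by (intro cdiff_mult[OF cdiff_divide[OF cdiff_mult]])
          (auto simp: p_def q_def intro!: cdiff_sum cdiff_mult cdiff_a)
    qed
  qed
  have eq: "A x = (\<Sum>j<k. \<rho> j (\<phi> x) * y x ^ j)" if x: "\<phi> x \<in> ball 0 d" "norm (y x) < r" for x
  proof -
    let ?f = "\<lambda>z. A (subst_y (\<phi> x) z)"
    have der: "(?f has_field_derivative frechet_derivative A (at (subst_y (\<phi> x) z)) (axis jy 1)) (at z)"
      if "z \<in> cball 0 r" for z
      using cdiff_line[of A "subst_y (\<phi> x) 0" z "axis jy 1"] R(2)[OF in_ball[OF x(1), of z]] that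
      by (simp add: subst_y_def)
    have cont: "continuous_on (cball 0 r) ?f"
      by (rule DERIV_continuous_on) (blast intro: has_field_derivative_at_within der)
    have hol: "?f holomorphic_on ball 0 r"
      using der by (intro holomorphic_onI)
        (meson ball_subset_cball field_differentiable_at_within field_differentiable_def subsetD)
    \<comment> \<open>Cauchy's formula in the last coordinate alone, with the parameters fixed at
      their values at \<open>x\<close>.\<close>
    have "((\<lambda>u. ?f u / (u - y x)) has_contour_integral (2 * pi * \<i>) * ?f (y x)) (circlepath 0 r)"
      using Cauchy_integral_circlepath[OF cont hol, of "y x"] x(2) by simp
    from integral_circlepath[OF this]
    have "A x = integral {0..1} (\<lambda>t. ?f (circlepath 0 r t) / (circlepath 0 r t - y x) * circlepath 0 r t)"
      by (simp add: subst_y_\<phi>)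
    also have "\<dots> = integral {0..1} (\<lambda>t. \<Sum>j<k. F j (\<phi> x) t * y x ^ j)"
    proof (rule integral_cong)
      fix t :: real
      define z where "z = circlepath 0 r t"
      have z: "norm z = r" by (simp add: z_def nc)
      have "p (\<phi> x) (y x) = 0" by (simp add: p_def p_eq y_power_k[symmetric])
      then have "- p (\<phi> x) z = (y x - z) * (\<Sum>j<k. q j (\<phi> x) z * y x ^ j)"
        using polyfun_diff[where a = "\<lambda>i. a i (\<phi> x)" and x = "y x" and n = k and y = z] k by (simp add: p_def q_def)
      then have pz: "p (\<phi> x) z = (z - y x) * (\<Sum>j<k. q j (\<phi> x) z * y x ^ j)"
        by (simp add: algebra_simps)
      have "1 / (z - y x) = (\<Sum>j<k. q j (\<phi> x) z * y x ^ j) / p (\<phi> x) z"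
        using p_nz[OF x(1) z] unfolding pz by simp
      then have "?f z / (z - y x) * z = ?f z * ((\<Sum>j<k. q j (\<phi> x) z * y x ^ j) / p (\<phi> x) z) * z"
        by (metis divide_inverse inverse_eq_divide)
      then show "?f (circlepath 0 r t) / (circlepath 0 r t - y x) * circlepath 0 r t
          = (\<Sum>j<k. F j (\<phi> x) t * y x ^ j)"
        by (simp add: F_def z_def sum_distrib_left sum_distrib_right sum_divide_distrib mult_ac)
    qed
    also have "\<dots> = (\<Sum>j<k. integral {0..1} (\<lambda>t. F j (\<phi> x) t * y x ^ j))"
      using contFt[OF x(1)] by (intro integral_sum integrable_continuous_interval continuous_intros) auto
    also have "\<dots> = (\<Sum>j<k. \<rho> j (\<phi> x) * y x ^ j)"
      by (simp add: \<rho>_def)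
    finally show ?thesis .
  qed
  have "isCont y 0" by (rule hgerm_isCont) simp
  then have "\<forall>\<^sub>F x in nhds 0. norm (y x) < r"
    by (rule eventually_isCont_nhds) (use eventually_nhds_in_open[of "ball 0 r" "0 :: complex"] r in simp)
  moreover have "\<forall>\<^sub>F x in nhds 0. \<phi> x \<in> ball 0 d"
    by (rule holo_germ_eventually[OF holo_\<phi> \<phi>_0]) (rule eventually_nhds_in_open, use d(1) in auto)
  ultimately have "\<forall>\<^sub>F x in nhds 0. A x = (\<Sum>j<k. \<rho> j (\<phi> x) * y x ^ j)"
    by eventually_elim (rule eq)
  with hg show ?thesis using that by blast
qed

end

subsection \<open>The ideal of liftable fields\<close>

lemma germ_ideal_cmult:
  assumes "germ_ideal I" "a \<in> I" shows "(\<lambda>x. c * a x) \<in> I"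
  by (rule germ_ideal_mult[OF assms(1) hgerm_const assms(2)])

lemma germ_ideal_cdiv:
  assumes "germ_ideal I" "(\<lambda>x. c * a x) \<in> I" "c \<noteq> 0" shows "a \<in> I"
  using germ_ideal_cmult[OF assms(1,2), of "inverse c"] assms(3) by (simp add: mult.assoc[symmetric])

section \<open>Reduction of powers of y\<close>

context minimal_cross_cap
begin

text \<open>\<open>red m l\<close> is the coefficient of \<open>y\<^sup>l\<close> in the reduction of \<open>y\<^sup>m\<close>, see \<open>y_power_red\<close>.\<close>

primrec red :: "nat \<Rightarrow> nat \<Rightarrow> complex ^ 'p \<Rightarrow> complex" where
  "red 0 l w = (if l = 0 then 1 else 0)"
| "red (Suc m) l w = (if l = 0 then 0 else red m (l - 1) w) + red m (k - 1) w * cP l w"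

lemma red_less: "m < k \<Longrightarrow> l < k \<Longrightarrow> red m l w = (if l = m then 1 else 0)"
  by (induction m arbitrary: l) auto

lemma hgerm_red [simp, intro]: "hgerm (red m l)"
proof (induction m arbitrary: l)
  case 0
  show ?case unfolding red.simps by (rule hgerm_if) auto
next
  case (Suc m)
  have "hgerm (\<lambda>w. (if l = 0 then 0 else red m (l - 1) w) + red m (k - 1) w * cP l w)"
    by (intro hgerm_add hgerm_if hgerm_mult Suc) auto
  then show ?case by simp
qed

lemma y_power_red: "y x ^ m = (\<Sum>l<k. red m l (\<phi> x) * y x ^ l)"
proof (induction m)
  case 0
  then show ?case using k by (simp add: if_distrib[of "\<lambda>z. z * _"] cong: if_cong)
next
  case (Suc m)
  obtain n where n: "k = Suc n" using k by (cases k) auto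
  have "y x ^ Suc m = y x * (\<Sum>l<k. red m l (\<phi> x) * y x ^ l)"
    by (simp only: Suc power_Suc)
  also have "\<dots> = (\<Sum>l<k. red m l (\<phi> x) * y x ^ Suc l)"
    by (simp add: sum_distrib_left mult.left_commute)
  also have "\<dots> = (\<Sum>l<n. red m l (\<phi> x) * y x ^ Suc l) + red m (k - 1) (\<phi> x) * y x ^ k"
    by (simp add: n)
  also have "(\<Sum>l<n. red m l (\<phi> x) * y x ^ Suc l) = (\<Sum>l<k. (if l = 0 then 0 else red m (l - 1) (\<phi> x)) * y x ^ l)"
    unfolding n by (subst sum.lessThan_Suc_shift) simp
  also have "red m (k - 1) (\<phi> x) * y x ^ k = (\<Sum>l<k. red m (k - 1) (\<phi> x) * cP l (\<phi> x) * y x ^ l)"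
    by (simp add: y_power_k sum_distrib_left mult.assoc)
  finally show ?case by (simp add: sum.distrib distrib_right)
qed

lemma red_k:
  assumes "l < k" shows "red k l w = cP l w"
proof -
  obtain n where n: "k = Suc n" using k by (cases k) auto
  have "red (Suc n) l w = (if l = 0 then 0 else red n (l - 1) w) + red n (k - 1) w * cP l w"
    by (rule red.simps(2))
  moreover have "red n (k - 1) w = 1" using n by (subst red_less) auto
  moreover have "red n (l - 1) w = 0" if "l \<noteq> 0" using n assms that by (subst red_less) auto
  ultimately show ?thesis by (simp add: n)
qed

text \<open>At the origin the relation reads y^k = 0, so all higher powers reduce to 0 as
  well.\<close>

lemma red_add_k_0: "l < k \<Longrightarrow> red (k + t) l 0 = 0"
proof (induction t arbitrary: l)
  case 0
  then show ?case by (simp add: red_k)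
qed simp

lemma red_0_eq_0: "k \<le> m \<Longrightarrow> l < k \<Longrightarrow> red m l 0 = 0"
  using red_add_k_0[of l "m - k"] by simp

text \<open>To first order y^(k+t) is the sum of \<open>cP l\<close> y^(l+t). Terms with l + t \<ge>
  k must be reduced again, which costs a second factor vanishing at 0, so they drop out.\<close>

lemma red_add_k_mod_square:
  assumes I: "germ_ideal I" and "l < k"
  shows "(\<lambda>w. red (k + t) l w - (if t \<le> l then cP (l - t) w else 0)) \<in> mod_square I"
  using assms(2)
proof (induction t arbitrary: l)
  case 0
  then have "(\<lambda>w. red (k + 0) l w - (if 0 \<le> l then cP (l - 0) w else 0)) = (\<lambda>_. 0)" by (simp add: red_k)
  then show ?case by (simp only: germ_ideal_zero[OF germ_ideal_mod_square[OF I]])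
next
  case (Suc t)
  note J = germ_ideal_mod_square[OF I]
  have *: "(\<lambda>w. red (k + t) (k - 1) w * cP l w) \<in> mod_square I"
    using k by (intro mult_in_mod_square[OF I]) (auto simp: red_add_k_0)
  show ?case
  proof (cases "l = 0")
    case True
    with * show ?thesis by simp
  next
    case False
    have "(\<lambda>w. (red (k + t) (l - 1) w - (if t \<le> l - 1 then cP (l - 1 - t) w else 0))
        + red (k + t) (k - 1) w * cP l w) \<in> mod_square I"
      using Suc.prems by (intro germ_ideal_add[OF J Suc.IH *]) auto
    moreover have "red (k + Suc t) l w - (if Suc t \<le> l then cP (l - Suc t) w else 0)
      = (red (k + t) (l - 1) w - (if t \<le> l - 1 then cP (l - 1 - t) w else 0))
        + red (k + t) (k - 1) w * cP l w" for w
      unfolding diff_Suc_eq_diff_pred[of l t] using False by auto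
    ultimately show ?thesis by (simp only:)
  qed
qed

lemma Py_mult_power:
  "Py x * y x ^ j = of_nat k * y x ^ (k - 1 + j) + (\<Sum>i = 1..k - 2. of_nat i * coord i x * y x ^ (i + j - 1))"
  unfolding Py_def distrib_right sum_distrib_right
  by (intro arg_cong2[of _ _ _ _ "(+)"] sum.cong) (auto simp: power_add[symmetric] mult.assoc)

lemma Qy_mult_power:
  "Qy x * y x ^ j = (\<Sum>i = 1..k - 1. of_nat i * coord (k - 2 + i) x * y x ^ (i + j - 1))"
  unfolding Qy_def sum_distrib_right
  by (intro sum.cong) (auto simp: power_add[symmetric] mult.assoc)

text \<open>\<open>dP l\<close> and \<open>dQ l\<close> are the coefficients of y^l in
  \<open>Py\<close> and \<open>Qy\<close>, as functions on the target; the top term k y^(k-1) of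
  \<open>Py\<close> is kept apart.\<close>

definition dP :: "nat \<Rightarrow> complex ^ 'p \<Rightarrow> complex" where
  "dP l w = (if l + 1 \<le> k - 2 then of_nat (l + 1) * coord (l + 1) w else 0)"

definition dQ :: "nat \<Rightarrow> complex ^ 'p \<Rightarrow> complex" where
  "dQ l w = (if l + 1 \<le> k - 1 then of_nat (l + 1) * coord (k - 2 + (l + 1)) w else 0)"

lemma hgerm_dP: "hgerm (dP l)" and hgerm_dQ: "hgerm (dQ l)"
  unfolding dP_def[abs_def] dQ_def[abs_def] by (intro hgerm_if hgerm_mult; auto)+

lemma dP_0: "dP l 0 = 0" and dQ_0: "dQ l 0 = 0"
  by (simp_all add: dP_def dQ_def)

lemma Py_eq: "Py x = of_nat k * y x ^ (k - 1) + (\<Sum>l<k - 1. dP l (\<phi> x) * y x ^ l)"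
proof -
  have "(\<Sum>i = 1..k - 2. of_nat i * coord i x * y x ^ (i - 1)) = (\<Sum>l<k - 2. of_nat (l + 1) * coord (l + 1) x * y x ^ l)"
    unfolding One_nat_def by (subst sum.atLeast1_atMost_eq) simp
  also have "\<dots> = (\<Sum>l<k - 1. dP l (\<phi> x) * y x ^ l)"
    by (rule sum.mono_neutral_cong_left) (auto simp: dP_def)
  finally show ?thesis unfolding Py_def by simp
qed

lemma Qy_eq: "Qy x = (\<Sum>l<k. dQ l (\<phi> x) * y x ^ l)"
proof -
  have "Qy x = (\<Sum>l<k - 1. of_nat (l + 1) * coord (k - 2 + (l + 1)) x * y x ^ l)"
    unfolding Qy_def One_nat_def by (subst sum.atLeast1_atMost_eq) simp
  also have "\<dots> = (\<Sum>l<k. dQ l (\<phi> x) * y x ^ l)"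
    by (rule sum.mono_neutral_cong_left) (auto simp: dQ_def)
  finally show ?thesis .
qed

end

locale linear_section = minimal_cross_cap k source target
  for k :: nat and source :: "'n::finite itself" and target :: "'p::finite itself" +
  fixes \<alpha> \<beta> :: "nat \<Rightarrow> complex" and \<gamma>\<^sub>1 \<gamma>\<^sub>2 :: complex
  assumes \<alpha>: "\<alpha> (k - 2) \<noteq> 0" and \<beta>: "\<beta> (k - 1) \<noteq> 0"
begin

definition h :: "complex ^ 'p \<Rightarrow> complex" where
  "h w = (\<Sum>i = 1..k - 2. \<alpha> i * coord i w) + (\<Sum>i = 1..k - 1. \<beta> i * coord (k - 2 + i) w)
         + \<gamma>\<^sub>1 * coord (2 * k - 2) w + \<gamma>\<^sub>2 * coord (2 * k - 1) w"

text \<open>Along \<open>\<phi>\<close>, the fields \<open>\<partial>/\<partial>u\<^sub>i\<close> and \<open>\<partial>/\<partial>v\<^sub>i\<close> eliminate the first \<open>2k - 3\<close> components.  A liftable field \<open>\<xi>\<close>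
  thus amounts to the two equations below, where \<open>p\<close> lists the components of \<open>\<xi>\<close> at \<open>W\<^sub>1, - U\<^sub>1, - U\<^sub>2, \<dots>\<close> and
  \<open>q\<close> those at \<open>W\<^sub>2, - V\<^sub>1, - V\<^sub>2, \<dots>\<close>, and \<open>- \<eta>\<close> is the \<open>y\<close>-component of the lift.  In these terms
  \<open>dh(\<xi>) = lam p q\<close>.\<close>

definition lift_relation ::
  "(complex ^ 'n \<Rightarrow> complex) \<Rightarrow> (nat \<Rightarrow> complex ^ 'p \<Rightarrow> complex) \<Rightarrow> (nat \<Rightarrow> complex ^ 'p \<Rightarrow> complex) \<Rightarrow> bool" where
  "lift_relation \<eta> p q \<longleftrightarrow> hgerm \<eta> \<and> (\<forall>l. hgerm (p l)) \<and> (\<forall>l. hgerm (q l)) \<and>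
     (\<forall>\<^sub>F x in nhds 0. Py x * \<eta> x + (\<Sum>l<k - 1. p l (\<phi> x) * y x ^ l) = 0 \<and>
                      Qy x * \<eta> x + (\<Sum>l<k. q l (\<phi> x) * y x ^ l) = 0)"

lemma lift_relationD:
  assumes "lift_relation \<eta> p q"
  shows "hgerm \<eta>" "hgerm (p l)" "hgerm (q l)"
    and "\<forall>\<^sub>F x in nhds 0. Py x * \<eta> x + (\<Sum>l<k - 1. p l (\<phi> x) * y x ^ l) = 0 \<and>
                      Qy x * \<eta> x + (\<Sum>l<k. q l (\<phi> x) * y x ^ l) = 0"
  using assms by (auto simp: lift_relation_def)

text \<open>\<open>a\<close> and \<open>b\<close> list the coefficients of h in the order of p and
  q. Their minus signs match those in front of the U- and V-components of the liftable
  field.\<close>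

definition a :: "nat \<Rightarrow> complex" where "a l = (if l = 0 then \<gamma>\<^sub>1 else - \<alpha> l)"
definition b :: "nat \<Rightarrow> complex" where "b l = (if l = 0 then \<gamma>\<^sub>2 else - \<beta> l)"

definition lam :: "(nat \<Rightarrow> complex ^ 'p \<Rightarrow> complex) \<Rightarrow> (nat \<Rightarrow> complex ^ 'p \<Rightarrow> complex) \<Rightarrow> complex ^ 'p \<Rightarrow> complex" where
  "lam p q w = (\<Sum>l<k - 1. a l * p l w) + (\<Sum>l<k. b l * q l w)"

definition lift_ideal :: "(complex ^ 'p \<Rightarrow> complex) set" where
  "lift_ideal = {f. \<exists>\<eta> p q. lift_relation \<eta> p q \<and> (\<forall>\<^sub>F w in nhds 0. f w = lam p q w)}"

lemma a_nz: "a (k - 2) \<noteq> 0" and b_nz: "b (k - 1) \<noteq> 0"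
  using k \<alpha> \<beta> by (auto simp: a_def b_def)

lemma lift_idealI: "lift_relation \<eta> p q \<Longrightarrow> lam p q \<in> lift_ideal"
  using always_eventually[of "\<lambda>w. lam p q w = lam p q w"] unfolding lift_ideal_def by blast

text \<open>Liftable fields form a module over the germs on the target: multiplying a lift of \<xi>
  by \<open>c \<circ> \<phi>\<close> gives a lift of c \<xi>. The map \<open>lam\<close> is linear
  over these germs.\<close>

lemma germ_ideal_lift_ideal: "germ_ideal lift_ideal"
  unfolding germ_ideal_def
proof (intro conjI ballI allI impI subsetI)
  fix f assume "f \<in> lift_ideal"
  then obtain \<eta> p q where *: "lift_relation \<eta> p q" "\<forall>\<^sub>F w in nhds 0. f w = lam p q w"
    unfolding lift_ideal_def by blast
  have "hgerm (lam p q)"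
    using *(1) unfolding lam_def[abs_def] lift_relation_def by (intro hgerm_add hgerm_sum hgerm_mult) auto
  then show "f \<in> Collect hgerm" using hgerm_cong_ev[OF *(2)] by simp
next
  have "lift_relation (\<lambda>_. 0) (\<lambda>_ _. 0) (\<lambda>_ _. 0)" by (simp add: lift_relation_def)
  from lift_idealI[OF this] show "(\<lambda>_. 0) \<in> lift_ideal" by (simp add: lam_def[abs_def])
next
  fix f g assume "f \<in> lift_ideal" "g \<in> lift_ideal"
  then obtain \<eta> p q \<eta>' p' q' where
    f: "lift_relation \<eta> p q" "\<forall>\<^sub>F w in nhds 0. f w = lam p q w" and
    g: "lift_relation \<eta>' p' q'" "\<forall>\<^sub>F w in nhds 0. g w = lam p' q' w"
    unfolding lift_ideal_def by blast
  have "lift_relation (\<lambda>x. \<eta> x + \<eta>' x) (\<lambda>l w. p l w + p' l w) (\<lambda>l w. q l w + q' l w)"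
    unfolding lift_relation_def
  proof (intro conjI allI hgerm_add lift_relationD(1-3)[OF f(1)] lift_relationD(1-3)[OF g(1)])
    show "\<forall>\<^sub>F x in nhds 0. Py x * (\<eta> x + \<eta>' x) + (\<Sum>l<k - 1. (p l (\<phi> x) + p' l (\<phi> x)) * y x ^ l) = 0 \<and>
        Qy x * (\<eta> x + \<eta>' x) + (\<Sum>l<k. (q l (\<phi> x) + q' l (\<phi> x)) * y x ^ l) = 0"
      using lift_relationD(4)[OF f(1)] lift_relationD(4)[OF g(1)]
    proof eventually_elim
      case (elim x)
      have "Py x * (\<eta> x + \<eta>' x) + (\<Sum>l<k - 1. (p l (\<phi> x) + p' l (\<phi> x)) * y x ^ l)
        = (Py x * \<eta> x + (\<Sum>l<k - 1. p l (\<phi> x) * y x ^ l)) + (Py x * \<eta>' x + (\<Sum>l<k - 1. p' l (\<phi> x) * y x ^ l))"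
       "Qy x * (\<eta> x + \<eta>' x) + (\<Sum>l<k. (q l (\<phi> x) + q' l (\<phi> x)) * y x ^ l)
        = (Qy x * \<eta> x + (\<Sum>l<k. q l (\<phi> x) * y x ^ l)) + (Qy x * \<eta>' x + (\<Sum>l<k. q' l (\<phi> x) * y x ^ l))"
        by (simp_all add: algebra_simps sum.distrib)
      with elim show ?case by simp
    qed
  qed
  moreover have "\<forall>\<^sub>F w in nhds 0. f w + g w = lam (\<lambda>l w. p l w + p' l w) (\<lambda>l w. q l w + q' l w) w"
    using f(2) g(2) by eventually_elim (simp add: lam_def algebra_simps sum.distrib)
  ultimately show "(\<lambda>w. f w + g w) \<in> lift_ideal" unfolding lift_ideal_def by blast
next
  fix c f :: "complex ^ 'p \<Rightarrow> complex" assume c: "hgerm c" and "f \<in> lift_ideal"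
  then obtain \<eta> p q where *: "lift_relation \<eta> p q" "\<forall>\<^sub>F w in nhds 0. f w = lam p q w"
    unfolding lift_ideal_def by blast
  have "lift_relation (\<lambda>x. c (\<phi> x) * \<eta> x) (\<lambda>l w. c w * p l w) (\<lambda>l w. c w * q l w)"
    unfolding lift_relation_def
  proof (intro conjI allI hgerm_mult hgerm_compose[OF c holo_\<phi> \<phi>_0] c lift_relationD(1-3)[OF *(1)])
    show "\<forall>\<^sub>F x in nhds 0. Py x * (c (\<phi> x) * \<eta> x) + (\<Sum>l<k - 1. c (\<phi> x) * p l (\<phi> x) * y x ^ l) = 0 \<and>
        Qy x * (c (\<phi> x) * \<eta> x) + (\<Sum>l<k. c (\<phi> x) * q l (\<phi> x) * y x ^ l) = 0"
      using lift_relationD(4)[OF *(1)]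
    proof eventually_elim
      case (elim x)
      have "Py x * (c (\<phi> x) * \<eta> x) + (\<Sum>l<k - 1. c (\<phi> x) * p l (\<phi> x) * y x ^ l)
        = c (\<phi> x) * (Py x * \<eta> x + (\<Sum>l<k - 1. p l (\<phi> x) * y x ^ l))"
       "Qy x * (c (\<phi> x) * \<eta> x) + (\<Sum>l<k. c (\<phi> x) * q l (\<phi> x) * y x ^ l)
        = c (\<phi> x) * (Qy x * \<eta> x + (\<Sum>l<k. q l (\<phi> x) * y x ^ l))"
        by (simp_all add: algebra_simps sum_distrib_left)
      with elim show ?case by simp
    qed
  qed
  moreover have "\<forall>\<^sub>F w in nhds 0. c w * f w = lam (\<lambda>l w. c w * p l w) (\<lambda>l w. c w * q l w) w"
    using *(2) by eventually_elim (simp add: lam_def algebra_simps sum_distrib_left)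
  ultimately show "(\<lambda>w. c w * f w) \<in> lift_ideal" unfolding lift_ideal_def by blast
next
  fix f g assume "f \<in> lift_ideal" and fg: "\<forall>\<^sub>F w in nhds 0. f w = g w"
  then obtain \<eta> p q where *: "lift_relation \<eta> p q" "\<forall>\<^sub>F w in nhds 0. f w = lam p q w"
    unfolding lift_ideal_def by blast
  from fg *(2) have "\<forall>\<^sub>F w in nhds 0. g w = lam p q w" by eventually_elim simp
  with *(1) show "g \<in> lift_ideal" unfolding lift_ideal_def by blast
qed

section \<open>Coordinate functions modulo squares\<close>

lemmas ideal_lift_sq = germ_ideal_mod_square[OF germ_ideal_lift_ideal]

lemma mult_in_lift_sq:
  "hgerm f \<Longrightarrow> f 0 = 0 \<Longrightarrow> hgerm g \<Longrightarrow> g 0 = 0 \<Longrightarrow> (\<lambda>w. f w * g w) \<in> mod_square lift_ideal"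
  by (rule mult_in_mod_square[OF germ_ideal_lift_ideal])

lemma lam_in_mod_square: "lift_relation \<eta> p q \<Longrightarrow> lam p q \<in> mod_square lift_ideal"
  by (rule mod_square_supset[OF germ_ideal_lift_ideal lift_idealI])

text \<open>The relation is the reduction of \<open>W\<^sub>2 y\<^sup>j = (\<Sum>i. v\<^sub>i y\<^sup>i\<^sup>+\<^sup>j)\<close>, lifted by \<open>\<eta> = 0\<close>.\<close>

lemma W2_V_relation_in_mod_square:
  assumes "j < k"
  shows "(\<lambda>w. b j * coord (2 * k - 1) w - (\<Sum>i = 1..k - 1 - j. b (i + j) * coord (k - 2 + i) w)) \<in> mod_square lift_ideal"
proof -
  define q where "q l w = (if l = j then coord (2 * k - 1) w else 0) - (\<Sum>i = 1..k - 1. coord (k - 2 + i) w * red (i + j) l w)" for l w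
  have "(\<Sum>l<k. q l (\<phi> x) * y x ^ l) = 0" for x
  proof -
    have "(\<Sum>l<k. q l (\<phi> x) * y x ^ l) = coord (2 * k - 1) (\<phi> x) * y x ^ j
        - (\<Sum>l<k. \<Sum>i = 1..k - 1. coord (k - 2 + i) (\<phi> x) * (red (i + j) l (\<phi> x) * y x ^ l))"
      using assms by (simp add: q_def left_diff_distrib sum_subtractf sum_distrib_right mult.assoc
          if_distrib[of "\<lambda>z. z * _"] cong: if_cong)
    also have "(\<Sum>l<k. \<Sum>i = 1..k - 1. coord (k - 2 + i) (\<phi> x) * (red (i + j) l (\<phi> x) * y x ^ l))
      = (\<Sum>i = 1..k - 1. coord (k - 2 + i) x * y x ^ (i + j))"
      unfolding y_power_red[of x "_ + j"] sum_distrib_left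
      using k by (subst sum.swap) (auto intro!: sum.cong)
    finally show ?thesis by (simp add: sum_distrib_right power_add mult.assoc)
  qed
  then have "lift_relation (\<lambda>_. 0) (\<lambda>_ _. 0) q"
    unfolding lift_relation_def q_def by (auto intro!: hgerm_diff hgerm_sum hgerm_mult)
  then have lam: "lam (\<lambda>_ _. 0) q \<in> mod_square lift_ideal" by (rule lam_in_mod_square)
  let ?r = "\<lambda>i w. coord (k - 2 + i) w * (\<Sum>l<k. b l * red (i + j) l w)"
  have lam_eq: "lam (\<lambda>_ _. 0) q w = b j * coord (2 * k - 1) w - (\<Sum>i = 1..k - 1. ?r i w)" for w
  proof -
    have "(\<Sum>l<k. \<Sum>i = 1..k - 1. b l * (coord (k - 2 + i) w * red (i + j) l w)) = (\<Sum>i = 1..k - 1. ?r i w)"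
      by (subst sum.swap) (simp add: sum_distrib_left mult_ac)
    then show ?thesis using assms
      by (simp add: lam_def q_def right_diff_distrib sum_subtractf sum_distrib_left if_distrib[of "\<lambda>z. _ * z"] cong: if_cong)
  qed
  \<comment> \<open>For i \<ge> k - j the power y^(i+j) has to be reduced, so its coefficients
    vanish at 0 and the product with V_i is of second order.\<close>
  have "(\<lambda>w. \<Sum>i = k - j..k - 1. ?r i w) \<in> mod_square lift_ideal"
    using assms by (intro germ_ideal_sum[OF ideal_lift_sq] mult_in_lift_sq hgerm_sum hgerm_mult) (auto simp: red_0_eq_0)
  from germ_ideal_add[OF ideal_lift_sq lam this]
  have "(\<lambda>w. lam (\<lambda>_ _. 0) q w + (\<Sum>i = k - j..k - 1. ?r i w)) \<in> mod_square lift_ideal" .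
  moreover have "lam (\<lambda>_ _. 0) q w + (\<Sum>i = k - j..k - 1. ?r i w)
     = b j * coord (2 * k - 1) w - (\<Sum>i = 1..k - 1 - j. b (i + j) * coord (k - 2 + i) w)" for w
  proof -
    have "{1..k - 1} = {1..k - 1 - j} \<union> {k - j..k - 1}" using assms by auto
    then have "(\<Sum>i = 1..k - 1. ?r i w) = (\<Sum>i = 1..k - 1 - j. ?r i w) + (\<Sum>i = k - j..k - 1. ?r i w)"
      by (simp only:) (rule sum.union_disjoint, auto)
    moreover have "(\<Sum>i = 1..k - 1 - j. ?r i w) = (\<Sum>i = 1..k - 1 - j. b (i + j) * coord (k - 2 + i) w)"
    proof (intro sum.cong refl)
      fix i assume "i \<in> {1..k - 1 - j}"
      then have "i + j < k" using assms by auto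
      then show "?r i w = b (i + j) * coord (k - 2 + i) w"
        by (simp add: red_less if_distrib[of "\<lambda>z. _ * z"] cong: if_cong)
    qed
    ultimately show ?thesis by (simp add: lam_eq)
  qed
  ultimately show ?thesis by simp
qed

text \<open>For j = k - 1 the sum over the V_i is empty and only b_(k-1) W_2 remains.\<close>

lemma W2_in_mod_square: "coord (2 * k - 1) \<in> mod_square lift_ideal"
proof (rule germ_ideal_cdiv[OF ideal_lift_sq _ b_nz])
  show "(\<lambda>w. b (k - 1) * coord (2 * k - 1) w) \<in> mod_square lift_ideal"
    using W2_V_relation_in_mod_square[of "k - 1"] k by simp
qed

text \<open>With j = k - 1 - i the relation involves W_2 and V_1, ..., V_i only, and V_i occurs with
  the non-zero coefficient b_(k-1).\<close>

lemma V_in_mod_square: "1 \<le> i \<Longrightarrow> i \<le> k - 1 \<Longrightarrow> coord (k - 2 + i) \<in> mod_square lift_ideal"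
proof (induction i rule: less_induct)
  case (less i)
  let ?j = "k - 1 - i"
  let ?S = "\<lambda>w. \<Sum>i' = 1..i - 1. b (i' + ?j) * coord (k - 2 + i') w"
  have "(\<lambda>w. b ?j * coord (2 * k - 1) w - (\<Sum>i' = 1..i. b (i' + ?j) * coord (k - 2 + i') w)) \<in> mod_square lift_ideal"
    using W2_V_relation_in_mod_square[of ?j] less.prems by simp
  moreover have "(\<lambda>w. b ?j * coord (2 * k - 1) w - ?S w) \<in> mod_square lift_ideal"
    using less by (intro germ_ideal_diff[OF ideal_lift_sq] germ_ideal_sum[OF ideal_lift_sq]
        germ_ideal_cmult[OF ideal_lift_sq] W2_in_mod_square) auto
  ultimately have D: "(\<lambda>w. (b ?j * coord (2 * k - 1) w - ?S w)
     - (b ?j * coord (2 * k - 1) w - (\<Sum>i' = 1..i. b (i' + ?j) * coord (k - 2 + i') w))) \<in> mod_square lift_ideal"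
    by (rule germ_ideal_diff[OF ideal_lift_sq, rotated])
  have sum_eq: "(\<Sum>i' = 1..i. b (i' + ?j) * coord (k - 2 + i') w) = ?S w + b (k - 1) * coord (k - 2 + i) w" for w
  proof -
    have "{1..i} = insert i {1..i - 1}" "i \<notin> {1..i - 1}" "i + ?j = k - 1" using less.prems by auto
    then show ?thesis
      using sum.insert[of "{1..i - 1}" i "\<lambda>i'. b (i' + ?j) * coord (k - 2 + i') w"]
      by (simp only: finite_atLeastAtMost simp_thms add.commute)
  qed
  have eq: "(b ?j * coord (2 * k - 1) w - ?S w)
     - (b ?j * coord (2 * k - 1) w - (\<Sum>i' = 1..i. b (i' + ?j) * coord (k - 2 + i') w))
     = b (k - 1) * coord (k - 2 + i) w" for w unfolding sum_eq by algebra
  from D have "(\<lambda>w. b (k - 1) * coord (k - 2 + i) w) \<in> mod_square lift_ideal" unfolding eq .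
  then show ?case by (rule germ_ideal_cdiv[OF ideal_lift_sq _ b_nz])
qed

text \<open>The coefficient of y^l after \<open>Py\<close> times y^j has been reduced to degree
  below k.\<close>

definition Pcoef :: "nat \<Rightarrow> nat \<Rightarrow> complex ^ 'p \<Rightarrow> complex" where
  "Pcoef j l w = of_nat k * red (k - 1 + j) l w + (\<Sum>i = 1..k - 2. of_nat i * coord i w * red (i + j - 1) l w)"

lemma hgerm_Pcoef [simp, intro]: "hgerm (Pcoef j l)"
  unfolding Pcoef_def[abs_def] by (intro hgerm_add hgerm_sum hgerm_mult) auto

lemma Pcoef_sum: "(\<Sum>l<k. Pcoef j l (\<phi> x) * y x ^ l) = Py x * y x ^ j"
proof -
  have "Pcoef j l (\<phi> x) = of_nat k * red (k - 1 + j) l (\<phi> x)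
      + (\<Sum>i = 1..k - 2. of_nat i * coord i x * red (i + j - 1) l (\<phi> x))" for l
    unfolding Pcoef_def by (intro arg_cong2[of _ _ _ _ "(+)"] sum.cong) auto
  then have "(\<Sum>l<k. Pcoef j l (\<phi> x) * y x ^ l) = of_nat k * (\<Sum>l<k. red (k - 1 + j) l (\<phi> x) * y x ^ l)
      + (\<Sum>l<k. \<Sum>i = 1..k - 2. of_nat i * coord i x * (red (i + j - 1) l (\<phi> x) * y x ^ l))"
    by (simp add: distrib_right sum.distrib sum_distrib_left sum_distrib_right mult.assoc)
  also have "(\<Sum>l<k. \<Sum>i = 1..k - 2. of_nat i * coord i x * (red (i + j - 1) l (\<phi> x) * y x ^ l))
      = (\<Sum>i = 1..k - 2. of_nat i * coord i x * y x ^ (i + j - 1))"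
    unfolding y_power_red[of x "_ + j - 1"] sum_distrib_left by (rule sum.swap)
  finally show ?thesis unfolding Py_mult_power y_power_red[of x "k - 1 + j"] .
qed

text \<open>The relation comes from \<open>\<eta> = y\<^sup>j - e\<close>, with \<open>e\<close> chosen to cancel the coefficient of \<open>y\<^sup>k\<^sup>-\<^sup>1\<close>.\<close>

lemma Pcoef_relation_in_mod_square:
  assumes j: "1 \<le> j"
  shows "(\<lambda>w. \<Sum>l<k - 1. a l * Pcoef j l w) \<in> mod_square lift_ideal"
proof -
  \<comment> \<open>The first equation of \<open>lift_relation\<close> stops at degree k - 2, as
    there is no coordinate U_(k-1). The term of degree k - 1 can only be removed by a multiple of
    \<open>Py\<close>, whose top coefficient is k.\<close>
  define e where "e w = Pcoef j (k - 1) w / of_nat k" for w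
  have e: "hgerm e" unfolding e_def[abs_def] using k by (intro hgerm_divide) auto
  \<comment> \<open>As j \<ge> 1, the power y^(k-1+j) is reduced and its coefficients vanish at 0;
    hence the products of \<open>e\<close> with \<open>dP\<close> and \<open>dQ\<close> are of
    second order.\<close>
  have e0: "e 0 = 0" using j k by (simp add: e_def Pcoef_def red_0_eq_0)
  define p where "p l w = e w * dP l w - Pcoef j l w" for l w
  define q where "q l w = e w * dQ l w - (\<Sum>i = 1..k - 1. of_nat i * coord (k - 2 + i) w * red (i + j - 1) l w)" for l w
  define \<eta> where "\<eta> x = y x ^ j - e (\<phi> x)" for x
  have "lift_relation \<eta> p q"
    unfolding lift_relation_def
  proof (intro conjI allI always_eventually)
    show "hgerm \<eta>" unfolding \<eta>_def[abs_def] by (intro hgerm_diff hgerm_power hgerm_compose[OF e holo_\<phi> \<phi>_0]) auto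
    show "hgerm (p l)" for l unfolding p_def[abs_def] by (intro hgerm_diff hgerm_mult e hgerm_dP) auto
    show "hgerm (q l)" for l unfolding q_def[abs_def] by (intro hgerm_diff hgerm_sum hgerm_mult e hgerm_dQ) auto
    fix x
    have "Py x * \<eta> x = Py x * y x ^ j - e (\<phi> x) * (of_nat k * y x ^ (k - 1) + (\<Sum>l<k - 1. dP l (\<phi> x) * y x ^ l))"
      by (simp add: Py_eq \<eta>_def algebra_simps)
    also have "Py x * y x ^ j = (\<Sum>l<k - 1. Pcoef j l (\<phi> x) * y x ^ l) + e (\<phi> x) * of_nat k * y x ^ (k - 1)"
      using k sum.lessThan_Suc[of "\<lambda>l. Pcoef j l (\<phi> x) * y x ^ l" "k - 1"] by (simp add: Pcoef_sum e_def)
    finally show "Py x * \<eta> x + (\<Sum>l<k - 1. p l (\<phi> x) * y x ^ l) = 0"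
      by (simp add: p_def algebra_simps sum_subtractf sum_distrib_left)
    have "Qy x * \<eta> x = Qy x * y x ^ j - e (\<phi> x) * (\<Sum>l<k. dQ l (\<phi> x) * y x ^ l)"
      by (simp add: Qy_eq \<eta>_def algebra_simps)
    also have "Qy x * y x ^ j = (\<Sum>l<k. \<Sum>i = 1..k - 1. of_nat i * coord (k - 2 + i) x * (red (i + j - 1) l (\<phi> x) * y x ^ l))"
      unfolding Qy_mult_power y_power_red[of x "_ + j - 1"] sum_distrib_left by (rule sum.swap)
    also have "\<dots> = (\<Sum>l<k. (\<Sum>i = 1..k - 1. of_nat i * coord (k - 2 + i) (\<phi> x) * red (i + j - 1) l (\<phi> x)) * y x ^ l)"
      unfolding sum_distrib_right using k by (intro sum.cong) auto
    finally show "Qy x * \<eta> x + (\<Sum>l<k. q l (\<phi> x) * y x ^ l) = 0"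
      by (simp add: q_def left_diff_distrib sum_subtractf sum_distrib_left mult.assoc)
  qed
  then have lam: "lam p q \<in> mod_square lift_ideal" by (rule lam_in_mod_square)
  have "(\<lambda>w. \<Sum>l<k - 1. a l * (e w * dP l w)) \<in> mod_square lift_ideal"
    by (intro germ_ideal_sum[OF ideal_lift_sq] germ_ideal_cmult[OF ideal_lift_sq] mult_in_lift_sq e e0 hgerm_dP dP_0)
  \<comment> \<open>Apart from second-order terms, the second equation contributes only multiples of
    the V_i, which are already known to lie in the ideal.\<close>
  moreover have "(\<lambda>w. \<Sum>l<k. b l * q l w) \<in> mod_square lift_ideal"
  proof (intro germ_ideal_sum[OF ideal_lift_sq] germ_ideal_cmult[OF ideal_lift_sq])
    fix l
    have "(\<lambda>w. (of_nat i * red (i + j - 1) l w) * coord (k - 2 + i) w) \<in> mod_square lift_ideal" if "i \<in> {1..k - 1}" for i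
      using that by (intro germ_ideal_mult[OF ideal_lift_sq] V_in_mod_square) auto
    then have "(\<lambda>w. \<Sum>i = 1..k - 1. (of_nat i * red (i + j - 1) l w) * coord (k - 2 + i) w) \<in> mod_square lift_ideal"
      by (rule germ_ideal_sum[OF ideal_lift_sq])
    moreover have "(\<lambda>w. e w * dQ l w) \<in> mod_square lift_ideal"
      by (intro mult_in_lift_sq e e0 hgerm_dQ dQ_0)
    ultimately have "(\<lambda>w. e w * dQ l w - (\<Sum>i = 1..k - 1. (of_nat i * red (i + j - 1) l w) * coord (k - 2 + i) w)) \<in> mod_square lift_ideal"
      by (intro germ_ideal_diff[OF ideal_lift_sq])
    then show "q l \<in> mod_square lift_ideal" by (simp add: q_def[abs_def] mult_ac)
  qed
  ultimately have "(\<lambda>w. (\<Sum>l<k - 1. a l * (e w * dP l w)) - (lam p q w - (\<Sum>l<k. b l * q l w))) \<in> mod_square lift_ideal"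
    using lam by (intro germ_ideal_diff[OF ideal_lift_sq])
  then show ?thesis
    by (simp add: lam_def p_def right_diff_distrib sum_subtractf)
qed

text \<open>The first-order part. The term k y^(k+(j-1)) contributes k times the shifted
  \<open>cP\<close>, and U_i y^(i+j-1) counts only when it needs no reduction and has degree exactly
  l. Both contributions concern the coordinate with the same index i = l - (j - 1).\<close>

lemma Pcoef_mod_J:
  assumes j: "1 \<le> j" and l: "l < k"
  shows "(\<lambda>w. Pcoef j l w - (of_nat k * (if j - 1 \<le> l then cP (l - (j - 1)) w else 0)
    + (\<Sum>i = 1..k - 2. if i + j - 1 = l then of_nat i * coord i w else 0))) \<in> mod_square lift_ideal"
proof -
  have "(\<lambda>w. of_nat k * (red (k + (j - 1)) l w - (if j - 1 \<le> l then cP (l - (j - 1)) w else 0))) \<in> mod_square lift_ideal"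
    by (intro germ_ideal_cmult[OF ideal_lift_sq] red_add_k_mod_square germ_ideal_lift_ideal l)
  moreover have "(\<lambda>w. \<Sum>i = 1..k - 2. of_nat i * coord i w * (red (i + j - 1) l w - (if i + j - 1 = l then 1 else 0))) \<in> mod_square lift_ideal"
  proof (rule germ_ideal_sum[OF ideal_lift_sq])
    fix i assume "i \<in> {1..k - 2}"
    show "(\<lambda>w. of_nat i * coord i w * (red (i + j - 1) l w - (if i + j - 1 = l then 1 else 0))) \<in> mod_square lift_ideal"
    proof (cases "i + j - 1 < k")
      case True
      then have "(\<lambda>w. of_nat i * coord i w * (red (i + j - 1) l w - (if i + j - 1 = l then 1 else 0))) = (\<lambda>_. 0)"
        using l by (auto simp: red_less)
      then show ?thesis using germ_ideal_zero[OF ideal_lift_sq] by simp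
    next
      case False
      then show ?thesis using l by (intro mult_in_lift_sq) (auto simp: red_0_eq_0)
    qed
  qed
  ultimately have "(\<lambda>w. of_nat k * (red (k + (j - 1)) l w - (if j - 1 \<le> l then cP (l - (j - 1)) w else 0))
     + (\<Sum>i = 1..k - 2. of_nat i * coord i w * (red (i + j - 1) l w - (if i + j - 1 = l then 1 else 0)))) \<in> mod_square lift_ideal"
    by (rule germ_ideal_add[OF ideal_lift_sq])
  moreover have "k + (j - 1) = k - 1 + j" using j k by simp
  moreover have "of_nat i * coord i w * (r - (if i + j - 1 = l then 1 else 0))
     = of_nat i * coord i w * r - (if i + j - 1 = l then of_nat i * coord i w else 0)" for i r and w :: "complex ^ 'p"
    by (simp add: algebra_simps)
  ultimately show ?thesis
    by (simp add: Pcoef_def sum_subtractf algebra_simps)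
qed

text \<open>With j = k - 1 - i, degrees l < k - 2 involve only earlier coordinates. Degree k - 2
  gives k \<open>cP i\<close> + i U_i, that is (k - i) \<open>cP i\<close>, with the non-zero factor
  \<open>a (k - 2)\<close>; for i = 0 this is the case of W_1.\<close>

lemma U_W1_in_mod_square: "i \<le> k - 2 \<Longrightarrow> cP i \<in> mod_square lift_ideal"
proof (induction i rule: less_induct)
  case (less i)
  define j where "j = k - 1 - i"
  have j: "1 \<le> j" "i + j = k - 1" using less.prems k by (auto simp: j_def)
  have small: "Pcoef j l \<in> mod_square lift_ideal" if "l < k - 2" for l
  proof -
    let ?A = "\<lambda>w. of_nat k * (if j - 1 \<le> l then cP (l - (j - 1)) w else 0)
      + (\<Sum>i = 1..k - 2. if i + j - 1 = l then of_nat i * coord i w else 0)"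
    have "(\<lambda>w. if j - 1 \<le> l then cP (l - (j - 1)) w else 0) \<in> mod_square lift_ideal"
    proof (cases "j - 1 \<le> l")
      case True
      then have "cP (l - (j - 1)) \<in> mod_square lift_ideal" using that j by (intro less.IH) auto
      with True show ?thesis by simp
    qed (simp add: germ_ideal_zero[OF ideal_lift_sq])
    moreover have "(\<lambda>w. if i' + j - 1 = l then of_nat i' * coord i' w else 0) \<in> mod_square lift_ideal" if "i' \<in> {1..k - 2}" for i'
    proof (cases "i' + j - 1 = l")
      case True
      then have "cP i' \<in> mod_square lift_ideal" using \<open>l < k - 2\<close> j that by (intro less.IH) auto
      from germ_ideal_cmult[OF ideal_lift_sq this, of "- of_nat i'"] True that show ?thesis
        by (simp add: cP_def)
    qed (simp add: germ_ideal_zero[OF ideal_lift_sq])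
    ultimately have "?A \<in> mod_square lift_ideal"
      by (intro germ_ideal_add[OF ideal_lift_sq] germ_ideal_cmult[OF ideal_lift_sq] germ_ideal_sum[OF ideal_lift_sq])
    from germ_ideal_add[OF ideal_lift_sq Pcoef_mod_J[OF j(1), of l] this] that show ?thesis by simp
  qed
  have "(\<lambda>w. (\<Sum>l<k - 1. a l * Pcoef j l w) - (\<Sum>l<k - 2. a l * Pcoef j l w)) \<in> mod_square lift_ideal"
    using small by (intro germ_ideal_diff[OF ideal_lift_sq] Pcoef_relation_in_mod_square j germ_ideal_sum[OF ideal_lift_sq]
        germ_ideal_cmult[OF ideal_lift_sq]) auto
  moreover have "k - 1 = Suc (k - 2)" using k by simp
  ultimately have "(\<lambda>w. a (k - 2) * Pcoef j (k - 2) w) \<in> mod_square lift_ideal" by simp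
  then have "Pcoef j (k - 2) \<in> mod_square lift_ideal" by (rule germ_ideal_cdiv[OF ideal_lift_sq _ a_nz])
  from germ_ideal_diff[OF ideal_lift_sq this Pcoef_mod_J[OF j(1), of "k - 2"]] k
  have "(\<lambda>w. of_nat k * (if j - 1 \<le> k - 2 then cP (k - 2 - (j - 1)) w else 0)
    + (\<Sum>i = 1..k - 2. if i + j - 1 = k - 2 then of_nat i * coord i w else 0)) \<in> mod_square lift_ideal" by simp
  moreover have "j - 1 \<le> k - 2" "k - 2 - (j - 1) = i" using j by auto
  moreover have "(\<Sum>i' = 1..k - 2. if i' + j - 1 = k - 2 then of_nat i' * coord i' w else 0) = - of_nat i * cP i w" for w :: "complex ^ 'p"
  proof (cases "i = 0")
    case True
    then show ?thesis using j by (auto intro!: sum.neutral)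
  next
    case False
    have "i' + j - 1 = k - 2 \<longleftrightarrow> i' = i" if "i' \<in> {1..k - 2}" for i' using j that by auto
    then have "(\<Sum>i' = 1..k - 2. if i' + j - 1 = k - 2 then of_nat i' * coord i' w else 0)
      = (\<Sum>i' = 1..k - 2. if i' = i then of_nat i' * coord i' w else 0)" by (intro sum.cong) auto
    then show ?thesis using False less.prems by (simp add: cP_def)
  qed
  ultimately have "(\<lambda>w. (of_nat k - of_nat i) * cP i w) \<in> mod_square lift_ideal" by (simp add: algebra_simps)
  moreover have "(of_nat k - of_nat i :: complex) \<noteq> 0" using less.prems k by simp
  ultimately show ?case by (rule germ_ideal_cdiv[OF ideal_lift_sq])
qed

lemma maximal_ideal_subset_lift_ideal:
  assumes "hgerm f" "f 0 = 0" shows "f \<in> lift_ideal"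
proof (rule germ_ideal_Nakayama[OF germ_ideal_lift_ideal _ assms])
  fix j :: 'p
  obtain i where i: "1 \<le> i" "i \<le> CARD('p)" "\<And>x :: complex ^ 'p. coord i x = x $ j"
    using ex_coord_eq_nth[of j] by blast
  consider "i \<le> k - 2" | "k - 2 < i" "i \<le> 2 * k - 3" | "i = 2 * k - 2" | "i = 2 * k - 1"
    using i card_target k by linarith
  then have "coord i \<in> mod_square lift_ideal"
  proof cases
    case 1
    have "(\<lambda>w. -1 * cP i w) = coord i" by (rule ext) (use 1 i(1) in \<open>simp add: cP_def\<close>)
    then show ?thesis using germ_ideal_cmult[OF ideal_lift_sq U_W1_in_mod_square[OF 1], of "-1"] by simp
  next
    case 2
    then have "k - 2 + (i - (k - 2)) = i" "1 \<le> i - (k - 2)" "i - (k - 2) \<le> k - 1" by auto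
    then show ?thesis using V_in_mod_square[of "i - (k - 2)"] by (simp only:)
  next
    case 3
    then show ?thesis using U_W1_in_mod_square[of 0] by (simp add: cP_def[abs_def])
  next
    case 4
    then show ?thesis using W2_in_mod_square by simp
  qed
  moreover have "coord i = (\<lambda>x :: complex ^ 'p. x $ j)" using i(3) by (rule ext)
  ultimately show "(\<lambda>x :: complex ^ 'p. x $ j) \<in> mod_square lift_ideal" by simp
qed

end

subsection \<open>Codimension one and A-equivalence\<close>

lemma frechet_derivative_vdiff_linear:
  assumes "vdiff s x"
  shows "frechet_derivative s (at x) (u + v) = frechet_derivative s (at x) u + frechet_derivative s (at x) v"
    and "frechet_derivative s (at x) (u - v) = frechet_derivative s (at x) u - frechet_derivative s (at x) v"
    and "frechet_derivative s (at x) (c *s v) = c *s frechet_derivative s (at x) v"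
proof -
  interpret bounded_linear "frechet_derivative s (at x)"
    by (rule has_derivative_bounded_linear[OF vdiff_has_derivative(1)[OF assms]])
  show "frechet_derivative s (at x) (u + v) = frechet_derivative s (at x) u + frechet_derivative s (at x) v"
    by (rule add)
  show "frechet_derivative s (at x) (u - v) = frechet_derivative s (at x) u - frechet_derivative s (at x) v"
    by (rule diff)
  show "frechet_derivative s (at x) (c *s v) = c *s frechet_derivative s (at x) v"
    by (rule vdiff_has_derivative(2)[OF assms])
qed

lemma Ae_tangent_iff:
  "s \<in> Ae_tangent f \<longleftrightarrow> holo_germ s \<and> (\<exists>\<eta> \<xi>. holo_germ \<eta> \<and> holo_germ \<xi> \<and>
     (\<forall>\<^sub>F x in nhds 0. s x = frechet_derivative f (at x) (\<eta> x) + \<xi> (f x)))"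
  by (simp add: Ae_tangent_def theta_def tf_def wf_def)

lemma Ae_tangent_cong:
  assumes "s \<in> Ae_tangent f" "\<forall>\<^sub>F x in nhds 0. s x = t x"
  shows "t \<in> Ae_tangent f"
proof -
  obtain \<eta> \<xi> where *: "holo_germ s" "holo_germ \<eta>" "holo_germ \<xi>"
    "\<forall>\<^sub>F x in nhds 0. s x = frechet_derivative f (at x) (\<eta> x) + \<xi> (f x)"
    using assms(1) by (auto simp: Ae_tangent_iff)
  have "\<forall>\<^sub>F x in nhds 0. t x = frechet_derivative f (at x) (\<eta> x) + \<xi> (f x)"
    using assms(2) *(4) by eventually_elim simp
  with * show ?thesis using holo_germ_cong_ev[OF assms(2)] by (auto simp: Ae_tangent_iff)
qed

lemma Ae_tangent_lincomb:
  assumes f: "holo_germ f" and "s \<in> Ae_tangent f" "t \<in> Ae_tangent f"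
  shows "(\<lambda>x. a *s s x + b *s t x) \<in> Ae_tangent f"
proof -
  obtain \<eta> \<xi> where s: "holo_germ s" "holo_germ \<eta>" "holo_germ \<xi>"
    "\<forall>\<^sub>F x in nhds 0. s x = frechet_derivative f (at x) (\<eta> x) + \<xi> (f x)"
    using assms(2) by (auto simp: Ae_tangent_iff)
  obtain \<eta>' \<xi>' where t: "holo_germ t" "holo_germ \<eta>'" "holo_germ \<xi>'"
    "\<forall>\<^sub>F x in nhds 0. t x = frechet_derivative f (at x) (\<eta>' x) + \<xi>' (f x)"
    using assms(3) by (auto simp: Ae_tangent_iff)
  have eq: "\<forall>\<^sub>F x in nhds 0. a *s s x + b *s t x
    = frechet_derivative f (at x) (a *s \<eta> x + b *s \<eta>' x) + (a *s \<xi> (f x) + b *s \<xi>' (f x))"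
    using f[unfolded holo_germ_iff_vdiff] s(4) t(4)
    by eventually_elim (simp add: frechet_derivative_vdiff_linear vec.scale_right_distrib)
  have lin: "holo_germ (\<lambda>x. a *s r x + b *s r' x)" if "holo_germ r" "holo_germ r'" for r r' :: "complex ^ 'x \<Rightarrow> complex ^ 'y"
    using that by (intro holo_germ_add holo_germ_scale) auto
  show ?thesis unfolding Ae_tangent_iff
    by (intro conjI exI[of _ "\<lambda>x. a *s \<eta> x + b *s \<eta>' x"] exI[of _ "\<lambda>w. a *s \<xi> w + b *s \<xi>' w"] lin s t eq)
qed

lemma Ae_tangent_scale:
  "holo_germ f \<Longrightarrow> s \<in> Ae_tangent f \<Longrightarrow> (\<lambda>x. a *s s x) \<in> Ae_tangent f"
  using Ae_tangent_lincomb[of f s s a 0] by simp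

text \<open>A quotient spanned by one non-zero class, stated without bases so that it can be carried
  along an equivalence.\<close>

definition cod_one :: "(complex ^ 'n \<Rightarrow> complex ^ 'p) \<Rightarrow> bool" where
  "cod_one f \<longleftrightarrow> (\<exists>s\<^sub>0. holo_germ s\<^sub>0 \<and> s\<^sub>0 \<notin> Ae_tangent f \<and>
     (\<forall>s. holo_germ s \<longrightarrow> (\<exists>c. (\<lambda>x. s x - c *s s\<^sub>0 x) \<in> Ae_tangent f)))"

text \<open>\<open>quotient_dim\<close> measures an arbitrarily chosen basis, so exhibiting a basis
  with one element is not enough: every basis must be shown to have one element.\<close>

lemma Ae_cod_eq_1:
  assumes f: "holo_germ f" and "cod_one f"
  shows "Ae_cod f = 1"
proof -
  obtain s0 where s0: "holo_germ s0" "s0 \<notin> Ae_tangent f"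
    and span: "\<And>s. holo_germ s \<Longrightarrow> \<exists>c. (\<lambda>x. s x - c *s s0 x) \<in> Ae_tangent f"
    using assms(2) unfolding cod_one_def by blast
  have zero: "(\<lambda>x. 0) \<in> Ae_tangent f"
  proof -
    obtain c where "(\<lambda>x. s0 x - c *s s0 x) \<in> Ae_tangent f" using span[OF s0(1)] by blast
    from Ae_tangent_scale[OF f this, of 0] show ?thesis by simp
  qed
  have c0: "c = 0" if "(\<lambda>x. c *s s0 x) \<in> Ae_tangent f" for c
    using Ae_tangent_scale[OF f that, of "inverse c"] s0(2) by (cases "c = 0") auto
  have basis: "quotient_basis (theta f) (Ae_tangent f) {s0}"
    unfolding quotient_basis_def
  proof (intro conjI allI impI ballI)
    fix c b assume "(\<lambda>x. \<Sum>b\<in>{s0}. c b *s b x) \<in> Ae_tangent f" "b \<in> {s0}"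
    then show "c b = 0" using c0[of "c s0"] by simp
  next
    fix s assume "s \<in> theta f"
    then obtain c where "(\<lambda>x. s x - c *s s0 x) \<in> Ae_tangent f" using span by (auto simp: theta_def)
    then show "\<exists>c. (\<lambda>x. s x - (\<Sum>b\<in>{s0}. c b *s b x)) \<in> Ae_tangent f"
      by (intro exI[of _ "\<lambda>_. c"]) simp
  qed (use s0 in \<open>auto simp: theta_def\<close>)
  have "card B = 1" if B: "quotient_basis (theta f) (Ae_tangent f) B" for B
  proof -
    have fin: "finite B" and Bth: "\<And>b. b \<in> B \<Longrightarrow> holo_germ b"
      and indep: "\<And>c. (\<lambda>x. \<Sum>b\<in>B. c b *s b x) \<in> Ae_tangent f \<Longrightarrow> \<forall>b\<in>B. c b = 0"
      and spanB: "\<And>s. holo_germ s \<Longrightarrow> \<exists>c. (\<lambda>x. s x - (\<Sum>b\<in>B. c b *s b x)) \<in> Ae_tangent f"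
      using B unfolding quotient_basis_def theta_def by auto
    have "B \<noteq> {}" using spanB[OF s0(1)] s0(2) by auto
    then obtain b1 where b1: "b1 \<in> B" by blast
    have "b2 = b1" if b2: "b2 \<in> B" for b2
    proof (rule ccontr)
      assume ne: "b2 \<noteq> b1"
      obtain c1 c2 where c1: "(\<lambda>x. b1 x - c1 *s s0 x) \<in> Ae_tangent f"
        and c2: "(\<lambda>x. b2 x - c2 *s s0 x) \<in> Ae_tangent f"
        using span[OF Bth[OF b1]] span[OF Bth[OF b2]] by blast
      \<comment> \<open>Modulo the tangent space \<open>b1\<close> and \<open>b2\<close> are c1 and
        c2 times \<open>s0\<close>, so c2 b1 - c1 b2 lies in it. Independence gives c2 = 0; then
        \<open>b2\<close> itself is tangent, which contradicts independence.\<close>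
      define c where "c b = (if b = b1 then c2 else if b = b2 then - c1 else 0)" for b
      have sum_eq: "(\<Sum>b\<in>B. e b *s b x) = e b1 *s b1 x + e b2 *s b2 x"
        if "\<And>b. b \<noteq> b1 \<Longrightarrow> b \<noteq> b2 \<Longrightarrow> e b = 0" for e x
      proof -
        have "(\<Sum>b\<in>B. e b *s b x) = (\<Sum>b\<in>{b1, b2}. e b *s b x)"
          using fin b1 b2 that by (intro sum.mono_neutral_right) auto
        then show ?thesis using ne by simp
      qed
      have "(\<lambda>x. c2 *s (b1 x - c1 *s s0 x) + (- c1) *s (b2 x - c2 *s s0 x)) \<in> Ae_tangent f"
        by (rule Ae_tangent_lincomb[OF f c1 c2])
      also have "(\<lambda>x. c2 *s (b1 x - c1 *s s0 x) + (- c1) *s (b2 x - c2 *s s0 x)) = (\<lambda>x. \<Sum>b\<in>B. c b *s b x)"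
        using ne by (subst sum_eq) (auto simp: c_def vec_eq_iff algebra_simps)
      finally have "c b1 = 0" using indep[of c] b1 by blast
      then have "c2 = 0" by (simp add: c_def)
      with c2 have "b2 \<in> Ae_tangent f" by simp
      moreover have "(\<lambda>x. \<Sum>b\<in>B. (if b = b2 then 1 else 0) *s b x) = b2"
        using ne by (subst sum_eq) auto
      ultimately have "\<forall>b\<in>B. (if b = b2 then 1 else 0 :: complex) = 0"
        by (intro indep) simp
      then show False using b2 by auto
    qed
    then have "B = {b1}" using b1 by blast
    then show ?thesis by simp
  qed
  moreover have ex: "\<exists>B. quotient_basis (theta f) (Ae_tangent f) B" using basis by (rule exI)
  ultimately have card: "card (SOME B. quotient_basis (theta f) (Ae_tangent f) B) = 1"
    using someI_ex[OF ex] by blast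
  show ?thesis
    unfolding Ae_cod_def quotient_dim_def by (simp only: ex if_True card one_enat_def)
qed

section \<open>Invariance under A-equivalence\<close>

lemma eventually_frechet_derivative_inverse:
  fixes R R' :: "complex ^ 'n \<Rightarrow> complex ^ 'n"
  assumes "holo_germ R" "R 0 = 0" "holo_germ R'" "\<forall>\<^sub>F z in nhds 0. R' (R z) = z"
  shows "\<forall>\<^sub>F z in nhds 0. \<forall>v. frechet_derivative R' (at (R z)) (frechet_derivative R (at z) v) = v"
  using eventually_frechet_derivative_compose[OF assms(1-3)]
    eventually_frechet_derivative_cong[OF assms(4)]
proof eventually_elim
  case (elim z)
  show ?case
  proof
    fix v
    have "frechet_derivative R' (at (R z)) (frechet_derivative R (at z) v) = frechet_derivative (\<lambda>x. R' (R x)) (at z) v"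
      by (rule elim(1)[rule_format, symmetric])
    also have "\<dots> = v"
      unfolding elim(2) frechet_derivative_at[OF has_derivative_ident, symmetric] ..
    finally show "frechet_derivative R' (at (R z)) (frechet_derivative R (at z) v) = v" .
  qed
qed

text \<open>The inverse germs are parameters, which makes the relation symmetric and every result
  available in both directions.\<close>

locale A_equivalence =
  fixes f\<^sub>0 f :: "complex ^ 'm \<Rightarrow> complex ^ 'n" and L L' :: "complex ^ 'n \<Rightarrow> complex ^ 'n"
    and R R' :: "complex ^ 'm \<Rightarrow> complex ^ 'm"
  assumes f0: "holo_germ f\<^sub>0" "f\<^sub>0 0 = 0" and f: "holo_germ f" "f 0 = 0"
    and L: "holo_germ L" "L 0 = 0" "holo_germ L'" "L' 0 = 0"
    and R: "holo_germ R" "R 0 = 0" "holo_germ R'" "R' 0 = 0"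
    and L_inv: "\<forall>\<^sub>F w in nhds 0. L' (L w) = w" "\<forall>\<^sub>F w in nhds 0. L (L' w) = w"
    and R_inv: "\<forall>\<^sub>F z in nhds 0. R' (R z) = z" "\<forall>\<^sub>F z in nhds 0. R (R' z) = z"
    and f_eq: "\<forall>\<^sub>F z in nhds 0. f z = L (f\<^sub>0 (R z))"
begin

lemma swap: "A_equivalence f f\<^sub>0 L' L R' R"
proof
  have "\<forall>\<^sub>F z in nhds 0. f (R' z) = L (f\<^sub>0 (R (R' z)))" by (rule holo_germ_eventually[OF R(3,4) f_eq])
  moreover have "\<forall>\<^sub>F z in nhds 0. L' (L (f\<^sub>0 z)) = f\<^sub>0 z" by (rule holo_germ_eventually[OF f0 L_inv(1)])
  ultimately show "\<forall>\<^sub>F z in nhds 0. f\<^sub>0 z = L' (f (R' z))" using R_inv(2) by eventually_elim simp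
qed (use f0 f L R L_inv R_inv in auto)

text \<open>The isomorphism from fields along \<open>f\<^sub>0\<close> to fields along
  \<open>f\<close>: precompose with \<open>R\<close> and apply the differential of
  \<open>L\<close>.\<close>

definition transport :: "(complex ^ 'm \<Rightarrow> complex ^ 'n) \<Rightarrow> complex ^ 'm \<Rightarrow> complex ^ 'n" where
  "transport s z = frechet_derivative L (at (f\<^sub>0 (R z))) (s (R z))"

lemma holo_f0_R: "holo_germ (\<lambda>z. f\<^sub>0 (R z))"
  by (rule holo_germ_compose[OF f0(1) R(1,2)])

lemma f0_R_0: "f\<^sub>0 (R 0) = 0"
  by (simp add: f0 R)

lemma holo_transport: "holo_germ s \<Longrightarrow> holo_germ (transport s)"
  unfolding transport_def[abs_def]
  by (intro holo_germ_frechet_along[OF L(1) holo_f0_R f0_R_0] holo_germ_compose[OF _ R(1,2)])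

lemma vdiff_L: "\<forall>\<^sub>F z in nhds 0. vdiff L (f\<^sub>0 (R z))"
  by (rule holo_germ_eventually[OF holo_f0_R f0_R_0]) (use L(1) in \<open>simp add: holo_germ_iff_vdiff\<close>)

text \<open>By the chain rule a field \<eta> on the source is pulled back by \<open>R\<close>, and a
  field \<xi> on the target is pushed forward by \<open>L\<close>.\<close>

lemma transport_Ae_tangent:
  assumes "s \<in> Ae_tangent f\<^sub>0" shows "transport s \<in> Ae_tangent f"
proof -
  obtain \<eta> \<xi> where s: "holo_germ s" "holo_germ \<eta>" "holo_germ \<xi>"
    and s_eq: "\<forall>\<^sub>F x in nhds 0. s x = frechet_derivative f\<^sub>0 (at x) (\<eta> x) + \<xi> (f\<^sub>0 x)"
    using assms by (auto simp: Ae_tangent_iff)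
  define \<eta>' where "\<eta>' z = frechet_derivative R' (at (R z)) (\<eta> (R z))" for z
  define \<xi>' where "\<xi>' w = frechet_derivative L (at (L' w)) (\<xi> (L' w))" for w
  have "holo_germ \<eta>'" unfolding \<eta>'_def[abs_def]
    by (intro holo_germ_frechet_along[OF R(3) R(1,2)] holo_germ_compose[OF s(2) R(1,2)])
  moreover have "holo_germ \<xi>'" unfolding \<xi>'_def[abs_def]
    by (intro holo_germ_frechet_along[OF L(1) L(3,4)] holo_germ_compose[OF s(3) L(3,4)])
  moreover have "\<forall>\<^sub>F z in nhds 0. transport s z = frechet_derivative f (at z) (\<eta>' z) + \<xi>' (f z)"
    using vdiff_L holo_germ_eventually[OF R(1,2) s_eq] f_eq eventually_frechet_derivative_cong[OF f_eq]
      eventually_frechet_derivative_compose[OF holo_f0_R f0_R_0 L(1)]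
      eventually_frechet_derivative_compose[OF R(1,2) f0(1)]
      holo_germ_eventually[OF holo_f0_R f0_R_0 L_inv(1)]
      holo_germ_eventually[OF R(1,2) eventually_frechet_derivative_inverse[OF R(3,4) R(1) R_inv(2)]] R_inv(1)
  proof eventually_elim
    case (elim z)
    have "frechet_derivative f (at z) (\<eta>' z)
      = frechet_derivative L (at (f\<^sub>0 (R z))) (frechet_derivative f\<^sub>0 (at (R z)) (frechet_derivative R (at z) (\<eta>' z)))"
      using elim(4,5,6) by simp
    also have "frechet_derivative R (at z) (\<eta>' z) = \<eta> (R z)"
      using elim(8,9) unfolding \<eta>'_def by metis
    finally have 1: "frechet_derivative f (at z) (\<eta>' z)
      = frechet_derivative L (at (f\<^sub>0 (R z))) (frechet_derivative f\<^sub>0 (at (R z)) (\<eta> (R z)))" .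
    have "\<xi>' (f z) = frechet_derivative L (at (f\<^sub>0 (R z))) (\<xi> (f\<^sub>0 (R z)))"
      unfolding \<xi>'_def using elim(3,7) by simp
    with 1 show ?case using elim(1,2) by (simp add: transport_def frechet_derivative_vdiff_linear)
  qed
  ultimately show ?thesis using holo_transport[OF s(1)] by (auto simp: Ae_tangent_iff)
qed

interpretation inv: A_equivalence f f\<^sub>0 L' L R' R
  by (rule swap)

lemma inv_transport_transport: "\<forall>\<^sub>F z in nhds 0. inv.transport (transport s) z = s z"
  using R_inv(2) holo_germ_eventually[OF R(3,4) f_eq]
    holo_germ_eventually[OF f0 eventually_frechet_derivative_inverse[OF L(1,2,3) L_inv(1)]]
proof eventually_elim
  case (elim z)
  then show ?case by (simp add: inv.transport_def transport_def)
qed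

lemma cod_one_transport:
  assumes "cod_one f\<^sub>0" shows "cod_one f"
proof -
  obtain s0 where s0: "holo_germ s0" "s0 \<notin> Ae_tangent f\<^sub>0"
    and span: "\<And>s. holo_germ s \<Longrightarrow> \<exists>c. (\<lambda>x. s x - c *s s0 x) \<in> Ae_tangent f\<^sub>0"
    using assms unfolding cod_one_def by blast
  have "transport s0 \<notin> Ae_tangent f"
    using inv.transport_Ae_tangent[of "transport s0"] Ae_tangent_cong[OF _ inv_transport_transport] s0(2) by blast
  moreover have "\<exists>c. (\<lambda>x. s x - c *s transport s0 x) \<in> Ae_tangent f" if s: "holo_germ s" for s
  proof -
    obtain c where "(\<lambda>x. inv.transport s x - c *s s0 x) \<in> Ae_tangent f\<^sub>0"
      using span[OF inv.holo_transport[OF s]] by blast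
    from transport_Ae_tangent[OF this]
    have *: "transport (\<lambda>x. inv.transport s x - c *s s0 x) \<in> Ae_tangent f" .
    have "\<forall>\<^sub>F z in nhds 0. transport (inv.transport s) z = s z"
      using A_equivalence.inv_transport_transport[OF swap] .
    with vdiff_L have "\<forall>\<^sub>F z in nhds 0. transport (\<lambda>x. inv.transport s x - c *s s0 x) z = s z - c *s transport s0 z"
      by eventually_elim (simp add: transport_def frechet_derivative_vdiff_linear)
    from Ae_tangent_cong[OF * this] show ?thesis by blast
  qed
  ultimately show ?thesis unfolding cod_one_def using holo_transport[OF s0(1)] by blast
qed

end

subsection \<open>Infinitesimal stability\<close>

lemma sum_lessThan_split_0:
  fixes n :: nat
  shows "0 < n \<Longrightarrow> (\<Sum>l<n. f l) = f 0 + (\<Sum>l = 1..n - 1. f l :: complex)"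
proof -
  assume "0 < n"
  then have "{..<n} = insert 0 {1..n - 1}" by auto
  then show ?thesis by simp
qed

context linear_section
begin

lemma h_add: "h (w + w') = h w + h w'" and h_scale: "h (c *s w) = c * h w"
  by (simp_all add: h_def distrib_left sum.distrib sum_distrib_left algebra_simps)

lemma h_0 [simp]: "h 0 = 0" and h_minus: "h (- w) = - h w" and h_diff: "h (w - w') = h w - h w'"
  using h_scale[of 0 w] h_scale[of "-1" w] h_add[of w "- w'"] h_scale[of "-1" w'] by auto

lemma hgerm_h [simp, intro]: "hgerm h"
  unfolding h_def[abs_def] by (intro hgerm_add hgerm_sum hgerm_mult) auto

text \<open>The field \<open>\<xi>\<close> is determined only up to liftable fields, whose values under \<open>h\<close> fill the maximal ideal;
  this is why \<open>h \<circ> \<xi>\<close> can be made constant.\<close>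

lemma infinitesimal_stability:
  assumes \<sigma>: "holo_germ (\<sigma> :: complex ^ 'n \<Rightarrow> complex ^ 'p)"
  obtains \<eta> \<xi> c where "holo_germ \<eta>" "holo_germ \<xi>"
    "\<forall>\<^sub>F x in nhds 0. \<sigma> x = frechet_derivative \<phi> (at x) (\<eta> x) + \<xi> (\<phi> x)"
    "\<forall>\<^sub>F w in nhds 0. h (\<xi> w) = c"
proof -
  \<comment> \<open>\<open>A\<close> and \<open>B\<close> are what remains of the last two
    components once the fields in the directions u_i and v_i have absorbed the first 2k - 3.\<close>
  define A where "A x = coord (2 * k - 2) (\<sigma> x) - (\<Sum>i = 1..k - 2. coord i (\<sigma> x) * y x ^ i)" for x
  define B where "B x = coord (2 * k - 1) (\<sigma> x) - (\<Sum>i = 1..k - 1. coord (k - 2 + i) (\<sigma> x) * y x ^ i)" for x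
  have hA: "hgerm A" and hB: "hgerm B"
    unfolding A_def[abs_def] B_def[abs_def]
    by (intro hgerm_diff hgerm_sum hgerm_mult hgerm_power hgerm_coord_comp \<sigma>; simp)+
  obtain r where r: "\<And>j. hgerm (r j)" "\<forall>\<^sub>F x in nhds 0. A x = (\<Sum>j<k. r j (\<phi> x) * y x ^ j)"
    using weierstrass_division[OF hA] by blast
  obtain s where s: "\<And>j. hgerm (s j)" "\<forall>\<^sub>F x in nhds 0. B x = (\<Sum>j<k. s j (\<phi> x) * y x ^ j)"
    using weierstrass_division[OF hB] by blast
  \<comment> \<open>Subtracting this multiple of \<open>Py\<close> removes the term of degree k - 1
    from \<open>A\<close>, which the available p-coefficients cannot produce.\<close>
  define e where "e w = r (k - 1) w / of_nat k" for w
  have e: "hgerm e" unfolding e_def[abs_def] using k r by (intro hgerm_divide) auto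
  define p0 where "p0 l w = r l w - e w * dP l w" for l w
  define q0 where "q0 l w = s l w - e w * dQ l w" for l w
  have p0: "hgerm (p0 l)" and q0: "hgerm (q0 l)" for l
    unfolding p0_def[abs_def] q0_def[abs_def] by (intro hgerm_diff hgerm_mult r s e hgerm_dP hgerm_dQ)+
  have A_eq: "(\<Sum>j<k. r j (\<phi> x) * y x ^ j) = Py x * e (\<phi> x) + (\<Sum>l<k - 1. p0 l (\<phi> x) * y x ^ l)" for x
  proof -
    have "(\<Sum>j<k. r j (\<phi> x) * y x ^ j) = (\<Sum>j<k - 1. r j (\<phi> x) * y x ^ j) + r (k - 1) (\<phi> x) * y x ^ (k - 1)"
      using k sum.lessThan_Suc[of "\<lambda>j. r j (\<phi> x) * y x ^ j" "k - 1"] by simp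
    also have "r (k - 1) (\<phi> x) = e (\<phi> x) * of_nat k" using k by (simp add: e_def)
    finally show ?thesis unfolding Py_eq
      by (simp add: p0_def algebra_simps sum_subtractf sum_distrib_left)
  qed
  have B_eq: "(\<Sum>j<k. s j (\<phi> x) * y x ^ j) = Qy x * e (\<phi> x) + (\<Sum>l<k. q0 l (\<phi> x) * y x ^ l)" for x
    unfolding Qy_eq by (simp add: q0_def algebra_simps sum_subtractf sum_distrib_left)
  \<comment> \<open>The non-constant part of h on the preliminary field. It vanishes at 0, hence is
    the h-value of a liftable field, which is subtracted next.\<close>
  define f where "f w = lam p0 q0 w - lam p0 q0 0" for w
  have "hgerm f" unfolding f_def[abs_def] lam_def[abs_def]
    by (intro hgerm_diff hgerm_add hgerm_sum hgerm_mult p0 q0) auto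
  then have "f \<in> lift_ideal" by (rule maximal_ideal_subset_lift_ideal) (simp add: f_def)
  then obtain \<eta>' p' q' where lift: "lift_relation \<eta>' p' q'" and f_eq: "\<forall>\<^sub>F w in nhds 0. f w = lam p' q' w"
    unfolding lift_ideal_def by blast
  note lift = lift_relationD[OF lift]
  define p where "p l w = p0 l w - p' l w" for l w
  define q where "q l w = q0 l w - q' l w" for l w
  define \<eta>y where "\<eta>y x = e (\<phi> x) - \<eta>' x" for x
  have p: "hgerm (p l)" and q: "hgerm (q l)" for l
    unfolding p_def[abs_def] q_def[abs_def] by (intro hgerm_diff p0 q0 lift)+
  have \<eta>y: "hgerm \<eta>y" unfolding \<eta>y_def[abs_def] by (intro hgerm_diff hgerm_compose[OF e holo_\<phi> \<phi>_0] lift(1))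
  have A_sol: "\<forall>\<^sub>F x in nhds 0. A x = Py x * \<eta>y x + (\<Sum>l<k - 1. p l (\<phi> x) * y x ^ l)"
    using r(2) lift(4)
  proof eventually_elim
    case (elim x)
    have "Py x * \<eta>y x + (\<Sum>l<k - 1. p l (\<phi> x) * y x ^ l)
      = (Py x * e (\<phi> x) + (\<Sum>l<k - 1. p0 l (\<phi> x) * y x ^ l)) - (Py x * \<eta>' x + (\<Sum>l<k - 1. p' l (\<phi> x) * y x ^ l))"
      by (simp add: \<eta>y_def p_def algebra_simps sum_subtractf)
    then show ?case using elim A_eq by simp
  qed
  have B_sol: "\<forall>\<^sub>F x in nhds 0. B x = Qy x * \<eta>y x + (\<Sum>l<k. q l (\<phi> x) * y x ^ l)"
    using s(2) lift(4)
  proof eventually_elim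
    case (elim x)
    have "Qy x * \<eta>y x + (\<Sum>l<k. q l (\<phi> x) * y x ^ l)
      = (Qy x * e (\<phi> x) + (\<Sum>l<k. q0 l (\<phi> x) * y x ^ l)) - (Qy x * \<eta>' x + (\<Sum>l<k. q' l (\<phi> x) * y x ^ l))"
      by (simp add: \<eta>y_def q_def algebra_simps sum_subtractf)
    then show ?case using elim B_eq by simp
  qed
  define \<xi> :: "complex ^ 'p \<Rightarrow> complex ^ 'p" where "\<xi> w = vec_of_coords (\<lambda>i. if i \<le> k - 2 then - p i w
      else if i \<le> 2 * k - 3 then - q (i - (k - 2)) w else if i = 2 * k - 2 then p 0 w else q 0 w)" for w
  define \<eta> :: "complex ^ 'n \<Rightarrow> complex ^ 'n" where "\<eta> x = vec_of_coords (\<lambda>i. if i \<le> 2 * k - 3 then coord i (\<sigma> x) - coord i (\<xi> (\<phi> x)) else \<eta>y x)" for x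
  have \<xi>: "holo_germ \<xi>"
    unfolding \<xi>_def[abs_def] by (intro holo_germ_vec_of_coords hgerm_if hgerm_minus p q)
  have \<eta>: "holo_germ \<eta>"
    unfolding \<eta>_def[abs_def]
    by (intro holo_germ_vec_of_coords hgerm_if hgerm_diff hgerm_coord_comp \<sigma> \<eta>y holo_germ_compose[OF \<xi> holo_\<phi> \<phi>_0])
  have \<xi>_U: "coord i (\<xi> w) = - p i w" if "1 \<le> i" "i \<le> k - 2" for i w
    using that card_target unfolding \<xi>_def by (subst coord_vec_of_coords) auto
  have \<xi>_V: "coord (k - 2 + i) (\<xi> w) = - q i w" if "1 \<le> i" "i \<le> k - 1" for i w
  proof -
    have *: "1 \<le> k - 2 + i" "k - 2 + i \<le> CARD('p)" "\<not> k - 2 + i \<le> k - 2" "k - 2 + i \<le> 2 * k - 3"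
      using that card_target k by auto
    show ?thesis unfolding \<xi>_def coord_vec_of_coords[OF *(1,2)]
      by (simp only: *(3,4) if_True if_False add_diff_cancel_left')
  qed
  have \<xi>_W1: "coord (2 * k - 2) (\<xi> w) = p 0 w" for w
    using k card_target unfolding \<xi>_def by (subst coord_vec_of_coords) auto
  have \<xi>_W2: "coord (2 * k - 1) (\<xi> w) = q 0 w" for w
    using k card_target unfolding \<xi>_def by (subst coord_vec_of_coords) auto
  have \<eta>_par: "coord i (\<eta> x) = coord i (\<sigma> x) - coord i (\<xi> (\<phi> x))" if "1 \<le> i" "i \<le> 2 * k - 3" for i x
    using that card_source unfolding \<eta>_def by (subst coord_vec_of_coords) auto
  have \<eta>_y: "y (\<eta> x) = \<eta>y x" for x
    using k card_source unfolding \<eta>_def by (subst coord_vec_of_coords) auto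
  have "\<forall>\<^sub>F x in nhds 0. \<sigma> x = frechet_derivative \<phi> (at x) (\<eta> x) + \<xi> (\<phi> x)"
    using A_sol B_sol
  proof eventually_elim
    case (elim x)
    show ?case
    proof (rule coord_eqI)
      fix i assume i: "1 \<le> i" "i \<le> CARD('p)"
      then show "coord i (\<sigma> x) = coord i (frechet_derivative \<phi> (at x) (\<eta> x) + \<xi> (\<phi> x))"
      proof (rule target_cases)
        assume "i \<le> 2 * k - 3"
        then show ?thesis using i by (simp add: \<eta>_par)
      next
        assume i: "i = 2 * k - 2"
        have "(\<Sum>l<k - 1. p l (\<phi> x) * y x ^ l) = p 0 (\<phi> x) + (\<Sum>l = 1..k - 2. p l (\<phi> x) * y x ^ l)"
          using sum_lessThan_split_0[of "k - 1"] k by (simp add: numeral_2_eq_2)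
        moreover have "(\<Sum>l = 1..k - 2. coord l (\<eta> x) * y x ^ l)
          = (\<Sum>l = 1..k - 2. coord l (\<sigma> x) * y x ^ l) + (\<Sum>l = 1..k - 2. p l (\<phi> x) * y x ^ l)"
          unfolding sum.distrib[symmetric] by (intro sum.cong) (auto simp: \<eta>_par \<xi>_U algebra_simps)
        ultimately show ?thesis using elim(1) unfolding i coord_add coord_d\<phi>_W1 \<xi>_W1 \<eta>_y A_def
          by (simp only: algebra_simps)
      next
        assume i: "i = 2 * k - 1"
        have "(\<Sum>l<k. q l (\<phi> x) * y x ^ l) = q 0 (\<phi> x) + (\<Sum>l = 1..k - 1. q l (\<phi> x) * y x ^ l)"
          using sum_lessThan_split_0[of k] k by simp
        moreover have "(\<Sum>l = 1..k - 1. coord (k - 2 + l) (\<eta> x) * y x ^ l)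
          = (\<Sum>l = 1..k - 1. coord (k - 2 + l) (\<sigma> x) * y x ^ l) + (\<Sum>l = 1..k - 1. q l (\<phi> x) * y x ^ l)"
          unfolding sum.distrib[symmetric]
        proof (intro sum.cong refl)
          fix l assume l: "l \<in> {1..k - 1}"
          then have "1 \<le> k - 2 + l" "k - 2 + l \<le> 2 * k - 3" using k by auto
          from \<eta>_par[OF this] \<xi>_V[of l] l
          have "coord (k - 2 + l) (\<eta> x) = coord (k - 2 + l) (\<sigma> x) + q l (\<phi> x)"
            by (simp only: atLeastAtMost_iff diff_minus_eq_add)
          then show "coord (k - 2 + l) (\<eta> x) * y x ^ l = coord (k - 2 + l) (\<sigma> x) * y x ^ l + q l (\<phi> x) * y x ^ l"
            by (simp only: distrib_right)
        qed
        ultimately show ?thesis using elim(2) unfolding i coord_add coord_d\<phi>_W2 \<xi>_W2 \<eta>_y B_def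
          by (simp only: algebra_simps)
      qed
    qed
  qed
  moreover have "\<forall>\<^sub>F w in nhds 0. h (\<xi> w) = lam p0 q0 0"
    using f_eq
  proof eventually_elim
    case (elim w)
    have "(\<Sum>i = 1..k - 2. \<alpha> i * coord i (\<xi> w)) = (\<Sum>i = 1..k - 2. a i * p i w)"
      by (intro sum.cong) (auto simp: \<xi>_U a_def)
    moreover have "(\<Sum>i = 1..k - 1. \<beta> i * coord (k - 2 + i) (\<xi> w)) = (\<Sum>i = 1..k - 1. b i * q i w)"
      by (intro sum.cong) (auto simp: \<xi>_V b_def)
    ultimately have "h (\<xi> w) = (a 0 * p 0 w + (\<Sum>i = 1..k - 2. a i * p i w)) + (b 0 * q 0 w + (\<Sum>i = 1..k - 1. b i * q i w))"
      unfolding h_def \<xi>_W1 \<xi>_W2 by (simp add: a_def b_def)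
    also have "\<dots> = lam p q w"
      unfolding lam_def using sum_lessThan_split_0[of k "\<lambda>l. b l * q l w"] sum_lessThan_split_0[of "k - 1" "\<lambda>l. a l * p l w"] k
      by (simp add: numeral_2_eq_2)
    also have "\<dots> = lam p0 q0 w - lam p' q' w"
      by (simp add: lam_def p_def q_def algebra_simps sum_subtractf)
    finally show ?case using elim by (simp add: f_def algebra_simps)
  qed
  ultimately show ?thesis using that[OF \<eta> \<xi>] by blast
qed

end

section \<open>Dropping and inserting a coordinate\<close>

definition drop_coord :: "nat \<Rightarrow> complex ^ 'a \<Rightarrow> complex ^ 'b" where
  "drop_coord d x = vec_of_coords (\<lambda>i. if i < d then coord i x else coord (i + 1) x)"

text \<open>Used with d = 2k - 3, the number of v_(k-1) in the source and of V_(k-1) in the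
  target.\<close>

definition insert_zero :: "nat \<Rightarrow> complex ^ 'b \<Rightarrow> complex ^ 'a" where
  "insert_zero d z = vec_of_coords (\<lambda>i. if i < d then coord i z else if i = d then 0 else coord (i - 1) z)"

definition unit_vec :: "nat \<Rightarrow> complex ^ 'a" where
  "unit_vec d = vec_of_coords (\<lambda>i. if i = d then 1 else 0)"

lemma coord_unit_vec: "1 \<le> i \<Longrightarrow> i \<le> CARD('a) \<Longrightarrow> coord i (unit_vec d :: complex ^ 'a) = (if i = d then 1 else 0)"
  unfolding unit_vec_def by (rule coord_vec_of_coords)

lemma coord_drop_coord:
  "1 \<le> i \<Longrightarrow> i \<le> CARD('b) \<Longrightarrow> coord i (drop_coord d x :: complex ^ 'b) = (if i < d then coord i x else coord (i + 1) x)"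
  unfolding drop_coord_def by (rule coord_vec_of_coords)

lemma coord_insert_zero:
  "1 \<le> i \<Longrightarrow> i \<le> CARD('a) \<Longrightarrow> coord i (insert_zero d z :: complex ^ 'a)
    = (if i < d then coord i z else if i = d then 0 else coord (i - 1) z)"
  unfolding insert_zero_def by (rule coord_vec_of_coords)

lemma drop_coord_linear:
  "drop_coord d (x + x') = drop_coord d x + drop_coord d x'"
  "drop_coord d (x - x') = drop_coord d x - drop_coord d x'"
  "drop_coord d (c *s x) = c *s drop_coord d x"
  by (rule coord_eqI, simp add: coord_drop_coord)+

lemma insert_zero_linear:
  "insert_zero d (x + x') = insert_zero d x + insert_zero d x'"
  "insert_zero d (c *s x) = c *s insert_zero d x"
  by (rule coord_eqI, simp add: coord_insert_zero)+

lemma vdiff_drop_coord [simp]: "vdiff (drop_coord d) x"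
  unfolding drop_coord_def[abs_def] by (intro vdiff_vec_of_coords cdiff_if) auto

lemma vdiff_insert_zero [simp]: "vdiff (insert_zero d) x"
  unfolding insert_zero_def[abs_def] by (intro vdiff_vec_of_coords cdiff_if) auto

lemma drop_coord_insert_zero:
  assumes "CARD('a) = CARD('b) + 1"
  shows "drop_coord d (insert_zero d z :: complex ^ 'a) = (z :: complex ^ 'b)"
  using assms by (intro coord_eqI) (auto simp: coord_drop_coord coord_insert_zero)

lemma drop_coord_unit_vec:
  assumes "CARD('a) = CARD('b) + 1"
  shows "drop_coord d (unit_vec d :: complex ^ 'a) = (0 :: complex ^ 'b)"
  using assms by (intro coord_eqI) (auto simp: coord_drop_coord coord_unit_vec)

lemma insert_zero_drop_coord:
  assumes "CARD('a) = CARD('b) + 1" "1 \<le> d" "d \<le> CARD('a)"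
  shows "x = insert_zero d (drop_coord d x :: complex ^ 'b) + coord d x *s (unit_vec d :: complex ^ 'a)"
proof (rule coord_eqI)
  fix i assume "1 \<le> i" "i \<le> CARD('a)"
  note i = this
  have drop: "coord j (drop_coord d x :: complex ^ 'b) = (if j < d then coord j x else coord (j + 1) x)"
    if "1 \<le> j" "j \<le> CARD('b)" for j
    using that by (rule coord_drop_coord)
  show "coord i x = coord i (insert_zero d (drop_coord d x :: complex ^ 'b) + coord d x *s (unit_vec d :: complex ^ 'a))"
    unfolding coord_add coord_scale coord_insert_zero[OF i] coord_unit_vec[OF i]
    using i assms drop[of i] drop[of "i - 1"] by auto
qed

lemma drop_coord_0 [simp]: "drop_coord d 0 = 0" and insert_zero_0 [simp]: "insert_zero d 0 = 0"
  by (rule coord_eqI, simp add: coord_drop_coord coord_insert_zero)+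

subsection \<open>Coordinates on the section\<close>

lemma clinear_has_derivative:
  fixes F :: "complex ^ 'a \<Rightarrow> complex ^ 'b"
  assumes "\<And>u v. F (u + v) = F u + F v" "\<And>c v. F (c *s v) = c *s F v"
  shows "(F has_derivative F) (at x)"
proof -
  have *: "r *\<^sub>R v = of_real r *s v" for r and v :: "complex ^ 'c"
    by (simp add: vec_eq_iff) (simp add: scaleR_conv_of_real)
  have "linear F" by (rule linearI) (simp_all add: assms *)
  then show ?thesis by (intro bounded_linear_imp_has_derivative) (simp add: linear_conv_bounded_linear)
qed

lemma frechet_derivative_drop_coord: "frechet_derivative (drop_coord d) (at x) v = drop_coord d v"
  using frechet_derivative_at[OF clinear_has_derivative[of "drop_coord d"]] by (metis drop_coord_linear(1,3))

locale section_pullback = linear_section k source target \<alpha> \<beta> \<gamma>\<^sub>1 \<gamma>\<^sub>2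
  for k :: nat and source :: "'n::finite itself" and target :: "'p::finite itself" and \<alpha> \<beta> \<gamma>\<^sub>1 \<gamma>\<^sub>2 +
  fixes pb :: "'m::finite itself"
  assumes card_pb: "CARD('m) = 2 * k - 3"
begin

abbreviation eV :: "complex ^ 'p" where "eV \<equiv> unit_vec (2 * k - 3)"
abbreviation ev :: "complex ^ 'n" where "ev \<equiv> unit_vec (2 * k - 3)"
abbreviation eW2 :: "complex ^ 'p" where "eW2 \<equiv> unit_vec (2 * k - Suc 0)"
abbreviation prp :: "complex ^ 'p \<Rightarrow> complex ^ 'n" where "prp \<equiv> drop_coord (2 * k - 3)"
abbreviation prn :: "complex ^ 'n \<Rightarrow> complex ^ 'm" where "prn \<equiv> drop_coord (2 * k - 3)"
abbreviation insp :: "complex ^ 'n \<Rightarrow> complex ^ 'p" where "insp \<equiv> insert_zero (2 * k - 3)"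
abbreviation insn :: "complex ^ 'm \<Rightarrow> complex ^ 'n" where "insn \<equiv> insert_zero (2 * k - 3)"

lemma cards: "CARD('p) = CARD('n) + 1" "CARD('n) = CARD('m) + 1"
  using k card_source card_target card_pb by auto

lemma prp_insp: "prp (insp w) = w" and prn_insn: "prn (insn z) = z"
  by (simp_all add: drop_coord_insert_zero cards)

lemma prp_eV: "prp eV = 0" and prn_ev: "prn ev = 0"
  by (simp_all add: drop_coord_unit_vec cards)

lemma decompose_p: "w = insp (prp w) + coord (2 * k - 3) w *s eV"
  using k card_target by (intro insert_zero_drop_coord) (auto simp: cards(1))

lemma decompose_n: "x = insn (prn x) + coord (2 * k - 3) x *s ev"
  using k card_source by (intro insert_zero_drop_coord) (auto simp: cards(2))

lemma coord_eV: "1 \<le> i \<Longrightarrow> i \<le> 2 * k - 1 \<Longrightarrow> coord i eV = (if i = 2 * k - 3 then 1 else 0)"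
  and coord_ev: "1 \<le> i \<Longrightarrow> i \<le> 2 * k - 2 \<Longrightarrow> coord i ev = (if i = 2 * k - 3 then 1 else 0)"
  and coord_eW2: "1 \<le> i \<Longrightarrow> i \<le> 2 * k - 1 \<Longrightarrow> coord i eW2 = (if i = 2 * k - 1 then 1 else 0)"
  by (simp_all add: coord_unit_vec card_source card_target)

lemma index_neq [simp]:
  "2 * k - 2 \<noteq> 2 * k - 3" "2 * k - 3 \<noteq> 2 * k - 2" "2 * k - Suc 0 \<noteq> 2 * k - 3"
  "2 * k - 3 \<noteq> 2 * k - Suc 0" "2 * k - 2 \<noteq> 2 * k - Suc 0" "2 * k - Suc 0 \<noteq> 2 * k - 2"
  using k by auto

lemma sum_V_delta: "(\<Sum>i = 1..k - 1. c i * (if k - 2 + i = 2 * k - 3 then 1 else 0)) = (c (k - 1) :: complex)"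
proof -
  have "(\<Sum>i = 1..k - 1. c i * (if k - 2 + i = 2 * k - 3 then 1 else 0)) = (\<Sum>i\<in>{k - 1}. c i)"
    using k by (intro sum.mono_neutral_cong_right) auto
  then show ?thesis by simp
qed

lemma h_eV: "h eV = \<beta> (k - 1)"
proof -
  have "(\<Sum>i = 1..k - 1. \<beta> i * coord (k - 2 + i) eV) = (\<Sum>i = 1..k - 1. \<beta> i * (if k - 2 + i = 2 * k - 3 then 1 else 0))"
    using k by (intro sum.cong) (auto simp: coord_eV)
  moreover have "(\<Sum>i = 1..k - 2. \<alpha> i * coord i eV) = 0"
    using k by (intro sum.neutral) (auto simp: coord_eV split: if_splits)
  ultimately show ?thesis using k unfolding h_def sum_V_delta by (simp add: coord_eV)
qed

lemma h_eW2: "h eW2 = \<gamma>\<^sub>2"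
proof -
  have "(\<Sum>i = 1..k - 1. \<beta> i * coord (k - 2 + i) eW2) = 0" "(\<Sum>i = 1..k - 2. \<alpha> i * coord i eW2) = 0"
    using k by (auto intro!: sum.neutral simp: coord_eW2 split: if_splits)
  then show ?thesis using k unfolding h_def by (simp add: coord_eW2)
qed

text \<open>The hyperplane h = 0 as a graph over the coordinates other than V_(k-1). Since
  \<open>h eV\<close> is \<beta>_(k-1), the multiple of \<open>eV\<close> cancels h.\<close>

definition \<kappa> :: "complex ^ 'n \<Rightarrow> complex ^ 'p" where
  "\<kappa> w = insp w - (h (insp w) / \<beta> (k - 1)) *s eV"

lemma h_\<kappa> [simp]: "h (\<kappa> w) = 0"
  using \<beta> by (simp add: \<kappa>_def h_diff h_scale h_eV)

lemma prp_\<kappa> [simp]: "prp (\<kappa> w) = w"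
  by (simp add: \<kappa>_def drop_coord_linear prp_eV prp_insp)

lemma \<kappa>_prp: "h w = 0 \<Longrightarrow> \<kappa> (prp w) = w"
proof -
  assume "h w = 0"
  then have "h (insp (prp w)) + coord (2 * k - 3) w * \<beta> (k - 1) = 0"
    using decompose_p[of w] h_add h_scale h_eV by metis
  then have "h (insp (prp w)) / \<beta> (k - 1) = - coord (2 * k - 3) w"
    using \<beta> by (simp add: field_simps add_eq_0_iff)
  then show ?thesis using decompose_p[of w] by (simp add: \<kappa>_def)
qed

lemma \<kappa>_add: "\<kappa> (w + w') = \<kappa> w + \<kappa> w'" and \<kappa>_scale: "\<kappa> (c *s w) = c *s \<kappa> w"
  by (simp_all add: \<kappa>_def insert_zero_linear h_add h_scale vec_eq_iff add_divide_distrib algebra_simps)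

lemma \<kappa>_0 [simp]: "\<kappa> 0 = 0"
  using \<kappa>_scale[of 0 0] by simp

lemma deriv_\<kappa>: "(\<kappa> has_derivative \<kappa>) (at w)"
  by (rule clinear_has_derivative) (simp_all add: \<kappa>_add \<kappa>_scale)

lemma vdiff_\<kappa> [simp]: "vdiff \<kappa> w"
  by (rule vdiffI[OF deriv_\<kappa>]) (simp add: \<kappa>_scale)

lemma holo_\<kappa> [simp]: "holo_germ \<kappa>"
  by (simp add: holo_germ_iff_vdiff)

lemma frechet_\<kappa>: "frechet_derivative \<kappa> (at w) v = \<kappa> v"
  using frechet_derivative_at[OF deriv_\<kappa>] by simp

text \<open>The derivative of \<open>h \<circ> \<phi>\<close> in the direction v_(k-1). It depends
  on y alone, so \<open>h \<circ> \<phi>\<close> is affine along \<open>ev\<close> with this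
  slope.\<close>

definition bb :: "complex ^ 'n \<Rightarrow> complex" where "bb x = \<beta> (k - 1) + \<gamma>\<^sub>2 * y x ^ (k - 1)"

lemma d\<phi>_ev: "frechet_derivative \<phi> (at x) ev = eV + y x ^ (k - 1) *s eW2"
proof (rule coord_eqI)
  fix i assume i: "1 \<le> i" "i \<le> CARD('p)"
  then show "coord i (frechet_derivative \<phi> (at x) ev) = coord i (eV + y x ^ (k - 1) *s eW2)"
  proof (rule target_cases)
    assume "i \<le> 2 * k - 3"
    then show ?thesis using i k by (simp add: coord_eV coord_ev coord_eW2)
  next
    assume i: "i = 2 * k - 2"
    have "(\<Sum>i = 1..k - 2. coord i ev * y x ^ i) = 0"
      using k by (intro sum.neutral) (auto simp: coord_ev split: if_splits)
    then show ?thesis unfolding i coord_d\<phi>_W1 using k by (simp add: coord_eV coord_ev coord_eW2)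
  next
    assume i: "i = 2 * k - 1"
    have "(\<Sum>i = 1..k - 1. coord (k - 2 + i) ev * y x ^ i)
      = (\<Sum>i = 1..k - 1. y x ^ i * (if k - 2 + i = 2 * k - 3 then 1 else 0))"
      using k by (intro sum.cong) (auto simp: coord_ev split: if_splits)
    then show ?thesis unfolding i coord_d\<phi>_W2 sum_V_delta using k by (simp add: coord_eV coord_ev coord_eW2)
  qed
qed

lemma y_add_ev [simp]: "y (x + t *s ev) = y x"
  using k by (simp add: coord_ev)

lemma \<phi>_add_ev: "\<phi> (x + t *s ev) = \<phi> x + t *s (eV + y x ^ (k - 1) *s eW2)"
proof (rule coord_eqI)
  fix i assume i: "1 \<le> i" "i \<le> CARD('p)"
  then show "coord i (\<phi> (x + t *s ev)) = coord i (\<phi> x + t *s (eV + y x ^ (k - 1) *s eW2))"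
  proof (rule target_cases)
    assume "i \<le> 2 * k - 3"
    then show ?thesis using i k by (simp add: coord_eV coord_ev coord_eW2)
  next
    assume i: "i = 2 * k - 2"
    have "(\<Sum>i = 1..k - 2. coord i (x + t *s ev) * y x ^ i) = (\<Sum>i = 1..k - 2. coord i x * y x ^ i)"
      using k by (intro sum.cong) (auto simp: coord_ev split: if_splits)
    then show ?thesis unfolding i coord_add[where x = "\<phi> x"] coord_\<phi>_W1 y_add_ev
      using k by (simp add: coord_eV coord_eW2)
  next
    assume i: "i = 2 * k - 1"
    have "(\<Sum>i = 1..k - 1. coord (k - 2 + i) (x + t *s ev) * y x ^ i)
      = (\<Sum>i = 1..k - 1. coord (k - 2 + i) x * y x ^ i + t * y x ^ i * (if k - 2 + i = 2 * k - 3 then 1 else 0))"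
    proof (intro sum.cong refl)
      fix i assume "i \<in> {1..k - 1}"
      then have e: "coord (k - 2 + i) ev = (if k - 2 + i = 2 * k - 3 then 1 else 0)"
        using k by (intro coord_ev) auto
      show "coord (k - 2 + i) (x + t *s ev) * y x ^ i
        = coord (k - 2 + i) x * y x ^ i + t * y x ^ i * (if k - 2 + i = 2 * k - 3 then 1 else 0)"
        unfolding coord_add coord_scale e by algebra
    qed
    then show ?thesis unfolding i coord_add[where x = "\<phi> x"] coord_\<phi>_W2 y_add_ev sum.distrib sum_V_delta
      using k by (simp add: coord_eV coord_eW2)
  qed
qed

lemma h_\<phi>_add_ev: "h (\<phi> (x + t *s ev)) = h (\<phi> x) + t * bb x"
  unfolding \<phi>_add_ev h_add h_scale h_eV h_eW2 bb_def by algebra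

lemma h_d\<phi>_ev: "h (frechet_derivative \<phi> (at x) ev) = bb x"
  by (simp add: d\<phi>_ev h_add h_scale h_eV h_eW2 bb_def)

lemma bb_add_ev [simp]: "bb (x + t *s ev) = bb x"
  unfolding bb_def y_add_ev ..

lemma hgerm_bb [simp]: "hgerm bb"
  unfolding bb_def[abs_def] by (intro hgerm_add hgerm_mult hgerm_power) auto

lemma bb_0: "bb 0 \<noteq> 0"
  using k \<beta> by (simp add: bb_def zero_power)

lemma bb_ev_nz: "\<forall>\<^sub>F x in nhds 0. bb x \<noteq> 0"
  using eventually_isCont_nhds[OF hgerm_isCont[OF hgerm_bb], of "\<lambda>z. z \<noteq> 0"] bb_0 t1_space_nhds by blast

text \<open>The preimage of h = 0 under \<phi> as a graph over the coordinates other than v_(k-1):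
  an affine equation in v_(k-1) is solved by dividing by its slope, which is non-zero near
  0.\<close>

definition \<mu> :: "complex ^ 'm \<Rightarrow> complex ^ 'n" where
  "\<mu> z = insn z + (- (h (\<phi> (insn z)) / bb (insn z))) *s ev"

lemma holo_insn: "holo_germ insn" and holo_prn: "holo_germ prn" and holo_prp: "holo_germ prp"
  by (simp_all add: holo_germ_iff_vdiff)

lemma holo_\<mu> [simp]: "holo_germ \<mu>"
proof -
  have "hgerm (\<lambda>z. h (\<phi> (insn z)))"
    by (rule hgerm_compose[OF hgerm_compose[OF hgerm_h holo_\<phi> \<phi>_0] holo_insn insert_zero_0])
  moreover have "hgerm (\<lambda>z. bb (insn z))" by (rule hgerm_compose[OF hgerm_bb holo_insn insert_zero_0])
  ultimately show ?thesis unfolding \<mu>_def[abs_def]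
    by (intro holo_germ_add holo_insn holo_germ_scale hgerm_minus hgerm_divide) (auto simp: bb_0)
qed

lemma \<mu>_0 [simp]: "\<mu> 0 = 0"
  by (simp add: \<mu>_def)

lemma prn_\<mu> [simp]: "prn (\<mu> z) = z"
  by (simp add: \<mu>_def drop_coord_linear prn_ev prn_insn)

lemma bb_\<mu>: "bb (\<mu> z) = bb (insn z)"
  unfolding \<mu>_def by (rule bb_add_ev)

lemma h_\<phi>_\<mu>: "bb (\<mu> z) \<noteq> 0 \<Longrightarrow> h (\<phi> (\<mu> z)) = 0"
  unfolding bb_\<mu> unfolding \<mu>_def h_\<phi>_add_ev by simp

lemma \<mu>_prn: "h (\<phi> x) = 0 \<Longrightarrow> bb x \<noteq> 0 \<Longrightarrow> \<mu> (prn x) = x"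
proof -
  assume x: "h (\<phi> x) = 0" "bb x \<noteq> 0"
  let ?x = "insn (prn x)" and ?c = "coord (2 * k - 3) x"
  have "bb ?x = bb x" using decompose_n[of x] bb_add_ev by metis
  moreover have "h (\<phi> x) = h (\<phi> ?x) + ?c * bb ?x" using decompose_n[of x] h_\<phi>_add_ev by metis
  ultimately have "- (h (\<phi> ?x) / bb ?x) = ?c"
    using x by (simp add: field_simps add_eq_0_iff)
  then show ?thesis unfolding \<mu>_def using decompose_n[of x] by simp
qed

lemma bb_\<mu>_nz: "\<forall>\<^sub>F z in nhds 0. bb (\<mu> z) \<noteq> 0"
  by (rule holo_germ_eventually[OF holo_\<mu> \<mu>_0 bb_ev_nz])

text \<open>The normal form of the pullback: \<phi> restricted to the preimage of the hyperplane and
  read in the graph coordinates of both.\<close>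

definition f0 :: "complex ^ 'm \<Rightarrow> complex ^ 'n" where "f0 z = prp (\<phi> (\<mu> z))"

lemma holo_\<phi>_\<mu>: "holo_germ (\<lambda>z. \<phi> (\<mu> z))"
  by (rule holo_germ_compose[OF holo_\<phi> holo_\<mu> \<mu>_0])

lemma holo_f0 [simp]: "holo_germ f0"
  unfolding f0_def[abs_def] by (rule holo_germ_compose[OF holo_prp holo_\<phi>_\<mu>]) simp

lemma f0_0 [simp]: "f0 0 = 0"
  by (simp add: f0_def)

lemma \<kappa>_f0: "\<forall>\<^sub>F z in nhds 0. \<phi> (\<mu> z) = \<kappa> (f0 z)"
  using bb_\<mu>_nz by eventually_elim (simp add: f0_def \<kappa>_prp h_\<phi>_\<mu>)

lemma d\<phi>_d\<mu>: "\<forall>\<^sub>F z in nhds 0. \<forall>v. frechet_derivative \<phi> (at (\<mu> z)) (frechet_derivative \<mu> (at z) v)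
    = \<kappa> (frechet_derivative f0 (at z) v)"
  using eventually_frechet_derivative_compose[OF holo_\<mu> \<mu>_0 holo_\<phi>]
    eventually_frechet_derivative_compose[OF holo_f0 f0_0 holo_\<kappa>]
    eventually_frechet_derivative_cong[OF \<kappa>_f0]
proof eventually_elim
  case (elim z)
  then show ?case by (simp add: frechet_\<kappa>)
qed

lemma prn_d\<mu>: "\<forall>\<^sub>F z in nhds 0. \<forall>v. prn (frechet_derivative \<mu> (at z) v) = v"
  using eventually_frechet_derivative_compose[OF holo_\<mu> \<mu>_0 holo_prn]
proof eventually_elim
  case (elim z)
  have "frechet_derivative (\<lambda>z. z) (at z) v = v" for v :: "complex ^ 'm"
    using frechet_derivative_at[OF has_derivative_ident, of z] by metis
  then show ?case using elim by (simp add: frechet_derivative_drop_coord)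
qed

text \<open>The difference of the two vectors has no component other than along \<open>ev\<close>,
  where the differential of \<open>h \<circ> \<phi>\<close> is multiplication by the non-zero
  \<open>bb\<close>. This is how fields on the source of \<phi> are restricted to the
  section.\<close>

lemma tangent_\<mu>:
  "\<forall>\<^sub>F z in nhds 0. \<forall>\<tau>. h (frechet_derivative \<phi> (at (\<mu> z)) \<tau>) = 0 \<longrightarrow>
     frechet_derivative \<mu> (at z) (prn \<tau>) = \<tau>"
  using d\<phi>_d\<mu> prn_d\<mu> bb_\<mu>_nz
proof eventually_elim
  case (elim z)
  show ?case
  proof (intro allI impI)
    fix \<tau> assume \<tau>: "h (frechet_derivative \<phi> (at (\<mu> z)) \<tau>) = 0"
    define \<delta> where "\<delta> = \<tau> - frechet_derivative \<mu> (at z) (prn \<tau>)"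
    have "prn \<delta> = 0" using elim(2) by (simp add: \<delta>_def drop_coord_linear)
    then have \<delta>: "\<delta> = coord (2 * k - 3) \<delta> *s ev" using decompose_n[of \<delta>] by simp
    have "h (frechet_derivative \<phi> (at (\<mu> z)) \<delta>) = 0"
      unfolding \<delta>_def using \<tau> elim(1) by (simp add: frechet_derivative_vdiff_linear h_diff)
    moreover have "h (frechet_derivative \<phi> (at (\<mu> z)) \<delta>) = coord (2 * k - 3) \<delta> * bb (\<mu> z)"
      by (subst \<delta>) (simp add: frechet_derivative_vdiff_linear h_scale h_d\<phi>_ev)
    ultimately have "coord (2 * k - 3) \<delta> = 0" using elim(3) by simp
    then have "\<delta> = 0" using \<delta> by simp
    then show "frechet_derivative \<mu> (at z) (prn \<tau>) = \<tau>" by (simp add: \<delta>_def)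
  qed
qed

end

subsection \<open>The codimension of the normal form\<close>

lemma isCont_imp_bigo_1:
  fixes q :: "complex \<Rightarrow> complex"
  assumes "isCont q 0" shows "q \<in> O[at 0](\<lambda>_. 1)"
  using assms by (intro bigoI_tendsto[of q "\<lambda>_. 1" "q 0"]) (auto simp: isCont_def)

lemma power_bigo_power:
  assumes "m \<le> n" shows "(\<lambda>t :: complex. t ^ n) \<in> O[at 0](\<lambda>t. t ^ m)"
proof -
  have "(\<lambda>t :: complex. t ^ m * t ^ (n - m)) \<in> O[at 0](\<lambda>t. t ^ m * 1)"
    by (intro landau_o.big.mult isCont_imp_bigo_1 landau_o.big_refl) simp
  then show ?thesis using assms by (simp add: power_add[symmetric])
qed

text \<open>Letting t tend to 0 kills the constant term; then divide by t and repeat.\<close>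

lemma polynomial_bigo_imp_0:
  fixes c :: "nat \<Rightarrow> complex"
  assumes "(\<lambda>t. \<Sum>i<n. c i * t ^ i) \<in> O[at 0](\<lambda>t. t ^ n)" "i < n"
  shows "c i = 0"
  using assms
proof (induction n arbitrary: c i)
  case 0
  then show ?case by (simp only: not_less_zero)
next
  case (Suc n)
  have f_eq: "(\<Sum>i<Suc n. c i * t ^ i) = c 0 + t * (\<Sum>i<n. c (Suc i) * t ^ i)" for t
    unfolding sum.lessThan_Suc_shift by (simp add: sum_distrib_left mult.left_commute)
  obtain C where C: "\<forall>\<^sub>F t in at 0. norm (\<Sum>i<Suc n. c i * t ^ i) \<le> C * norm (t ^ Suc n)"
    using Suc.prems(1) by (elim landau_o.bigE)
  have "((\<lambda>t :: complex. C * norm (t ^ Suc n)) \<longlongrightarrow> C * norm ((0 :: complex) ^ Suc n)) (at 0)"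
    by (intro tendsto_intros)
  then have "((\<lambda>t. \<Sum>i<Suc n. c i * t ^ i) \<longlongrightarrow> 0) (at 0)"
    by (intro Lim_null_comparison[OF C]) simp
  moreover have "((\<lambda>t. c 0 + t * (\<Sum>i<n. c (Suc i) * t ^ i)) \<longlongrightarrow> c 0 + 0 * (\<Sum>i<n. c (Suc i) * 0 ^ i)) (at 0)"
    by (intro tendsto_intros)
  ultimately have c0: "c 0 = 0"
    using tendsto_unique[of "at (0 :: complex)" "\<lambda>t. \<Sum>i<Suc n. c i * t ^ i" 0 "c 0"] unfolding f_eq by simp
  have "(\<lambda>t. \<Sum>i<n. c (Suc i) * t ^ i) \<in> O[at 0](\<lambda>t. t ^ n)"
  proof (rule landau_o.bigI)
    show "max C 1 > 0" by simp
    show "\<forall>\<^sub>F t in at 0. norm (\<Sum>i<n. c (Suc i) * t ^ i) \<le> max C 1 * norm (t ^ n)"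
      using C eventually_neq_at_within[of 0 0 UNIV]
    proof eventually_elim
      case (elim t)
      have "norm t * norm (\<Sum>i<n. c (Suc i) * t ^ i) \<le> norm t * (C * norm (t ^ n))"
        using elim(1) unfolding f_eq c0 by (simp add: norm_mult mult_ac)
      then have "norm (\<Sum>i<n. c (Suc i) * t ^ i) \<le> C * norm (t ^ n)" using elim(2) by simp
      also have "\<dots> \<le> max C 1 * norm (t ^ n)" by (intro mult_right_mono) auto
      finally show ?case .
    qed
  qed
  from Suc.IH[OF this] have "c (Suc j) = 0" if "j < n" for j using that by blast
  with c0 Suc.prems(2) show ?case by (cases i) auto
qed

lemma isCont_line: "isCont (\<lambda>t :: complex. t *s (w :: complex ^ 'a)) 0"
proof -
  have "((\<lambda>t. t *s w) has_derivative (\<lambda>h. h *s w)) (at 0)"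
    unfolding has_derivative_vec_iff by (auto intro!: derivative_eq_intros)
  then show ?thesis by (rule has_derivative_continuous)
qed

lemma hgerm_line_bigo: "hgerm a \<Longrightarrow> (\<lambda>t. a (t *s w)) \<in> O[at 0](\<lambda>_. 1)"
  by (intro isCont_imp_bigo_1 isCont_o2[OF isCont_line]) (simp add: hgerm_isCont)

lemma eventually_line: "\<forall>\<^sub>F z in nhds 0. P z \<Longrightarrow> \<forall>\<^sub>F t :: complex in at 0. P (t *s w)"
  using eventually_isCont_nhds[OF isCont_line, of P w] by (simp add: eventually_at_filter eventually_mono)

lemma holo_germ_drop_coord: "holo_germ s \<Longrightarrow> holo_germ (\<lambda>x. drop_coord d (s x))"
  unfolding drop_coord_def by (intro holo_germ_vec_of_coords hgerm_if hgerm_coord_comp)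

lemma holo_germ_insert_zero: "holo_germ s \<Longrightarrow> holo_germ (\<lambda>x. insert_zero d (s x))"
  unfolding insert_zero_def by (intro holo_germ_vec_of_coords hgerm_if hgerm_coord_comp hgerm_const)

section \<open>Fields along the normal form\<close>

context section_pullback
begin

lemma holo_germ_\<kappa>: "holo_germ s \<Longrightarrow> holo_germ (\<lambda>x. \<kappa> (s x))"
  unfolding \<kappa>_def h_def using \<beta>
  by (intro holo_germ_diff holo_germ_insert_zero holo_germ_scale hgerm_divide hgerm_add hgerm_sum hgerm_mult
      hgerm_coord_comp holo_germ_const hgerm_const)

definition \<epsilon> :: "complex ^ 'p" where "\<epsilon> = (1 / \<beta> (k - 1)) *s eV"

lemma h_\<epsilon> [simp]: "h \<epsilon> = 1"
  using \<beta> by (simp add: \<epsilon>_def h_scale h_eV)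

text \<open>\<epsilon> on the target and \<open>E\<close> on the source are both normalised to have
  h-value 1, the latter after applying the differential of \<phi>.\<close>

definition E :: "complex ^ 'n \<Rightarrow> complex ^ 'n" where "E x = (1 / bb x) *s ev"

lemma holo_E: "holo_germ E"
  unfolding E_def[abs_def] by (intro holo_germ_scale hgerm_divide) (auto simp: bb_0)

lemma h_d\<phi>_E: "bb x \<noteq> 0 \<Longrightarrow> h (frechet_derivative \<phi> (at x) (E x)) = 1"
  by (simp add: E_def frechet_derivative_vdiff_linear h_scale h_d\<phi>_ev)

text \<open>The h-values of \<epsilon> and of the image of \<open>E\<close> cancel, so their
  difference restricts to a field along \<open>f0\<close>. It represents the class for which the
  constant \<open>h \<circ> \<xi>\<close> equals 1.\<close>

definition s0 :: "complex ^ 'm \<Rightarrow> complex ^ 'n" where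
  "s0 z = prp (\<epsilon> - frechet_derivative \<phi> (at (\<mu> z)) (E (\<mu> z)))"

lemma holo_s0: "holo_germ s0"
proof -
  have "holo_germ (\<lambda>z. \<epsilon> - frechet_derivative \<phi> (at (\<mu> z)) (E (\<mu> z)))"
    by (intro holo_germ_diff holo_germ_const holo_germ_frechet_along[OF holo_\<phi> holo_\<mu> \<mu>_0]
        holo_germ_compose[OF holo_E holo_\<mu> \<mu>_0])
  then show ?thesis unfolding s0_def[abs_def] by (rule holo_germ_drop_coord)
qed

lemma \<kappa>_s0: "bb (\<mu> z) \<noteq> 0 \<Longrightarrow> \<kappa> (s0 z) = \<epsilon> - frechet_derivative \<phi> (at (\<mu> z)) (E (\<mu> z))"
  unfolding s0_def by (rule \<kappa>_prp) (simp add: h_diff h_d\<phi>_E)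

lemma \<phi>_\<mu>_0: "\<phi> (\<mu> 0) = 0"
  by simp

text \<open>Extend \<open>s\<close> to the source of \<phi>, decompose it there with
  \<open>h \<circ> \<xi>\<close> equal to a constant c, and restrict back. Subtracting c
  \<open>s0\<close> is exactly the correction that makes both parts tangent to the section.\<close>

lemma Ae_tangent_f0_span:
  assumes s: "holo_germ s"
  shows "\<exists>c. (\<lambda>z. s z - c *s s0 z) \<in> Ae_tangent f0"
proof -
  \<comment> \<open>The extension is constant in the direction v_(k-1), and \<kappa> gives it
    h-value 0.\<close>
  have "holo_germ (\<lambda>x. \<kappa> (s (prn x)))"
    by (intro holo_germ_\<kappa> holo_germ_compose[OF s holo_prn]) simp
  then obtain \<eta> \<xi> c where \<eta>: "holo_germ \<eta>" and \<xi>: "holo_germ \<xi>"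
    and eq: "\<forall>\<^sub>F x in nhds 0. \<kappa> (s (prn x)) = frechet_derivative \<phi> (at x) (\<eta> x) + \<xi> (\<phi> x)"
    and h\<xi>: "\<forall>\<^sub>F w in nhds 0. h (\<xi> w) = c"
    using infinitesimal_stability by blast
  \<comment> \<open>Since \<kappa> (s z) has h-value 0 and \<xi> contributes c, the image of \<eta>
    has h-value -c along \<mu>; adding c \<open>E\<close> brings it to 0.\<close>
  define \<tau> where "\<tau> z = \<eta> (\<mu> z) + c *s E (\<mu> z)" for z
  define \<eta>' where "\<eta>' z = prn (\<tau> z)" for z
  define \<xi>' where "\<xi>' w = prp (\<xi> (\<kappa> w) - c *s \<epsilon>)" for w
  have "holo_germ \<tau>" unfolding \<tau>_def[abs_def]
    by (intro holo_germ_add holo_germ_scale hgerm_const holo_germ_compose[OF _ holo_\<mu> \<mu>_0] \<eta> holo_E)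
  then have \<eta>': "holo_germ \<eta>'" unfolding \<eta>'_def[abs_def] by (rule holo_germ_drop_coord)
  have \<xi>': "holo_germ \<xi>'" unfolding \<xi>'_def[abs_def]
    by (intro holo_germ_drop_coord holo_germ_diff holo_germ_compose[OF \<xi> holo_\<kappa> \<kappa>_0] holo_germ_const)
  have "\<forall>\<^sub>F z in nhds 0. s z - c *s s0 z = frechet_derivative f0 (at z) (\<eta>' z) + \<xi>' (f0 z)"
    using holo_germ_eventually[OF holo_\<mu> \<mu>_0 eq] holo_germ_eventually[OF holo_\<phi>_\<mu> \<phi>_\<mu>_0 h\<xi>] \<kappa>_f0 d\<phi>_d\<mu>
      tangent_\<mu> bb_\<mu>_nz
  proof eventually_elim
    case (elim z)
    let ?d = "frechet_derivative \<phi> (at (\<mu> z))"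
    have 1: "\<kappa> (s z) = ?d (\<eta> (\<mu> z)) + \<xi> (\<phi> (\<mu> z))" using elim(1) by simp
    have 2: "?d (\<tau> z) = ?d (\<eta> (\<mu> z)) + c *s ?d (E (\<mu> z))"
      by (simp add: \<tau>_def frechet_derivative_vdiff_linear)
    have "h (?d (\<eta> (\<mu> z))) = - c" using arg_cong[OF 1, of h] elim(2) by (simp add: h_add add_eq_0_iff)
    then have "h (?d (\<tau> z)) = 0" unfolding 2 using elim(6) by (simp add: h_add h_scale h_d\<phi>_E)
    then have 3: "?d (\<tau> z) = \<kappa> (frechet_derivative f0 (at z) (\<eta>' z))"
      unfolding \<eta>'_def using elim(4,5) by metis
    have "\<kappa> (s z - c *s s0 z) = ?d (\<eta> (\<mu> z)) + \<xi> (\<phi> (\<mu> z)) - c *s \<kappa> (s0 z)"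
      using \<kappa>_add[of "s z - c *s s0 z" "c *s s0 z"] 1 by (simp add: \<kappa>_scale)
    also have "\<dots> = ?d (\<tau> z) + (\<xi> (\<phi> (\<mu> z)) - c *s \<epsilon>)"
      unfolding 2 using elim(6) by (simp add: \<kappa>_s0 vec_eq_iff algebra_simps)
    finally have "prp (\<kappa> (s z - c *s s0 z)) = prp (\<kappa> (frechet_derivative f0 (at z) (\<eta>' z))) + prp (\<xi> (\<phi> (\<mu> z)) - c *s \<epsilon>)"
      unfolding 3 by (simp only: drop_coord_linear)
    then show ?case using elim(3) by (simp add: \<xi>'_def)
  qed
  moreover have "holo_germ (\<lambda>z. s z - c *s s0 z)"
    by (intro holo_germ_diff holo_germ_scale hgerm_const s holo_s0)
  ultimately show ?thesis using \<eta>' \<xi>' unfolding Ae_tangent_iff by blast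
qed

text \<open>Along the curve \<open>\<mu> (t *s unit_vec (2 * k - 3))\<close>, where \<open>u\<close> vanishes, \<open>v = O(t ^ k)\<close> and \<open>y = t\<close>, a relation
  would equate polynomials of degree below \<open>k - 1\<close> and \<open>k\<close> with functions of higher order.\<close>

lemma s0_notin_Ae_tangent: "s0 \<notin> Ae_tangent f0"
proof
  assume "s0 \<in> Ae_tangent f0"
  then obtain \<eta> \<xi> where \<eta>: "holo_germ \<eta>" and \<xi>: "holo_germ \<xi>"
    and eq: "\<forall>\<^sub>F z in nhds 0. s0 z = frechet_derivative f0 (at z) (\<eta> z) + \<xi> (f0 z)"
    by (auto simp: Ae_tangent_iff)
  define \<tau> where "\<tau> z = frechet_derivative \<mu> (at z) (\<eta> z) + E (\<mu> z)" for z
  have \<tau>: "holo_germ \<tau>" unfolding \<tau>_def[abs_def]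
    by (intro holo_germ_add holo_germ_compose[OF holo_E holo_\<mu> \<mu>_0]
        holo_germ_frechet_along[OF holo_\<mu> holo_germ_id] \<eta>) simp
  \<comment> \<open>\<open>D\<close> has h-value 1 everywhere, whereas the order estimates below
    force \<open>h (D 0)\<close> to be 0.\<close>
  define D where "D w = \<epsilon> - \<kappa> (\<xi> w)" for w
  have D: "holo_germ D" unfolding D_def[abs_def] by (intro holo_germ_diff holo_germ_const holo_germ_\<kappa> \<xi>)
  have main: "\<forall>\<^sub>F z in nhds 0. D (f0 z) = frechet_derivative \<phi> (at (\<mu> z)) (\<tau> z)"
    using eq d\<phi>_d\<mu> bb_\<mu>_nz
  proof eventually_elim
    case (elim z)
    have "\<kappa> (s0 z) = \<kappa> (frechet_derivative f0 (at z) (\<eta> z)) + \<kappa> (\<xi> (f0 z))"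
      using elim(1) by (simp add: \<kappa>_add)
    then show ?case
      using elim(2,3) by (simp add: D_def \<tau>_def \<kappa>_s0 frechet_derivative_vdiff_linear algebra_simps)
  qed
  \<comment> \<open>With v_(k-1) dropped, the coordinate y has number 2k - 3 in the source of
    \<open>f0\<close>.\<close>
  define ey :: "complex ^ 'm" where "ey = unit_vec (2 * k - 3)"
  have ey: "coord i (t *s ey) = (if i = 2 * k - 3 then t else 0)" if "1 \<le> i" "i \<le> 2 * k - 3" for i t
    using that by (simp add: ey_def coord_unit_vec card_pb)
  have ins: "coord i (insn (t *s ey)) = (if i = 2 * k - 2 then t else 0)" if "1 \<le> i" "i \<le> 2 * k - 2" for i t
  proof -
    have "coord i (insn (t *s ey)) = (if i < 2 * k - 3 then coord i (t *s ey) else if i = 2 * k - 3 then 0 else coord (i - 1) (t *s ey))"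
      using that by (intro coord_insert_zero) (simp_all add: card_source)
    then show ?thesis using that k ey[of i t] ey[of "i - 1" t] by auto
  qed
  define \<nu> where "\<nu> t = - (h (\<phi> (insn (t *s ey))) / bb (insn (t *s ey)))" for t
  have \<mu>_line: "\<mu> (t *s ey) = insn (t *s ey) + \<nu> t *s ev" for t
    unfolding \<mu>_def \<nu>_def ..
  have y_line: "y (\<mu> (t *s ey)) = t" for t
    unfolding \<mu>_line y_add_ev using k by (simp add: ins)
  have par_line: "coord i (\<mu> (t *s ey)) = (if i = 2 * k - 3 then \<nu> t else 0)" if "1 \<le> i" "i \<le> 2 * k - 3" for i t
    unfolding \<mu>_line using that k by (auto simp: ins coord_ev)
  have \<phi>_ins: "coord i (\<phi> (insn (t *s ey))) = (if i = 2 * k - 2 then t ^ k else 0)" if "1 \<le> i" "i \<le> 2 * k - 1" for i t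
  proof -
    have yi: "y (insn (t *s ey)) = t" using k by (simp add: ins)
    have 0: "coord i (insn (t *s ey)) = 0" if "1 \<le> i" "i \<le> 2 * k - 3" for i
      using that k by (simp add: ins)
    consider "i \<le> 2 * k - 3" | "i = 2 * k - 2" | "i = 2 * k - 1" using \<open>i \<le> 2 * k - 1\<close> by linarith
    then show ?thesis
    proof cases
      case 1
      then show ?thesis using that k by (simp add: 0)
    next
      case 2
      have "(\<Sum>i = 1..k - 2. coord i (insn (t *s ey)) * t ^ i) = 0"
        using k by (intro sum.neutral) (auto simp: 0)
      then show ?thesis unfolding 2 coord_\<phi>_W1 yi by simp
    next
      case 3
      have "(\<Sum>i = 1..k - 1. coord (k - 2 + i) (insn (t *s ey)) * t ^ i) = 0"
      proof (intro sum.neutral ballI)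
        fix i assume "i \<in> {1..k - 1}"
        then have "1 \<le> k - 2 + i" "k - 2 + i \<le> 2 * k - 3" using k by auto
        from 0[OF this] show "coord (k - 2 + i) (insn (t *s ey)) * t ^ i = 0" by (simp only: mult_zero_left)
      qed
      then show ?thesis unfolding 3 coord_\<phi>_W2 yi using k by simp
    qed
  qed
  have h_ins: "h (\<phi> (insn (t *s ey))) = \<gamma>\<^sub>1 * t ^ k" for t
  proof -
    have "(\<Sum>i = 1..k - 2. \<alpha> i * coord i (\<phi> (insn (t *s ey)))) = 0"
      using k by (intro sum.neutral ballI) (subst \<phi>_ins, auto)
    moreover have "(\<Sum>i = 1..k - 1. \<beta> i * coord (k - 2 + i) (\<phi> (insn (t *s ey)))) = 0"
      using k by (intro sum.neutral ballI) (subst \<phi>_ins, auto)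
    ultimately show ?thesis unfolding h_def
      using \<phi>_ins[of "2 * k - 2" t] \<phi>_ins[of "2 * k - 1" t] k by (simp del: coord_\<phi>_W1 coord_\<phi>_W2 coord_\<phi>_W2_Suc)
  qed
  \<comment> \<open>On the line before correction only the component W_1 of \<phi> is non-zero,
    namely t^k. So h equals \<gamma>_1 t^k there, and dividing by the unit \<open>bb\<close> keeps
    the order.\<close>
  have \<nu>: "\<nu> \<in> O[at 0](\<lambda>t. t ^ k)"
  proof -
    have "hgerm (\<lambda>z. - (\<gamma>\<^sub>1 / bb (insn z)))"
      by (intro hgerm_minus hgerm_divide hgerm_const hgerm_compose[OF hgerm_bb holo_insn]) (simp_all add: bb_0)
    from landau_o.big.mult[OF hgerm_line_bigo[OF this, of ey] landau_o.big_refl[of "\<lambda>t. t ^ k"]]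
    show ?thesis by (simp add: \<nu>_def[abs_def] h_ins)
  qed
  have \<phi>_line: "(\<lambda>t. coord i (\<phi> (\<mu> (t *s ey)))) \<in> O[at 0](\<lambda>t. t ^ k)" if "1 \<le> i" "i \<le> 2 * k - 1" for i
  proof -
    have "(\<lambda>t. if i = 2 * k - 2 then t ^ k else 0) \<in> O[at 0](\<lambda>t :: complex. t ^ k)"
      by (cases "i = 2 * k - 2") simp_all
    moreover have "(\<lambda>t. \<nu> t * (coord i eV + t ^ (k - 1) * coord i eW2)) \<in> O[at 0](\<lambda>t. t ^ k * 1)"
      by (intro landau_o.big.mult \<nu> isCont_imp_bigo_1 continuous_intros)
    ultimately have "(\<lambda>t. (if i = 2 * k - 2 then t ^ k else 0) + \<nu> t * (coord i eV + t ^ (k - 1) * coord i eW2))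
        \<in> O[at 0](\<lambda>t. t ^ k)"
      by (intro sum_in_bigo) simp_all
    moreover have "coord i (\<phi> (\<mu> (t *s ey))) = (if i = 2 * k - 2 then t ^ k else 0) + \<nu> t * (coord i eV + t ^ (k - 1) * coord i eW2)" for t
      using k unfolding \<mu>_line \<phi>_add_ev coord_add coord_scale \<phi>_ins[OF that] by (simp add: ins)
    ultimately show ?thesis by simp
  qed
  have f0_line: "(\<lambda>t. f0 (t *s ey) $ j) \<in> O[at 0](\<lambda>t. t ^ k)" for j
  proof -
    obtain i where i: "1 \<le> i" "i \<le> CARD('n)" "\<And>x :: complex ^ 'n. coord i x = x $ j"
      using ex_coord_eq_nth[of j] by blast
    have "f0 z $ j = (if i < 2 * k - 3 then coord i (\<phi> (\<mu> z)) else coord (i + 1) (\<phi> (\<mu> z)))" for z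
      unfolding i(3)[symmetric] f0_def by (rule coord_drop_coord[OF i(1,2)])
    then show ?thesis using \<phi>_line[of i] \<phi>_line[of "i + 1"] i(1,2) card_source by (cases "i < 2 * k - 3") auto
  qed
  \<comment> \<open>By Hadamard's lemma the variation of \<open>D\<close> is at most of the order of
    \<open>f0\<close>, so \<open>D \<circ> f0\<close> may be replaced by \<open>D 0\<close> up to
    O(t^k).\<close>
  have D_line: "(\<lambda>t. coord i (D (f0 (t *s ey))) - coord i (D 0)) \<in> O[at 0](\<lambda>t. t ^ k)" for i
  proof -
    have hD: "hgerm (\<lambda>w. coord i (D w) - coord i (D 0))" using D by (intro hgerm_diff hgerm_coord_comp) auto
    have "coord i (D 0) - coord i (D 0) = 0" by simp
    from Hadamard_germ[OF hD this] obtain r where r: "\<And>j. hgerm (r j)" and r_eq: "\<forall>\<^sub>F w in nhds 0. coord i (D w) - coord i (D 0) = (\<Sum>j\<in>UNIV. r j w * w $ j)"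
      by blast
    have "(\<lambda>t. \<Sum>j\<in>UNIV. r j (f0 (t *s ey)) * f0 (t *s ey) $ j) \<in> O[at 0](\<lambda>t. 1 * t ^ k)"
      by (intro big_sum_in_bigo landau_o.big.mult f0_line hgerm_line_bigo[of "\<lambda>z. r _ (f0 z)"] hgerm_compose[OF r holo_f0 f0_0])
    moreover have "\<forall>\<^sub>F t in at 0. coord i (D (f0 (t *s ey))) - coord i (D 0) = (\<Sum>j\<in>UNIV. r j (f0 (t *s ey)) * f0 (t *s ey) $ j)"
      by (rule eventually_line[OF holo_germ_eventually[OF holo_f0 f0_0 r_eq]])
    ultimately show ?thesis using landau_o.big.in_cong by fastforce
  qed
  have main_line: "\<forall>\<^sub>F t in at 0. D (f0 (t *s ey)) = frechet_derivative \<phi> (at (\<mu> (t *s ey))) (\<tau> (t *s ey))"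
    by (rule eventually_line[OF main])
  have \<tau>y: "(\<lambda>t. y (\<tau> (t *s ey))) \<in> O[at 0](\<lambda>_. 1)"
    using \<tau> by (intro hgerm_line_bigo[of "\<lambda>z. y (\<tau> z)"]) auto
  let ?D = "\<lambda>i t. coord i (D (f0 (t *s ey))) - coord i (D 0)"
  have t_pow: "(\<lambda>t :: complex. t ^ i) \<in> O[at 0](\<lambda>_. 1)" for i
    using power_bigo_power[of 0 i] by simp
  \<comment> \<open>In the row of W_1 the function \<open>Py\<close> is k t^(k-1) on the curve.
    Replacing \<open>D\<close> by \<open>D 0\<close> leaves a polynomial of degree below k - 1 that
    is O(t^(k-1)).\<close>
  have W1: "coord i (D 0) = 0" if i: "i \<in> {1..k - 2} \<union> {2 * k - 2}" for i
  proof -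
    define c where "c i = (if i = 0 then coord (2 * k - 2) (D 0) else - coord i (D 0))" for i
    have Py: "Py (\<mu> (t *s ey)) = of_nat k * t ^ (k - 1)" for t
    proof -
      have "(\<Sum>i = 1..k - 2. of_nat i * coord i (\<mu> (t *s ey)) * t ^ (i - 1)) = 0"
        using k by (intro sum.neutral) (auto simp: par_line split: if_splits)
      then show ?thesis by (simp add: Py_def y_line)
    qed
    have A: "(\<lambda>t. of_nat k * t ^ (k - 1) * y (\<tau> (t *s ey))) \<in> O[at 0](\<lambda>t. t ^ (k - 1) * 1)"
      using \<tau>y by (intro landau_o.big.mult) auto
    have "(\<lambda>t. \<Sum>i = 1..k - 2. ?D i t * t ^ i) \<in> O[at 0](\<lambda>t. t ^ k * 1)"
      by (intro big_sum_in_bigo landau_o.big.mult D_line t_pow)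
    then have "(\<lambda>t. \<Sum>i = 1..k - 2. ?D i t * t ^ i) \<in> O[at 0](\<lambda>t. t ^ k)" by (simp only: mult_1_right)
    then have B: "(\<lambda>t. \<Sum>i = 1..k - 2. ?D i t * t ^ i) \<in> O[at 0](\<lambda>t. t ^ (k - 1))"
      by (rule landau_o.big_trans) (rule power_bigo_power, simp)
    have C: "?D (2 * k - 2) \<in> O[at 0](\<lambda>t. t ^ (k - 1))"
      by (rule landau_o.big_trans[OF D_line]) (rule power_bigo_power, simp)
    have "(\<lambda>t. of_nat k * t ^ (k - 1) * y (\<tau> (t *s ey)) + (\<Sum>i = 1..k - 2. ?D i t * t ^ i)
        - ?D (2 * k - 2) t) \<in> O[at 0](\<lambda>t. t ^ (k - 1))"
      using sum_in_bigo(2)[OF sum_in_bigo(1)[OF A[unfolded mult_1_right] B] C] .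
    moreover have "\<forall>\<^sub>F t in at 0. of_nat k * t ^ (k - 1) * y (\<tau> (t *s ey)) + (\<Sum>i = 1..k - 2. ?D i t * t ^ i)
        - ?D (2 * k - 2) t = (\<Sum>i<k - 1. c i * t ^ i)"
      using main_line
    proof eventually_elim
      case (elim t)
      have D_par: "coord i (D (f0 (t *s ey))) = coord i (\<tau> (t *s ey))" if "i \<in> {1..k - 2}" for i
        unfolding elim by (rule coord_d\<phi>_parameter) (use that k in auto)
      have "coord (2 * k - 2) (D (f0 (t *s ey))) = of_nat k * t ^ (k - 1) * y (\<tau> (t *s ey))
          + (\<Sum>i = 1..k - 2. coord i (\<tau> (t *s ey)) * t ^ i)"
        unfolding elim coord_d\<phi>_W1 Py y_line ..
      also have "(\<Sum>i = 1..k - 2. coord i (\<tau> (t *s ey)) * t ^ i)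
          = (\<Sum>i = 1..k - 2. ?D i t * t ^ i) + (\<Sum>i = 1..k - 2. coord i (D 0) * t ^ i)"
        unfolding sum.distrib[symmetric] by (intro sum.cong) (auto simp: D_par algebra_simps)
      finally have 1: "coord (2 * k - 2) (D (f0 (t *s ey))) = of_nat k * t ^ (k - 1) * y (\<tau> (t *s ey))
          + ((\<Sum>i = 1..k - 2. ?D i t * t ^ i) + (\<Sum>i = 1..k - 2. coord i (D 0) * t ^ i))" .
      have "(\<Sum>i<k - 1. c i * t ^ i) = coord (2 * k - 2) (D 0) + (\<Sum>i = 1..k - 2. c i * t ^ i)"
        using sum_lessThan_split_0[of "k - 1" "\<lambda>i. c i * t ^ i"] k by (simp add: c_def numeral_2_eq_2)
      also have "(\<Sum>i = 1..k - 2. c i * t ^ i) = - (\<Sum>i = 1..k - 2. coord i (D 0) * t ^ i)"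
        unfolding sum_negf[symmetric] by (intro sum.cong) (auto simp: c_def)
      finally have 2: "(\<Sum>i<k - 1. c i * t ^ i) = coord (2 * k - 2) (D 0) + - (\<Sum>i = 1..k - 2. coord (i) (D 0) * t ^ i)" .
      have "X + S - (X + (S + T) - d) = d + - T" for X S T d :: complex by simp
      then show ?case unfolding 1 2 .
    qed
    ultimately have "(\<lambda>t. \<Sum>i<k - 1. c i * t ^ i) \<in> O[at 0](\<lambda>t. t ^ (k - 1))"
      using landau_o.big.in_cong by fastforce
    note c0 = polynomial_bigo_imp_0[OF this]
    from i show ?thesis
    proof
      assume "i \<in> {1..k - 2}"
      then show ?thesis using c0[of i] k by (auto simp: c_def)
    next
      assume "i \<in> {2 * k - 2}"
      then show ?thesis using c0[of 0] k by (auto simp: c_def)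
    qed
  qed
  \<comment> \<open>In the row of W_2 the function \<open>Qy\<close> is O(t^k), as the only non-zero
    v-coordinate on the curve is \<open>\<nu> t\<close>. A polynomial of degree below k is then
    O(t^k).\<close>
  have W2: "(i = 0 \<longrightarrow> coord (2 * k - 1) (D 0) = 0) \<and> (i \<noteq> 0 \<longrightarrow> coord (k - 2 + i) (D 0) = 0)" if i: "i < k" for i
  proof -
    define c where "c i = (if i = 0 then coord (2 * k - 1) (D 0) else - coord (k - 2 + i) (D 0))" for i
    have par: "1 \<le> k - 2 + i" "k - 2 + i \<le> 2 * k - 3" if "i \<in> {1..k - 1}" for i
      using that k by auto
    have "(\<lambda>t. \<Sum>i = 1..k - 1. of_nat i * coord (k - 2 + i) (\<mu> (t *s ey)) * t ^ (i - 1)) \<in> O[at 0](\<lambda>t. t ^ k * 1)"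
    proof (intro big_sum_in_bigo landau_o.big.mult t_pow)
      fix i assume i: "i \<in> {1..k - 1}"
      show "(\<lambda>t. of_nat i * coord (k - 2 + i) (\<mu> (t *s ey))) \<in> O[at 0](\<lambda>t. t ^ k)"
        unfolding par_line[OF par[OF i]] using \<nu> by (cases "k - 2 + i = 2 * k - 3") simp_all
    qed
    then have "(\<lambda>t. Qy (\<mu> (t *s ey))) \<in> O[at 0](\<lambda>t. t ^ k * 1)"
      by (simp only: Qy_def y_line)
    from landau_o.big.mult[OF this \<tau>y]
    have A: "(\<lambda>t. Qy (\<mu> (t *s ey)) * y (\<tau> (t *s ey))) \<in> O[at 0](\<lambda>t. t ^ k)" by (simp only: mult_1_right)
    have "(\<lambda>t. \<Sum>i = 1..k - 1. ?D (k - 2 + i) t * t ^ i) \<in> O[at 0](\<lambda>t. t ^ k * 1)"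
      by (intro big_sum_in_bigo landau_o.big.mult D_line t_pow)
    then have B: "(\<lambda>t. \<Sum>i = 1..k - 1. ?D (k - 2 + i) t * t ^ i) \<in> O[at 0](\<lambda>t. t ^ k)"
      by (simp only: mult_1_right)
    have "(\<lambda>t. Qy (\<mu> (t *s ey)) * y (\<tau> (t *s ey)) + (\<Sum>i = 1..k - 1. ?D (k - 2 + i) t * t ^ i)
        - ?D (2 * k - 1) t) \<in> O[at 0](\<lambda>t. t ^ k)"
      using sum_in_bigo(2)[OF sum_in_bigo(1)[OF A B] D_line[of "2 * k - 1"]] .
    moreover have "\<forall>\<^sub>F t in at 0. Qy (\<mu> (t *s ey)) * y (\<tau> (t *s ey)) + (\<Sum>i = 1..k - 1. ?D (k - 2 + i) t * t ^ i)
        - ?D (2 * k - 1) t = (\<Sum>i<k. c i * t ^ i)"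
      using main_line
    proof eventually_elim
      case (elim t)
      have D_par: "coord (k - 2 + i) (D (f0 (t *s ey))) = coord (k - 2 + i) (\<tau> (t *s ey))" if "i \<in> {1..k - 1}" for i
        unfolding elim by (rule coord_d\<phi>_parameter[OF par[OF that]])
      have "coord (2 * k - 1) (D (f0 (t *s ey))) = Qy (\<mu> (t *s ey)) * y (\<tau> (t *s ey))
          + (\<Sum>i = 1..k - 1. coord (k - 2 + i) (\<tau> (t *s ey)) * t ^ i)"
        unfolding elim coord_d\<phi>_W2 y_line ..
      also have "(\<Sum>i = 1..k - 1. coord (k - 2 + i) (\<tau> (t *s ey)) * t ^ i)
          = (\<Sum>i = 1..k - 1. ?D (k - 2 + i) t * t ^ i) + (\<Sum>i = 1..k - 1. coord (k - 2 + i) (D 0) * t ^ i)"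
        unfolding sum.distrib[symmetric]
      proof (intro sum.cong refl)
        fix i assume "i \<in> {1..k - 1}"
        from D_par[OF this] show "coord (k - 2 + i) (\<tau> (t *s ey)) * t ^ i
          = ?D (k - 2 + i) t * t ^ i + coord (k - 2 + i) (D 0) * t ^ i" by (simp only: left_diff_distrib diff_add_cancel)
      qed
      finally have 1: "coord (2 * k - 1) (D (f0 (t *s ey))) = Qy (\<mu> (t *s ey)) * y (\<tau> (t *s ey))
          + ((\<Sum>i = 1..k - 1. ?D (k - 2 + i) t * t ^ i) + (\<Sum>i = 1..k - 1. coord (k - 2 + i) (D 0) * t ^ i))" .
      have "(\<Sum>i<k. c i * t ^ i) = coord (2 * k - 1) (D 0) + (\<Sum>i = 1..k - 1. c i * t ^ i)"
        using sum_lessThan_split_0[of k "\<lambda>i. c i * t ^ i"] k by (simp add: c_def)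
      also have "(\<Sum>i = 1..k - 1. c i * t ^ i) = - (\<Sum>i = 1..k - 1. coord (k - 2 + i) (D 0) * t ^ i)"
        unfolding sum_negf[symmetric] by (intro sum.cong) (auto simp: c_def)
      finally have 2: "(\<Sum>i<k. c i * t ^ i) = coord (2 * k - 1) (D 0) + - (\<Sum>i = 1..k - 1. coord (k - 2 + i) (D 0) * t ^ i)" .
      have "X + S - (X + (S + T) - d) = d + - T" for X S T d :: complex by simp
      then show ?case unfolding 1 2 .
    qed
    ultimately have "(\<lambda>t. \<Sum>i<k. c i * t ^ i) \<in> O[at 0](\<lambda>t. t ^ k)"
      using landau_o.big.in_cong by fastforce
    from polynomial_bigo_imp_0[OF this i] show ?thesis by (auto simp: c_def split: if_splits)
  qed
  have "h (D 0) = 0"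
  proof -
    have "(\<Sum>i = 1..k - 2. \<alpha> i * coord i (D 0)) = 0" using W1 by (intro sum.neutral) auto
    moreover have "(\<Sum>i = 1..k - 1. \<beta> i * coord (k - 2 + i) (D 0)) = 0"
    proof (intro sum.neutral ballI)
      fix i assume "i \<in> {1..k - 1}"
      then have "i < k" "i \<noteq> 0" using k by auto
      with W2[of i] have "coord (k - 2 + i) (D 0) = 0" by blast
      then show "\<beta> i * coord (k - 2 + i) (D 0) = 0" by (simp only: mult_zero_right)
    qed
    moreover have "coord (2 * k - 2) (D 0) = 0" "coord (2 * k - 1) (D 0) = 0" using W1 W2[of 0] k by auto
    ultimately show ?thesis unfolding h_def by simp
  qed
  then show False by (simp add: D_def h_diff)
qed

lemma cod_one_f0: "cod_one f0"
  unfolding cod_one_def using holo_s0 s0_notin_Ae_tangent Ae_tangent_f0_span by blast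

end

subsection \<open>Arbitrary pullbacks\<close>

lemma eventually_fst_0: "\<forall>\<^sub>F x in nhds 0. P x \<Longrightarrow> \<forall>\<^sub>F w in nhds (0 :: 'a::real_normed_vector \<times> 'b::real_normed_vector). P (fst w)"
  by (rule eventually_isCont_nhds) (auto intro: continuous_intros)

lemma eventually_snd_0: "\<forall>\<^sub>F x in nhds 0. P x \<Longrightarrow> \<forall>\<^sub>F w in nhds (0 :: 'a::real_normed_vector \<times> 'b::real_normed_vector). P (snd w)"
  by (rule eventually_isCont_nhds) (auto intro: continuous_intros)

lemma frechet_derivative_Pair:
  assumes "vdiff (\<lambda>z. fst (\<psi> z)) x" "vdiff (\<lambda>z. snd (\<psi> z)) x"
  shows "frechet_derivative \<psi> (at x) v
    = (frechet_derivative (\<lambda>z. fst (\<psi> z)) (at x) v, frechet_derivative (\<lambda>z. snd (\<psi> z)) (at x) v)"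
proof -
  have "((\<lambda>z. (fst (\<psi> z), snd (\<psi> z))) has_derivative
    (\<lambda>v. (frechet_derivative (\<lambda>z. fst (\<psi> z)) (at x) v, frechet_derivative (\<lambda>z. snd (\<psi> z)) (at x) v))) (at x)"
    by (intro has_derivative_Pair vdiff_has_derivative(1) assms)
  then have "(\<psi> has_derivative
    (\<lambda>v. (frechet_derivative (\<lambda>z. fst (\<psi> z)) (at x) v, frechet_derivative (\<lambda>z. snd (\<psi> z)) (at x) v))) (at x)"
    by (simp only: prod.collapse)
  from fun_cong[OF frechet_derivative_at[OF this], of v] show ?thesis by (rule sym)
qed

lemma holo_germ_vdiff_0: "holo_germ s \<Longrightarrow> vdiff s 0"
  unfolding holo_germ_iff_vdiff by (rule eventually_nhds_x_imp_x)

context section_pullback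
begin

context
  fixes g :: "complex ^ 'n \<Rightarrow> complex ^ 'p"
  assumes g: "map_germ g" and imm: "immersive g" and hg: "\<forall>\<^sub>F w in nhds 0. h (g w) = 0"
begin

text \<open>The change of parameter between the two parametrizations of the hyperplane: near 0,
  \<open>g\<close> is \<kappa> composed with \<open>gbar\<close>.\<close>

definition gbar :: "complex ^ 'n \<Rightarrow> complex ^ 'n" where "gbar w = prp (g w)"

lemma holo_g: "holo_germ g" and g_0: "g 0 = 0"
  using g by (auto simp: map_germ_def)

lemma holo_gbar: "holo_germ gbar"
  unfolding gbar_def[abs_def] by (rule holo_germ_drop_coord[OF holo_g])

lemma gbar_0: "gbar 0 = 0"
  by (simp add: gbar_def g_0)

lemma g_eq: "\<forall>\<^sub>F w in nhds 0. g w = \<kappa> (gbar w)"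
  using hg by eventually_elim (simp add: gbar_def \<kappa>_prp)

lemma dg_eq: "frechet_derivative g (at 0) v = \<kappa> (frechet_derivative gbar (at 0) v)"
proof -
  have "frechet_derivative g (at 0) v = frechet_derivative (\<lambda>w. \<kappa> (gbar w)) (at 0) v"
    using frechet_derivative_cong_ev[OF g_eq] by simp
  also have "\<dots> = frechet_derivative \<kappa> (at (gbar 0)) (frechet_derivative gbar (at 0) v)"
    by (rule frechet_derivative_vdiff_compose[OF holo_germ_vdiff_0[OF holo_gbar] vdiff_\<kappa>])
  finally show ?thesis by (simp add: frechet_\<kappa>)
qed

text \<open>As \<kappa> is linear, the differential of \<open>g\<close> factors through that of
  \<open>gbar\<close>, so injectivity passes to the latter.\<close>

lemma gbar_inverse:
  obtains L where "holo_germ L" "L 0 = 0" "\<forall>\<^sub>F w in nhds 0. L (gbar w) = w" "\<forall>\<^sub>F w in nhds 0. gbar (L w) = w"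
proof -
  have "inj (frechet_derivative gbar (at 0))"
  proof (rule injI)
    fix u v assume "frechet_derivative gbar (at 0) u = frechet_derivative gbar (at 0) v"
    then have "frechet_derivative g (at 0) u = frechet_derivative g (at 0) v" by (simp add: dg_eq)
    then show "u = v" using imm by (simp add: immersive_def inj_eq)
  qed
  from inverse_germ[OF holo_gbar gbar_0 this] that show ?thesis by blast
qed

text \<open>The projection of the fibre product to the source of \<phi> is parametrized by \<mu>;
  the second factor is then forced by g (f z) = \<kappa> (f0 z), that is, f = L \<circ> f0.\<close>

lemma ex_pullback: "\<exists>f :: complex ^ 'm \<Rightarrow> complex ^ 'n. is_pullback g \<phi> f"
proof -
  obtain L where L: "holo_germ L" "L 0 = 0" and Lg: "\<forall>\<^sub>F w in nhds 0. L (gbar w) = w"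
    and gL: "\<forall>\<^sub>F w in nhds 0. gbar (L w) = w" by (rule gbar_inverse)
  define f where "f z = L (f0 z)" for z
  have f: "holo_germ f" "f 0 = 0"
    unfolding f_def[abs_def] using L holo_germ_compose[OF L(1) holo_f0 f0_0] by simp_all
  define \<psi> where "\<psi> z = (\<mu> z, f z)" for z
  have "transverse \<phi> g"
    unfolding transverse_def
  proof
    fix w :: "complex ^ 'p"
    have "frechet_derivative gbar (at (L 0)) (frechet_derivative L (at 0) v) = v" for v
      using eventually_nhds_x_imp_x[OF eventually_frechet_derivative_inverse[OF L holo_gbar gL]] by blast
    then have "frechet_derivative g (at 0) (frechet_derivative L (at 0) (prp w)) = \<kappa> (prp w)"
      by (simp add: dg_eq L(2))
    \<comment> \<open>The image of \<open>g\<close> supplies h = 0, and the missing direction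
      \<open>eV\<close> is the image of \<open>ev\<close> under the differential of \<phi>, because
      y = 0 at the origin. \<open>c\<close> is the component of \<open>w\<close> along
      \<open>eV\<close> relative to the graph.\<close>
    moreover define c where "c = coord (2 * k - 3) w + h (insp (prp w)) / \<beta> (k - 1)"
    have "frechet_derivative \<phi> (at 0) (c *s ev) = c *s eV"
      using k by (simp add: frechet_derivative_vdiff_linear d\<phi>_ev zero_power)
    moreover have "w = c *s eV + \<kappa> (prp w)"
      by (subst decompose_p[of w]) (simp add: c_def \<kappa>_def vec_eq_iff algebra_simps)
    ultimately show "\<exists>v y. w = frechet_derivative \<phi> (at 0) v + frechet_derivative g (at 0) y" by metis
  qed
  moreover have "parametrizes \<psi> {(x, y). \<phi> x = g y}"
    unfolding parametrizes_def
  proof (intro conjI allI impI)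
    show "\<psi> 0 = 0" by (simp add: \<psi>_def f zero_prod_def)
    show "immersive \<psi>"
      unfolding immersive_def
    proof (rule injI)
      fix u v assume eq: "frechet_derivative \<psi> (at 0) u = frechet_derivative \<psi> (at 0) v"
      \<comment> \<open>The first component already has injective derivative, because
        \<open>prn\<close> is a left inverse of \<mu>.\<close>
      have "fst (frechet_derivative \<psi> (at 0) v) = frechet_derivative \<mu> (at 0) v" for v
        using frechet_derivative_Pair[of \<psi> 0 v] holo_germ_vdiff_0[OF holo_\<mu>] holo_germ_vdiff_0[OF f(1)]
        by (simp add: \<psi>_def)
      with eq have "prn (frechet_derivative \<mu> (at 0) u) = prn (frechet_derivative \<mu> (at 0) v)" by metis
      then show "u = v" using eventually_nhds_x_imp_x[OF prn_d\<mu>] by simp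
    qed
    show "\<forall>\<^sub>F z in nhds 0. \<psi> z \<in> {(x, y). \<phi> x = g y}"
      using holo_germ_eventually[OF f g_eq] holo_germ_eventually[OF holo_f0 f0_0 gL] \<kappa>_f0
      by eventually_elim (simp add: \<psi>_def f_def)
    fix U :: "(complex ^ 'm) set" assume U: "open U" "0 \<in> U"
    have "\<forall>\<^sub>F x in nhds 0. prn x \<in> U"
      by (rule holo_germ_eventually[OF holo_prn]) (use U in \<open>auto intro: eventually_nhds_in_open\<close>)
    with bb_ev_nz have "\<forall>\<^sub>F x in nhds 0. bb x \<noteq> 0 \<and> prn x \<in> U" by (rule eventually_conj)
    from eventually_fst_0[OF this] eventually_snd_0[OF eventually_conj[OF hg Lg]]
    show "\<forall>\<^sub>F w in nhds 0. w \<in> {(x, y). \<phi> x = g y} \<longrightarrow> w \<in> \<psi> ` U"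
    proof eventually_elim
      case (elim w)
      show ?case
      proof
        assume "w \<in> {(x, y). \<phi> x = g y}"
        then have w: "\<phi> (fst w) = g (snd w)" by auto
        then have \<mu>: "\<mu> (prn (fst w)) = fst w" using elim by (intro \<mu>_prn) auto
        then have "f (prn (fst w)) = L (gbar (snd w))" by (simp add: f_def f0_def w gbar_def)
        then have "\<psi> (prn (fst w)) = w" using elim \<mu> by (simp add: \<psi>_def)
        then show "w \<in> \<psi> ` U" using elim by (metis imageI)
      qed
    qed
  qed
  moreover have "f = snd \<circ> \<psi>" "fst \<circ> \<psi> = \<mu>" by (auto simp: \<psi>_def)
  ultimately show ?thesis
    unfolding is_pullback_def using g imm f by (intro exI[of _ f] conjI exI[of _ \<psi>]) (auto simp: map_germ_def)
qed

text \<open>A point (x, w) of the fibre product near 0 satisfies h (\<phi> x) = h (g w) = 0, hence x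
  = \<mu> (prn x). So any parametrization (a, f) has a = \<mu> \<circ> R with R = prn \<circ> a, and
  f = L \<circ> f0 \<circ> R. Both differentials factor through that of \<open>R\<close>, so
  immersivity makes \<open>R\<close> a local isomorphism and \<open>f\<close> is A-equivalent to
  \<open>f0\<close>.\<close>

lemma Ae_cod_pullback:
  fixes f :: "complex ^ 'm \<Rightarrow> complex ^ 'n"
  assumes "is_pullback g \<phi> f" shows "Ae_cod f = 1"
proof -
  obtain \<psi> :: "complex ^ 'm \<Rightarrow> (complex ^ 'n) \<times> (complex ^ 'n)" where
    \<psi>: "holo_germ (fst \<circ> \<psi>)" "holo_germ (snd \<circ> \<psi>)" "parametrizes \<psi> {(x, y). \<phi> x = g y}" "f = snd \<circ> \<psi>"
    using assms unfolding is_pullback_def by auto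
  define a where "a = fst \<circ> \<psi>"
  have a: "holo_germ a" "a 0 = 0" and f: "holo_germ f" "f 0 = 0"
    and imm_\<psi>: "inj (frechet_derivative \<psi> (at 0))" and af: "\<forall>\<^sub>F z in nhds 0. \<phi> (a z) = g (f z)"
    using \<psi> by (auto simp: a_def parametrizes_def immersive_def case_prod_beta)
  obtain L where L: "holo_germ L" "L 0 = 0" and Lg: "\<forall>\<^sub>F w in nhds 0. L (gbar w) = w"
    and gL: "\<forall>\<^sub>F w in nhds 0. gbar (L w) = w" by (rule gbar_inverse)
  define R where "R z = prn (a z)" for z
  have R: "holo_germ R" "R 0 = 0"
    unfolding R_def[abs_def] using a holo_germ_drop_coord[OF a(1)] by simp_all
  have a_eq: "\<forall>\<^sub>F z in nhds 0. a z = \<mu> (R z)"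
    using af holo_germ_eventually[OF f hg] holo_germ_eventually[OF a bb_ev_nz]
    by eventually_elim (simp add: R_def \<mu>_prn)
  have f_eq: "\<forall>\<^sub>F z in nhds 0. f z = L (f0 (R z))"
    using a_eq af holo_germ_eventually[OF f Lg]
  proof eventually_elim
    case (elim z)
    then show ?case by (metis f0_def gbar_def)
  qed
  have "inj (frechet_derivative R (at 0))"
  proof (rule injI)
    fix u v assume uv: "frechet_derivative R (at 0) u = frechet_derivative R (at 0) v"
    note vR = holo_germ_vdiff_0[OF R(1)]
    have "frechet_derivative a (at 0) w = frechet_derivative \<mu> (at (R 0)) (frechet_derivative R (at 0) w)" for w
      unfolding frechet_derivative_cong_ev[OF a_eq]
      by (rule frechet_derivative_vdiff_compose[OF vR]) (simp add: R(2) holo_germ_vdiff_0)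
    then have 1: "frechet_derivative a (at 0) u = frechet_derivative a (at 0) v" by (simp add: uv)
    have Lf0: "holo_germ (\<lambda>z. L (f0 z))" by (rule holo_germ_compose[OF L(1) holo_f0 f0_0])
    have "frechet_derivative f (at 0) w = frechet_derivative (\<lambda>z. L (f0 z)) (at (R 0)) (frechet_derivative R (at 0) w)" for w
      unfolding frechet_derivative_cong_ev[OF f_eq]
      by (rule frechet_derivative_vdiff_compose[OF vR]) (simp add: R(2) holo_germ_vdiff_0 Lf0)
    then have 2: "frechet_derivative f (at 0) u = frechet_derivative f (at 0) v" by (simp add: uv)
    have "(\<lambda>z. fst (\<psi> z)) = a" "(\<lambda>z. snd (\<psi> z)) = f" by (auto simp: a_def \<psi>(4))
    then have "frechet_derivative \<psi> (at 0) w = (frechet_derivative a (at 0) w, frechet_derivative f (at 0) w)" for w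
      using frechet_derivative_Pair[of \<psi> 0 w] holo_germ_vdiff_0[OF a(1)] holo_germ_vdiff_0[OF f(1)] by simp
    then show "u = v" using 1 2 imm_\<psi> by (metis injD)
  qed
  from inverse_germ[OF R this] obtain R' where R': "holo_germ R'" "R' 0 = 0"
    "\<forall>\<^sub>F z in nhds 0. R' (R z) = z" "\<forall>\<^sub>F z in nhds 0. R (R' z) = z" by blast
  interpret A_equivalence f0 f L gbar R R'
    by standard (simp_all add: f L holo_gbar gbar_0 R R' gL Lg f_eq)
  show ?thesis by (rule Ae_cod_eq_1[OF f(1) cod_one_transport[OF cod_one_f0]])
qed

end

end

text \<open>Since \<open>is_pullback\<close> is a relation, existence is included to keep the claim
  about all representatives from being vacuous.\<close>

theorem corollary5p9:
  fixes k :: nat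
    and \<alpha> \<beta> :: "nat \<Rightarrow> complex" and \<gamma>\<^sub>1 \<gamma>\<^sub>2 :: complex
    and h :: "complex ^ 'p \<Rightarrow> complex"
    and g :: "complex ^ 'n \<Rightarrow> complex ^ 'p"
  assumes "k > 2"
    and "CARD('n) = 2 * k - 2" and "CARD('p) = 2 * k - 1" and "CARD('m) = 2 * k - 3"
    and "h = (\<lambda>w. (\<Sum>i = 1..k - 2. \<alpha> i * coord i w) + (\<Sum>i = 1..k - 1. \<beta> i * coord (k - 2 + i) w)
                 + \<gamma>\<^sub>1 * coord (2 * k - 2) w + \<gamma>\<^sub>2 * coord (2 * k - 1) w)"
    and "\<alpha> (k - 2) \<noteq> 0" and "\<beta> (k - 1) \<noteq> 0"
    and "map_germ g" and "immersive g" and "parametrizes g {w. h w = 0}"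
  shows "(\<exists>f :: complex ^ 'm \<Rightarrow> complex ^ 'n.
            is_pullback g (cross_cap k :: complex ^ 'n \<Rightarrow> complex ^ 'p) f) \<and>
         (\<forall>f :: complex ^ 'm \<Rightarrow> complex ^ 'n.
            is_pullback g (cross_cap k :: complex ^ 'n \<Rightarrow> complex ^ 'p) f \<longrightarrow> Ae_cod f = 1)"
proof -
  interpret S: section_pullback k "TYPE('n)" "TYPE('p)" \<alpha> \<beta> \<gamma>\<^sub>1 \<gamma>\<^sub>2 "TYPE('m)"
    by standard (use assms in auto)
  have "S.h = h" unfolding assms(5) by (rule ext) (rule S.h_def)
  then have "\<forall>\<^sub>F w in nhds 0. S.h (g w) = 0"
    using assms(10) by (simp add: parametrizes_def)
  with S.ex_pullback[OF assms(8,9)] S.Ae_cod_pullback[OF assms(8,9)] show ?thesis by blast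
qed

end
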